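(* Let $M$ be a properly infinite von Neumann algebra (no separability assumption). Then the unitary group $\mathrm{U}(M)=\{g\in M\mid gg^*=g^*g=1\}$ has $96$-strong uncountable cofinality.
   Context: For $k\in\mathbb{N}$, a group $G$ has $k$-strong uncountable cofinality if for every countable increasing chain of subsets $W_1\subseteq W_2\subseteq\ldots\subseteq G$ with $G=\bigcup_{n\in\mathbb{N}}W_n$ there exists $n\in\mathbb{N}$ such that $G=W_n^k$, where $W_n^k=\{w_1\cdots w_k\mid w_i\in W_n \text{ for } 1\leq i\leq k\}$ (so $k$ does not depend on the chain). Two projections $p,q$ in a von Neumann algebra $M$ are equivalent if there is a partial isometry $x\in M$ with $x^*x=p$ and $xx^*=q$. A von Neumann algebra is properly infinite if every nonzero central projection in $M$ is equivalent to some proper subprojection of itself. *)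

theory Defs
  imports "HOL-Analysis.Analysis" "HOL-Algebra.Group"
begin

section \<open>Complex Hilbert spaces\<close>

text \<open>
  A complex Hilbert space is a real Hilbert space in the sense of the library (so that norm,
  topology and bounded operators are the library's) together with a complex scalar multiplication
  and a complex inner product, linear in the first argument, whose real part is the given
  real inner product. No separability is required, and the zero space is allowed.
\<close>

class chilbert_space = real_inner + banach +
  fixes scaleC :: "complex \<Rightarrow> 'a \<Rightarrow> 'a" (infixr \<open>*\<^sub>C\<close> 75)
    and cinner :: "'a \<Rightarrow> 'a \<Rightarrow> complex"
  assumes scaleC_add_right: "c *\<^sub>C (x + y) = c *\<^sub>C x + c *\<^sub>C y"
    and scaleC_add_left: "(c + d) *\<^sub>C x = c *\<^sub>C x + d *\<^sub>C x"
    and scaleC_scaleC: "c *\<^sub>C d *\<^sub>C x = (c * d) *\<^sub>C x"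
    and scaleR_eq_scaleC: "r *\<^sub>R x = complex_of_real r *\<^sub>C x"
    and cinner_commute: "cinner x y = cnj (cinner y x)"
    and cinner_add_left: "cinner (x + y) z = cinner x z + cinner y z"
    and cinner_scaleC_left: "cinner (c *\<^sub>C x) y = c * cinner x y"
    and inner_eq_Re_cinner: "inner x y = Re (cinner x y)"


section \<open>Bounded operators\<close>

text \<open>
  The type \<open>'h \<Rightarrow>\<^sub>L 'h\<close> consists of the bounded real-linear operators; the algebra \<open>B(H)\<close> of
  bounded complex-linear operators is the following subset.
\<close>

definition bounded_ops :: "('h::chilbert_space \<Rightarrow>\<^sub>L 'h) set" where
  "bounded_ops = {T. \<forall>c x. blinfun_apply T (c *\<^sub>C x) = c *\<^sub>C blinfun_apply T x}"

definition hilbert_adjoint :: "('h::chilbert_space \<Rightarrow>\<^sub>L 'h) \<Rightarrow> ('h \<Rightarrow>\<^sub>L 'h)" where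
  "hilbert_adjoint T = (THE S. \<forall>x y. cinner (blinfun_apply T x) y = cinner x (blinfun_apply S y))"

definition commutant :: "('h::chilbert_space \<Rightarrow>\<^sub>L 'h) set \<Rightarrow> ('h \<Rightarrow>\<^sub>L 'h) set" where
  "commutant M = {T \<in> bounded_ops. \<forall>S\<in>M. T o\<^sub>L S = S o\<^sub>L T}"


section \<open>Von Neumann algebras\<close>

text \<open>
  Von Neumann algebras are taken concretely: self-adjoint sets of bounded operators on a complex
  Hilbert space that equal their own bicommutant. That such a set is a subalgebra containing
  the identity operator is automatic, commutants being unital subalgebras of \<open>B(H)\<close>.
\<close>

definition von_neumann_algebra :: "('h::chilbert_space \<Rightarrow>\<^sub>L 'h) set \<Rightarrow> bool" where
  "von_neumann_algebra M \<longleftrightarrow>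
     M \<subseteq> bounded_ops \<and> (\<forall>T\<in>M. hilbert_adjoint T \<in> M) \<and> commutant (commutant M) = M"

definition projections :: "('h::chilbert_space \<Rightarrow>\<^sub>L 'h) set \<Rightarrow> ('h \<Rightarrow>\<^sub>L 'h) set" where
  "projections M = {p \<in> M. hilbert_adjoint p = p \<and> p o\<^sub>L p = p}"

definition central_projections :: "('h::chilbert_space \<Rightarrow>\<^sub>L 'h) set \<Rightarrow> ('h \<Rightarrow>\<^sub>L 'h) set" where
  "central_projections M = {z \<in> projections M. \<forall>T\<in>M. z o\<^sub>L T = T o\<^sub>L z}"

definition partial_isometry :: "('h::chilbert_space \<Rightarrow>\<^sub>L 'h) \<Rightarrow> bool" where
  "partial_isometry x \<longleftrightarrow> x o\<^sub>L hilbert_adjoint x o\<^sub>L x = x"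

definition equivalent_projections ::
    "('h::chilbert_space \<Rightarrow>\<^sub>L 'h) set \<Rightarrow> ('h \<Rightarrow>\<^sub>L 'h) \<Rightarrow> ('h \<Rightarrow>\<^sub>L 'h) \<Rightarrow> bool" where
  "equivalent_projections M p q \<longleftrightarrow>
     (\<exists>x\<in>M. partial_isometry x \<and> hilbert_adjoint x o\<^sub>L x = p \<and> x o\<^sub>L hilbert_adjoint x = q)"

text \<open>For projections, \<open>q \<le> p\<close> means that the range of \<open>q\<close> lies in that of \<open>p\<close>, i.e. \<open>p q = q\<close>.\<close>

definition proper_subprojection ::
    "('h::chilbert_space \<Rightarrow>\<^sub>L 'h) \<Rightarrow> ('h \<Rightarrow>\<^sub>L 'h) \<Rightarrow> bool" where
  "proper_subprojection q p \<longleftrightarrow> p o\<^sub>L q = q \<and> q \<noteq> p"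

definition properly_infinite :: "('h::chilbert_space \<Rightarrow>\<^sub>L 'h) set \<Rightarrow> bool" where
  "properly_infinite M \<longleftrightarrow>
     (\<forall>z\<in>central_projections M. z \<noteq> 0 \<longrightarrow>
        (\<exists>q\<in>projections M. proper_subprojection q z \<and> equivalent_projections M z q))"

definition unitary_group :: "('h::chilbert_space \<Rightarrow>\<^sub>L 'h) set \<Rightarrow> ('h \<Rightarrow>\<^sub>L 'h) monoid" where
  "unitary_group M =
     \<lparr>carrier = {g \<in> M. g o\<^sub>L hilbert_adjoint g = id_blinfun \<and> hilbert_adjoint g o\<^sub>L g = id_blinfun},
      mult = (o\<^sub>L), one = id_blinfun\<rparr>"


section \<open>Strong uncountable cofinality\<close>

definition set_power :: "('g, 'm) monoid_scheme \<Rightarrow> 'g set \<Rightarrow> nat \<Rightarrow> 'g set" where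
  "set_power G W k =
     {foldr (\<lambda>w v. w \<otimes>\<^bsub>G\<^esub> v) ws \<one>\<^bsub>G\<^esub> | ws. length ws = k \<and> set ws \<subseteq> W}"

definition strong_uncountable_cofinality :: "nat \<Rightarrow> ('g, 'm) monoid_scheme \<Rightarrow> bool" where
  "strong_uncountable_cofinality k G \<longleftrightarrow>
     group G \<and>
     (\<forall>W :: nat \<Rightarrow> 'g set.
        (\<forall>n. W n \<subseteq> carrier G) \<and> (\<forall>n. W n \<subseteq> W (Suc n)) \<and> (\<Union>n. W n) = carrier G \<longrightarrow>
        (\<exists>n. set_power G (W n) k = carrier G))"

end

theory Submission
  imports Defs
begin

text \<open>
  Comparison theory provides isometries \<open>\<alpha>, \<beta>\<close> in \<open>M\<close> with orthogonal ranges, and Bergman's diagonal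
  argument provides an isometry \<open>c\<close> and an index \<open>n\<close> such that every unitary \<open>u\<close> of \<open>M\<close> has a lift
  \<open>w\<close> in \<open>W n\<close> with \<open>w c = c u\<close>. Conjugating one of two lifts by a fixed symmetry makes their supports
  meet in a corner only, and every unitary of a corner is a commutator via a bilateral shift; hence
  a set that contains finitely many fixed symmetries covers all unitaries supported under a fixed
  projection \<open>d d\<^sup>*\<close> in 8 steps, and all unitaries fixing a suitable isometry with range below
  \<open>d d\<^sup>*\<close> in 26 steps.

  For arbitrary \<open>u\<close> one looks for isometries \<open>S, T\<close> with ranges below \<open>d d\<^sup>*\<close> and \<open>S\<^sup>* T = 0 = T\<^sup>* u S\<close>.
  Then the symmetry exchanging \<open>S\<close> and \<open>T\<close>, one exchanging halves of \<open>T\<close> and \<open>u S\<close>, and a unitary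
  fixing half of \<open>S\<close> multiply to \<open>u\<close>, which takes \<open>8 + 26 + 26 = 60 \<le> 96\<close> steps. The existence of
  \<open>S\<close> and \<open>T\<close> reduces to a self-adjoint operator, where it follows by a maximality argument.
\<close>

section \<open>Algebras with a proper involution\<close>

text \<open>A lift \<open>w\<close> of \<open>u\<close> is prescribed only on the range of
  \<open>c\<close>; on the complement it is arbitrary, because the diagonal argument gives no hold
  there. This is the obstacle: a commutator of two lifts is of use only if each is trivial where the
  other is uncontrolled. Conjugation by the symmetry \<open>g\<close> arranges this, at the price of
  the word \<open>A g B g A' g B' g\<close> with \<open>A' = star A\<close> and
  \<open>B' = star B\<close>, whence 8. The 26 is 8 + 1 + 8 + 1 + 8: a word of length 8, conjugated
  by a member of the set and by another word of length 8. Since adjoints of lifts occur, the chain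
  is first replaced by its symmetric parts. The algebra need not be a factor, so projections are
  comparable only up to a central splitting, and the pieces have to be glued again after each
  comparison. The abstract part works mostly with annihilators; limits of operators occur only when
  bicommutants are shown to satisfy \<open>vn_algebra\<close>. The class uses
  \<open>monoid_mult\<close> instead of a unital ring with \<open>0\<close> distinct from
  \<open>1\<close>, so that operators on the zero space are included.\<close>

class cstar_ring = real_normed_algebra + monoid_mult +
  fixes star :: "'a \<Rightarrow> 'a"
  assumes star_add [simp]: "star (x + y) = star x + star y"
    and star_mult [simp]: "star (x * y) = star y * star x"
    and star_star [simp]: "star (star x) = x"
    and star_scaleR [simp]: "star (r *\<^sub>R x) = r *\<^sub>R star x"
    and norm_star_mult_self: "norm (star x * x) = (norm x)\<^sup>2"

lemma star_zero [simp]: "star 0 = (0 :: 'a::cstar_ring)"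
  using star_scaleR[of 0 "0 :: 'a"] by simp

lemma star_minus [simp]: "star (- x) = - star x"
  using star_scaleR[of "-1" x] by simp

lemma star_diff [simp]: "star (x - y) = star x - star y"
  using star_add[of x "- y"] by simp

lemma star_one [simp]: "star 1 = (1 :: 'a::cstar_ring)"
proof -
  have "star (1 * star (1 :: 'a::cstar_ring)) = 1 * star 1" by (simp only: star_mult star_star)
  then show ?thesis by simp
qed

lemma star_eq_iff [simp]: "star x = star y \<longleftrightarrow> x = y"
  by (metis star_star)

lemma star_eq_0_iff [simp]: "star x = 0 \<longleftrightarrow> x = 0"
  by (metis star_zero star_star)

lemma star_mult_self_eq_0_iff [simp]: "star x * x = 0 \<longleftrightarrow> x = 0"
  using norm_star_mult_self[of x] by (metis mult_zero_right norm_eq_zero zero_eq_power2)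

lemma star_power [simp]: "star (x ^ n) = star x ^ n"
  by (induction n) (auto simp: power_commutes)

text \<open>Products are normalised to the right, so an equation for \<open>x * y\<close> fires
  inside a longer product only in this prolonged form.\<close>

lemma mult_assoc_rewrite:
  fixes x y w c :: "'a::semigroup_mult"
  shows "x * y = c \<Longrightarrow> x * (y * w) = c * w"
  by (metis mult.assoc)

lemma mult_assoc_rewrite2:
  fixes x y u w c :: "'a::semigroup_mult"
  shows "x * (y * u) = c \<Longrightarrow> x * (y * (u * w)) = c * w"
  by (metis mult.assoc)

text \<open>Orthogonality kills the cross terms, so \<open>p + q\<close> and \<open>p - q\<close>
  have the same \<open>star x * x\<close>; the C*-identity turns this into equality of
  norms.\<close>

lemma norm_add_eq_norm_diff:
  fixes p q :: "'a::cstar_ring"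
  assumes "star p * q = 0"
  shows "norm (p + q) = norm (p - q)"
proof -
  have qp: "star q * p = 0"
    using arg_cong[OF assms, of star] by simp
  have "star (p + q) * (p + q) = star (p - q) * (p - q)"
    using assms qp by (simp add: algebra_simps)
  then show ?thesis
    by (metis norm_star_mult_self norm_ge_zero power2_eq_imp_eq)
qed

definition proj :: "'a::cstar_ring \<Rightarrow> bool" where
  "proj p \<longleftrightarrow> star p = p \<and> p * p = p"

definition pisom :: "'a::cstar_ring \<Rightarrow> bool" where
  "pisom v \<longleftrightarrow> v * star v * v = v"

lemma pisomD: "pisom v \<Longrightarrow> v * (star v * v) = v"
  by (simp add: pisom_def mult.assoc)

lemma pisom_star: "pisom v \<Longrightarrow> pisom (star v)"
  unfolding pisom_def by (metis mult.assoc star_mult star_star)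

lemma proj_initial: "pisom v \<Longrightarrow> proj (star v * v)"
  by (simp add: proj_def pisomD mult.assoc)

lemma proj_final: "pisom v \<Longrightarrow> proj (v * star v)"
  using proj_initial[OF pisom_star] by simp

lemma proj_compl: "proj p \<Longrightarrow> proj (1 - p)"
  by (simp add: proj_def algebra_simps)

text \<open>The involution is proper: with \<open>a = star v * v\<close> the element
  \<open>v * a - v\<close> has square \<open>a - 2 a + a = 0\<close> under
  \<open>star x * x\<close>.\<close>

lemma mult_initial_proj:
  assumes "proj (star v * v)"
  shows "v * (star v * v) = v"
proof -
  let ?a = "star v * v"
  have a: "?a * ?a = ?a" "star ?a = ?a" using assms by (auto simp: proj_def)
  have "star (v * ?a - v) * (v * ?a - v) = ?a * ?a * ?a - ?a * ?a - ?a * ?a + ?a"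
    by (simp add: algebra_simps)
  also have "\<dots> = 0" by (simp add: a)
  finally show ?thesis by (simp only: star_mult_self_eq_0_iff) simp
qed

lemma pisom_iff: "pisom v \<longleftrightarrow> proj (star v * v)"
  using mult_initial_proj proj_initial by (auto simp: pisom_def mult.assoc)

lemma proj_fix_star: "proj p \<Longrightarrow> p * v = v \<Longrightarrow> star v * p = star v"
  by (metis proj_def star_mult)

text \<open>Zorn's lemma in the form shared by the three exhaustion arguments. \<open>R\<close> may
  be asymmetric, hence the two-sided demand on a new element. Concluding \<open>x \<in> F\<close>
  gives the contradiction later: an \<open>x\<close> orthogonal to all members is then orthogonal to
  itself.\<close>

lemma maximal_clique:
  obtains F where "\<And>x. x \<in> F \<Longrightarrow> P x"
    and "\<And>x y. x \<in> F \<Longrightarrow> y \<in> F \<Longrightarrow> x \<noteq> y \<Longrightarrow> R x y"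
    and "\<And>x. P x \<Longrightarrow> (\<And>y. y \<in> F \<Longrightarrow> R x y \<and> R y x) \<Longrightarrow> x \<in> F"
proof -
  define A where "A = {F. (\<forall>x\<in>F. P x) \<and> (\<forall>x\<in>F. \<forall>y\<in>F. x \<noteq> y \<longrightarrow> R x y)}"
  have "\<exists>F\<in>A. \<forall>X\<in>A. F \<subseteq> X \<longrightarrow> X = F"
  proof (rule subset_Zorn')
    fix C assume C: "subset.chain A C"
    show "\<Union>C \<in> A"
      unfolding A_def
    proof (intro CollectI conjI ballI impI)
      show "P x" if "x \<in> \<Union>C" for x
        using C that by (auto simp: subset_chain_def A_def)
      fix x y assume "x \<in> \<Union>C" "y \<in> \<Union>C" "x \<noteq> y"
      then obtain X Y where XY: "X \<in> C" "Y \<in> C" "x \<in> X" "y \<in> Y" by auto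
      then have "X \<subseteq> Y \<or> Y \<subseteq> X" "X \<in> A" "Y \<in> A"
        using C by (auto simp: subset_chain_def)
      then show "R x y"
        using XY \<open>x \<noteq> y\<close> by (auto simp: A_def)
    qed
  qed
  then obtain F where F: "F \<in> A" "\<And>X. X \<in> A \<Longrightarrow> F \<subseteq> X \<Longrightarrow> X = F" by blast
  show thesis
  proof
    show "P x" if "x \<in> F" for x using F(1) that by (auto simp: A_def)
    show "R x y" if "x \<in> F" "y \<in> F" "x \<noteq> y" for x y
      using F(1) that by (auto simp: A_def)
    fix x assume x: "P x" "\<And>y. y \<in> F \<Longrightarrow> R x y \<and> R y x"
    have "insert x F \<in> A" using x F(1) by (auto simp: A_def)
    then show "x \<in> F" using F(2)[of "insert x F"] by auto
  qed
qed

section \<open>Comparison theory in a Baer algebra with polar decomposition\<close>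

text \<open>The facts about von Neumann algebras on which the algebraic part rests, phrased through
  annihilators. \<open>orthogonal_sum\<close> is the strong sum of pairwise orthogonal partial
  isometries, \<open>polar\<close> keeps only the annihilators of the polar part, and the last bound
  in \<open>absolute_value\<close> places the spectrum of \<open>a\<close> in \<open>[0, r]\<close>,
  which encodes positivity without an order.\<close>

locale vn_algebra =
  fixes M :: "'a::cstar_ring set"
  assumes one_mem [simp]: "1 \<in> M"
    and add_mem [simp]: "x \<in> M \<Longrightarrow> y \<in> M \<Longrightarrow> x + y \<in> M"
    and mult_mem [simp]: "x \<in> M \<Longrightarrow> y \<in> M \<Longrightarrow> x * y \<in> M"
    and scaleR_mem [simp]: "x \<in> M \<Longrightarrow> r *\<^sub>R x \<in> M"
    and star_mem [simp]: "x \<in> M \<Longrightarrow> star x \<in> M"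
    and baer: "F \<subseteq> M \<Longrightarrow> \<exists>p\<in>M. proj p \<and> (\<forall>x\<in>F. p * x = x) \<and>
      (\<forall>y\<in>M. (\<forall>x\<in>F. y * x = 0) \<longrightarrow> y * p = 0)"
    and orthogonal_sum: "F \<subseteq> M \<Longrightarrow> \<forall>v\<in>F. pisom v \<Longrightarrow>
      \<forall>v\<in>F. \<forall>w\<in>F. v \<noteq> w \<longrightarrow> star v * w = 0 \<and> v * star w = 0 \<Longrightarrow>
      \<exists>X\<in>M. (\<forall>v\<in>F. X * star v = v * star v \<and> star v * X = star v * v) \<and>
        (\<forall>y\<in>M. (\<forall>v\<in>F. y * v = 0) \<longrightarrow> y * X = 0) \<and>
        (\<forall>y\<in>M. (\<forall>v\<in>F. v * y = 0) \<longrightarrow> X * y = 0)"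
    and polar: "x \<in> M \<Longrightarrow> \<exists>v\<in>M. pisom v \<and> (\<forall>y\<in>M. y * x = 0 \<longleftrightarrow> y * v = 0) \<and>
      (\<forall>y\<in>M. x * y = 0 \<longleftrightarrow> v * y = 0)"
    and absolute_value: "x \<in> M \<Longrightarrow> star x = x \<Longrightarrow> norm x \<le> r \<Longrightarrow>
      \<exists>a\<in>M. star a = a \<and> a * x = x * a \<and> a * a = x * x \<and> norm (a - (r / 2) *\<^sub>R 1) \<le> r / 2"
begin

lemma zero_mem [simp]: "0 \<in> M"
  using scaleR_mem[of 1 0] by simp

lemma minus_mem [simp]: "x \<in> M \<Longrightarrow> - x \<in> M"
  using scaleR_mem[of x "-1"] by simp

lemma diff_mem [simp]: "x \<in> M \<Longrightarrow> y \<in> M \<Longrightarrow> x - y \<in> M"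
  using add_mem[of x "- y"] by simp

lemma power_mem [simp]: "x \<in> M \<Longrightarrow> x ^ n \<in> M"
  by (induction n) auto

definition central :: "'a \<Rightarrow> bool" where
  "central z \<longleftrightarrow> z \<in> M \<and> proj z \<and> (\<forall>m\<in>M. z * m = m * z)"

lemma centralD: "central z \<Longrightarrow> z \<in> M" "central z \<Longrightarrow> proj z"
    "central z \<Longrightarrow> m \<in> M \<Longrightarrow> m * z = z * m"
    "central z \<Longrightarrow> z * z = z" "central z \<Longrightarrow> star z = z"
  by (auto simp: central_def proj_def)

lemma central_compl: "central z \<Longrightarrow> central (1 - z)"
  by (auto simp: central_def proj_compl algebra_simps)

lemma central_one: "central 1"
  by (auto simp: central_def proj_def)

lemma central_mult:
  assumes "central z" "central w"
  shows "central (z * w)"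
proof -
  have wz: "w * z = z * w" using centralD(3)[OF assms(1) centralD(1)[OF assms(2)]] .
  moreover have "z * w * (z * w) = z * w"
    using assms by (metis centralD(1,3,4) mult.assoc)
  moreover have "z * w * m = m * (z * w)" if "m \<in> M" for m
    using assms that by (metis centralD(3) mult.assoc)
  moreover have "star (z * w) = z * w"
    using wz by (simp add: centralD(5)[OF assms(1)] centralD(5)[OF assms(2)])
  moreover have "z * w \<in> M"
    using centralD(1)[OF assms(1)] centralD(1)[OF assms(2)] by simp
  ultimately show ?thesis
    unfolding central_def proj_def by blast
qed

text \<open>Murray-von Neumann subequivalence: \<open>b * v = v\<close> puts the range of
  \<open>v\<close> below \<open>b\<close>, so \<open>v\<close> carries \<open>a\<close> onto a part
  of \<open>b\<close>.\<close>

definition mvle :: "'a \<Rightarrow> 'a \<Rightarrow> bool" (infix "\<preceq>" 50) where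
  "a \<preceq> b \<longleftrightarrow> (\<exists>v\<in>M. star v * v = a \<and> b * v = v)"

lemma mvleI: "v \<in> M \<Longrightarrow> star v * v = a \<Longrightarrow> b * v = v \<Longrightarrow> a \<preceq> b"
  by (auto simp: mvle_def)

lemma mvle_proj: "p \<in> M \<Longrightarrow> proj p \<Longrightarrow> q * p = p \<Longrightarrow> p \<preceq> q"
  by (rule mvleI[of p]) (auto simp: proj_def)

lemma mvle_trans:
  assumes "a \<preceq> b" "b \<preceq> c"
  shows "a \<preceq> c"
proof -
  obtain u v where "u \<in> M" "v \<in> M" "star u * u = b" "c * u = u" "star v * v = a" "b * v = v"
    using assms by (auto simp: mvle_def)
  then show ?thesis
    by (intro mvleI[of "u * v"]) (simp_all, (metis mult.assoc)+)
qed

lemma mvle_mono: "a \<preceq> b \<Longrightarrow> c * b = b \<Longrightarrow> a \<preceq> c"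
  unfolding mvle_def by (metis mult.assoc)

lemma mvle_add:
  assumes "a \<preceq> b" "a' \<preceq> b'" "proj b" "proj b'" "b * b' = 0"
  shows "a + a' \<preceq> b + b'"
proof -
  obtain v v' where v: "v \<in> M" "star v * v = a" "b * v = v" "v' \<in> M" "star v' * v' = a'" "b' * v' = v'"
    using assms by (auto simp: mvle_def)
  have b: "b' * b = 0" using assms(3-5) by (metis proj_def star_mult star_zero)
  have 1: "star v * v' = 0"
  proof -
    have "star v * v' = (star v * b) * (b' * v')"
      using proj_fix_star[OF assms(3) v(3)] v(6) by simp
    also have "\<dots> = star v * (b * b') * v'" by (simp add: mult.assoc)
    finally show ?thesis by (simp add: assms)
  qed
  have 2: "star v' * v = 0"
    using arg_cong[OF 1, of star] by simp
  have 3: "b * v' = 0" "b' * v = 0"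
    by (metis assms(5) mult.assoc mult_zero_left v(6)) (metis b mult.assoc mult_zero_left v(3))
  show ?thesis
    by (rule mvleI[of "v + v'"]) (use v 1 2 3 in \<open>auto simp: algebra_simps\<close>)
qed

lemma mvle_central:
  assumes "a \<preceq> b" "central z"
  shows "z * a \<preceq> z * b"
proof -
  obtain v where v: "v \<in> M" "star v * v = a" "b * v = v"
    using assms by (auto simp: mvle_def)
  have zv: "v * z = z * v" using assms(2) v(1) by (rule centralD(3))
  have 1: "star (z * v) * (z * v) = z * a"
  proof -
    have "star (z * v) * (z * v) = star v * (z * z) * v"
      using centralD(5)[OF assms(2)] by (simp add: mult.assoc)
    also have "\<dots> = star v * v * z" using zv by (simp add: centralD[OF assms(2)] mult.assoc)
    also have "\<dots> = z * (star v * v)" using v(1) assms(2) by (simp add: centralD)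
    finally show ?thesis by (simp add: v)
  qed
  have "z * b * (z * v) = z * (b * v) * z" using zv by (simp add: mult.assoc)
  also have "\<dots> = z * z * v" using v zv by (simp add: mult.assoc)
  finally show ?thesis
    using v assms 1 by (intro mvleI[of "z * v"]) (auto simp: centralD)
qed

lemma mvle_central_self: "central z \<Longrightarrow> proj p \<Longrightarrow> p \<in> M \<Longrightarrow> z * p \<preceq> p"
proof (rule mvle_proj)
  assume z: "central z" and p: "proj p" "p \<in> M"
  have c: "p * z = z * p" using z p(2) by (rule centralD(3))
  show *: "p * (z * p) = z * p"
    using p c by (simp add: proj_def mult.assoc flip: mult.assoc[of p z p])
  show "proj (z * p)"
    using p c * centralD(4,5)[OF z] by (simp add: proj_def mult.assoc) (metis mult.assoc)
qed (use centralD in auto)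

lemma mvle_central_le: "central z \<Longrightarrow> proj b \<Longrightarrow> b \<in> M \<Longrightarrow> a \<preceq> b \<Longrightarrow> z * a \<preceq> b"
  using mvle_central mvle_central_self mvle_trans by blast

text \<open>Both copies lie below the same \<open>e\<close> and are still orthogonal:
  \<open>v = z * v\<close> and \<open>v' = w * v'\<close> live in disjoint central summands.\<close>

lemma mvle_add_central:
  assumes "z \<preceq> e" "w \<preceq> e" "central z" "central w" "z * w = 0"
  shows "z + w \<preceq> e"
proof -
  obtain v v' where v: "v \<in> M" "star v * v = z" "e * v = v" "v' \<in> M" "star v' * v' = w" "e * v' = v'"
    using assms by (auto simp: mvle_def)
  have vz: "z * v = v" "w * v' = v'"
    by (metis assms(3) centralD(2,3) mult_initial_proj v(1,2),
        metis assms(4) centralD(2,3) mult_initial_proj v(4,5))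
  have 1: "star v * v' = 0"
  proof -
    have "star v * v' = star v * (z * w) * v'"
      using vz proj_fix_star[OF centralD(2)[OF assms(3)] vz(1)]
      by (metis mult.assoc)
    then show ?thesis by (simp add: assms)
  qed
  have 2: "star v' * v = 0"
    using arg_cong[OF 1, of star] by simp
  show ?thesis
    by (rule mvleI[of "v + v'"]) (use v 1 2 in \<open>auto simp: algebra_simps\<close>)
qed

subsection \<open>Range projections\<close>

text \<open>A projection is recovered from its left annihilator by testing \<open>1 - p\<close> and
  \<open>1 - q\<close>.\<close>

lemma proj_eqI:
  assumes "p \<in> M" "q \<in> M" "proj p" "proj q"
    and "\<And>y. y \<in> M \<Longrightarrow> y * p = 0 \<longleftrightarrow> y * q = 0"
  shows "p = q"
proof -
  have "(1 - p) * q = 0" "(1 - q) * p = 0"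
    using assms(5)[of "1 - p"] assms(5)[of "1 - q"] assms(1-4) by (auto simp: proj_def algebra_simps)
  then have "q = p * q" "p = q * p" by (auto simp: algebra_simps)
  then show ?thesis using assms(3,4) by (metis proj_def star_mult)
qed

definition ran :: "'a \<Rightarrow> 'a" where
  "ran x = (SOME p. p \<in> M \<and> proj p \<and> p * x = x \<and> (\<forall>y\<in>M. y * x = 0 \<longrightarrow> y * p = 0))"

lemma ran:
  assumes "x \<in> M"
  shows ran_mem: "ran x \<in> M" and proj_ran: "proj (ran x)" and ran_mult: "ran x * x = x"
    and mult_ran_eq_0: "\<And>y. y \<in> M \<Longrightarrow> y * x = 0 \<Longrightarrow> y * ran x = 0"
proof -
  have "\<exists>p. p \<in> M \<and> proj p \<and> p * x = x \<and> (\<forall>y\<in>M. y * x = 0 \<longrightarrow> y * p = 0)"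
    using baer[of "{x}"] assms by auto
  from someI_ex[OF this] show "ran x \<in> M" "proj (ran x)" "ran x * x = x"
    "\<And>y. y \<in> M \<Longrightarrow> y * x = 0 \<Longrightarrow> y * ran x = 0"
    unfolding ran_def by auto
qed

lemma mult_ran_iff: "x \<in> M \<Longrightarrow> y \<in> M \<Longrightarrow> y * ran x = 0 \<longleftrightarrow> y * x = 0"
  using ran_mult[of x] mult_ran_eq_0[of x y] by (metis mult.assoc mult_zero_left)

lemma ran_absorb: "x \<in> M \<Longrightarrow> q \<in> M \<Longrightarrow> q * x = x \<Longrightarrow> q * ran x = ran x"
  using mult_ran_eq_0[of x "1 - q"] by (simp add: algebra_simps)

lemma ran_mult_left_eq_0: "x \<in> M \<Longrightarrow> y \<in> M \<Longrightarrow> star x * y = 0 \<Longrightarrow> ran x * y = 0"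
  using mult_ran_eq_0[of x "star y"] proj_ran[of x]
  by (metis proj_def star_eq_0_iff star_mem star_mult star_star)

lemma ran_pisom:
  assumes "v \<in> M" "pisom v"
  shows "ran v = v * star v"
proof (rule proj_eqI)
  show "y * ran v = 0 \<longleftrightarrow> y * (v * star v) = 0" if "y \<in> M" for y
    using mult_ran_iff[OF assms(1) that] assms(2) unfolding pisom_def
    by (metis mult.assoc mult_zero_left)
qed (use assms in \<open>auto simp: ran proj_final\<close>)

text \<open>The polar part \<open>v\<close> of \<open>x\<close> has initial projection
  \<open>ran (star x)\<close>, since it has the right annihilator of \<open>x\<close>, and its range
  lies below \<open>ran x\<close>. Used for \<open>x\<close> and \<open>star x\<close>, this
  replaces equivalence of left and right supports.\<close>

lemma ran_star_mvle:
  assumes "x \<in> M"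
  shows "ran (star x) \<preceq> ran x"
proof -
  obtain v where v: "v \<in> M" "pisom v" "\<forall>y\<in>M. y * x = 0 \<longleftrightarrow> y * v = 0"
    "\<forall>y\<in>M. x * y = 0 \<longleftrightarrow> v * y = 0"
    using polar[OF assms] by auto
  have "ran (star x) = star v * v"
  proof (rule proj_eqI)
    fix y assume y: "y \<in> M"
    have "y * ran (star x) = 0 \<longleftrightarrow> y * star x = 0" using assms y by (simp add: mult_ran_iff)
    also have "\<dots> \<longleftrightarrow> x * star y = 0" by (metis star_eq_0_iff star_mult star_star)
    also have "\<dots> \<longleftrightarrow> v * star y = 0" using v y by simp
    also have "\<dots> \<longleftrightarrow> y * star v = 0" by (metis star_eq_0_iff star_mult star_star)
    also have "\<dots> \<longleftrightarrow> y * (star v * v) = 0"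
    proof
      assume "y * star v = 0"
      then show "y * (star v * v) = 0" by (simp flip: mult.assoc)
    next
      assume "y * (star v * v) = 0"
      then have "y * (star v * v) * star v = 0" by simp
      then show "y * star v = 0" using pisomD[OF pisom_star[OF v(2)]] by (simp add: mult.assoc)
    qed
    finally show "y * ran (star x) = 0 \<longleftrightarrow> y * (star v * v) = 0" .
  qed (use assms v in \<open>auto simp: ran proj_initial\<close>)
  moreover have "ran x * v = v"
    using ran_mult[OF assms] ran_mem[OF assms] v(3)[rule_format, of "1 - ran x"]
    by (simp add: algebra_simps)
  ultimately show ?thesis using v(1) by (intro mvleI[of v]) auto
qed

subsection \<open>The comparison theorem\<close>

lemma initial_proj_eqI:
  assumes "x \<in> M" "y \<in> M" "pisom x" "pisom y"
    and "\<And>u. u \<in> M \<Longrightarrow> x * u = 0 \<longleftrightarrow> y * u = 0"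
  shows "star x * x = star y * y"
proof (rule proj_eqI)
  have *: "u * (star v * v) = 0 \<longleftrightarrow> v * star u = 0" if "pisom v" for u v :: 'a
  proof
    assume "u * (star v * v) = 0"
    then have "star (u * (star v * v)) = 0" by simp
    then have "v * (star v * (v * star u)) = 0" by (simp add: mult.assoc)
    then show "v * star u = 0" using pisomD[OF that] by (metis mult.assoc)
  next
    assume "v * star u = 0"
    then have "star (star v * (v * star u)) = 0" by simp
    then show "u * (star v * v) = 0" by (simp add: mult.assoc)
  qed
  show "u * (star x * x) = 0 \<longleftrightarrow> u * (star y * y) = 0" if "u \<in> M" for u
    using * assms(3-5) that by simp
qed (use assms in \<open>auto simp: proj_initial\<close>)

text \<open>\<open>X\<close> is the strong sum of the \<open>f i\<close>: the equations fix it on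
  each initial and final projection, and the annihilator clauses say that nothing of it lies outside
  these.\<close>

definition sum_of :: "('i \<Rightarrow> 'a) \<Rightarrow> 'i set \<Rightarrow> 'a \<Rightarrow> bool" where
  "sum_of f I X \<longleftrightarrow> X \<in> M \<and> pisom X \<and>
     (\<forall>i\<in>I. pisom (f i) \<and> X * star (f i) = f i * star (f i) \<and> star (f i) * X = star (f i) * f i) \<and>
     (\<forall>y\<in>M. (\<forall>i\<in>I. y * f i = 0) \<longrightarrow> y * X = 0) \<and>
     (\<forall>y\<in>M. (\<forall>i\<in>I. f i * y = 0) \<longrightarrow> X * y = 0)"

lemma sum_ofD:
  assumes "sum_of f I X"
  shows "X \<in> M" "pisom X"
    "i \<in> I \<Longrightarrow> X * star (f i) = f i * star (f i)"
    "i \<in> I \<Longrightarrow> star (f i) * X = star (f i) * f i"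
    "i \<in> I \<Longrightarrow> star X * f i = star (f i) * f i"
    "i \<in> I \<Longrightarrow> X * star (f i) * f i = f i"
    "y \<in> M \<Longrightarrow> (\<And>i. i \<in> I \<Longrightarrow> y * f i = 0) \<Longrightarrow> y * X = 0"
    "y \<in> M \<Longrightarrow> (\<And>i. i \<in> I \<Longrightarrow> f i * y = 0) \<Longrightarrow> X * y = 0"
proof -
  show "X * star (f i) * f i = f i" if "i \<in> I"
    using assms that by (simp add: sum_of_def pisom_def)
  show "star X * f i = star (f i) * f i" if "i \<in> I"
  proof -
    have "star (star (f i) * X) = star (star (f i) * f i)" using assms that by (simp add: sum_of_def)
    then show ?thesis by simp
  qed
qed (use assms in \<open>auto simp: sum_of_def\<close>)

lemma sum_of_mult_eq_0_iff:
  assumes X: "sum_of f I X" and y: "y \<in> M"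
  shows "X * y = 0 \<longleftrightarrow> (\<forall>i\<in>I. star (f i) * f i * y = 0)"
proof
  assume Xy: "X * y = 0"
  have "star (f i) * f i * y = star (f i) * (X * y)" if "i \<in> I" for i
    using sum_ofD(4)[OF X that] by (simp flip: mult.assoc)
  then show "\<forall>i\<in>I. star (f i) * f i * y = 0" using Xy by simp
next
  assume *: "\<forall>i\<in>I. star (f i) * f i * y = 0"
  have "f i * y = f i * (star (f i) * f i * y)" if "i \<in> I" for i
    using X that by (simp add: sum_of_def pisom_def flip: mult.assoc)
  then show "X * y = 0" using * by (intro sum_ofD(8)[OF X y]) simp
qed

text \<open>The right annihilator of a sum depends only on the initial projections of its
  members.\<close>

lemma sum_of_initial_eq:
  assumes X: "sum_of f I X" and Y: "sum_of g I Y"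
    and eq: "\<And>i. i \<in> I \<Longrightarrow> star (f i) * f i = star (g i) * g i"
  shows "star X * X = star Y * Y"
  by (rule initial_proj_eqI)
     (use sum_ofD(1,2)[OF X] sum_ofD(1,2)[OF Y] eq in
       \<open>simp_all add: sum_of_mult_eq_0_iff[OF X] sum_of_mult_eq_0_iff[OF Y]\<close>)

lemma orthogonal_sum_family:
  assumes "\<And>i. i \<in> I \<Longrightarrow> f i \<in> M" "\<And>i. i \<in> I \<Longrightarrow> pisom (f i)"
    and "\<And>i j. i \<in> I \<Longrightarrow> j \<in> I \<Longrightarrow> i \<noteq> j \<Longrightarrow> star (f i) * f j = 0"
    and "\<And>i j. i \<in> I \<Longrightarrow> j \<in> I \<Longrightarrow> i \<noteq> j \<Longrightarrow> f i * star (f j) = 0"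
  obtains X where "sum_of f I X"
proof -
  have "\<exists>X\<in>M. (\<forall>v\<in>f ` I. X * star v = v * star v \<and> star v * X = star v * v) \<and>
        (\<forall>y\<in>M. (\<forall>v\<in>f ` I. y * v = 0) \<longrightarrow> y * X = 0) \<and>
        (\<forall>y\<in>M. (\<forall>v\<in>f ` I. v * y = 0) \<longrightarrow> X * y = 0)"
  proof (intro orthogonal_sum ballI impI)
    fix v w assume "v \<in> f ` I" "w \<in> f ` I" "v \<noteq> w"
    then obtain i j where "i \<in> I" "j \<in> I" "v = f i" "w = f j" "i \<noteq> j" by auto
    then show "star v * w = 0 \<and> v * star w = 0" using assms(3,4) by simp
  qed (use assms(1,2) in auto)
  then obtain X where X: "X \<in> M" "\<And>i. i \<in> I \<Longrightarrow> X * star (f i) = f i * star (f i)"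
    "\<And>i. i \<in> I \<Longrightarrow> star (f i) * X = star (f i) * f i"
    "\<And>y. y \<in> M \<Longrightarrow> (\<And>i. i \<in> I \<Longrightarrow> y * f i = 0) \<Longrightarrow> y * X = 0"
    "\<And>y. y \<in> M \<Longrightarrow> (\<And>i. i \<in> I \<Longrightarrow> f i * y = 0) \<Longrightarrow> X * y = 0"
    by auto
  have 1: "X * star (f i) * f i = f i" if "i \<in> I" for i
    using assms(2)[OF that] X(2)[OF that] by (simp add: pisom_def)
  have 2: "star X * f i = star (f i) * f i" if "i \<in> I" for i
    using arg_cong[OF X(3)[OF that], of star] by simp
  \<comment> \<open>\<open>1 - X * star X\<close> annihilates every \<open>f i\<close>, hence also
    their sum; this makes \<open>X\<close> a partial isometry.\<close>
  have "(1 - X * star X) * X = 0"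
    using X(1) 1 2 by (intro X(4)) (auto simp: algebra_simps)
  then have "pisom X" by (simp add: pisom_def algebra_simps)
  then show thesis by (intro that[of X]) (use X assms(2) in \<open>auto simp: sum_of_def\<close>)
qed

text \<open>\<open>z\<close> is the range projection of the left ideal \<open>M a\<close>. Its range
  is invariant under \<open>M\<close>, so \<open>z n z = n z\<close> for all \<open>n\<close>; the
  same for \<open>star n\<close> gives \<open>z n z = z n\<close>.\<close>

lemma central_support:
  assumes a: "a \<in> M"
  obtains z where "central z" "z * a = a"
    "\<And>y. y \<in> M \<Longrightarrow> (\<And>m. m \<in> M \<Longrightarrow> y * (m * a) = 0) \<Longrightarrow> y * z = 0"
proof -
  have "{m * a |m. m \<in> M} \<subseteq> M" using a by auto
  from baer[OF this] obtain z where z: "z \<in> M" "proj z"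
    and zfix: "\<And>m. m \<in> M \<Longrightarrow> z * (m * a) = m * a"
    and ann: "\<And>y. y \<in> M \<Longrightarrow> (\<And>m. m \<in> M \<Longrightarrow> y * (m * a) = 0) \<Longrightarrow> y * z = 0"
    by blast
  have zinv: "z * n * z = n * z" if n: "n \<in> M" for n
  proof -
    have "(1 - z) * n * z = 0"
    proof (rule ann)
      fix m assume "m \<in> M"
      then have "z * (n * m * a) = n * m * a" using n by (intro zfix) simp
      then show "(1 - z) * n * (m * a) = 0" by (simp add: algebra_simps)
    qed (use z n in simp)
    then show ?thesis by (simp add: algebra_simps)
  qed
  have zcomm: "z * n = n * z" if n: "n \<in> M" for n
  proof -
    have "z * n * z = n * z" using n by (rule zinv)
    moreover have "star (z * star n * z) = star (star n * z)"
      using zinv[of "star n"] n by (simp only: star_mem)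
    then have "z * n * z = z * n" using z(2) by (simp add: proj_def mult.assoc)
    ultimately show ?thesis by simp
  qed
  show thesis
  proof
    show "central z" unfolding central_def using z zcomm by blast
    show "z * a = a" using zfix[of 1] by simp
  qed (rule ann)
qed

text \<open>A maximal orthogonal family of partial isometries from below \<open>a\<close> to below
  \<open>b\<close> has a sum \<open>X\<close>. Nothing in \<open>M\<close> connects the leftovers
  \<open>a'\<close> and \<open>b'\<close>, so the central support \<open>z\<close> of
  \<open>a'\<close> separates them: \<open>b\<close> is exhausted on \<open>z\<close>, and
  \<open>a\<close> on \<open>1 - z\<close>.\<close>

lemma comparison:
  assumes "a \<in> M" "b \<in> M" "proj a" "proj b"
  obtains z where "central z" "(1 - z) * a \<preceq> b" "z * b \<preceq> a"
proof -
  define P where "P x \<longleftrightarrow> x \<in> M \<and> pisom x \<and> x \<noteq> 0 \<and> b * x = x \<and> x * a = x" for x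
  define R where "R x y \<longleftrightarrow> star x * y = 0 \<and> x * star y = 0" for x y :: 'a
  obtain F where F: "\<And>x. x \<in> F \<Longrightarrow> P x"
    "\<And>x y. x \<in> F \<Longrightarrow> y \<in> F \<Longrightarrow> x \<noteq> y \<Longrightarrow> R x y"
    and Fmax: "\<And>x. P x \<Longrightarrow> (\<And>y. y \<in> F \<Longrightarrow> R x y \<and> R y x) \<Longrightarrow> x \<in> F"
    using maximal_clique[of P R] by blast
  note FP = F(1)[unfolded P_def] and FR = F(2)[unfolded R_def]
  obtain X where sumX: "sum_of (\<lambda>x. x) F X"
    by (rule orthogonal_sum_family[of F "\<lambda>x. x"]) (use FP FR in auto)
  note X = sum_ofD[OF sumX]
  have bX: "b * X = X"
    using X(7)[of "1 - b"] FP assms by (simp add: algebra_simps)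
  have Xa: "X * a = X"
    using X(8)[of "1 - a"] FP assms by (simp add: algebra_simps)
  have aX: "a * star X = star X"
    using Xa assms by (metis proj_def star_mult)
  have Xb: "star X * b = star X"
    using bX assms by (metis proj_def star_mult)
  define a' where "a' = a - star X * X"
  define b' where "b' = b - X * star X"
  have a': "a' \<in> M" "a' * a = a'" "star a' = a'" "X * a' = 0" "a' * star X = 0"
    and b': "b' \<in> M" "b * b' = b'" "star b' = b'" "b' * X = 0" "star X * b' = 0"
  proof -
    have p: "a * a = a" "star a = a" "b * b = b" "star b = b"
      using assms by (auto simp: proj_def)
    have X': "X * (star X * X) = X" "star X * (X * star X) = star X"
      using pisomD[OF X(2)] pisomD[OF pisom_star[OF X(2)]] by simp_all
    note simps = a'_def b'_def algebra_simps p X' bX Xa aX Xb bX[THEN mult_assoc_rewrite]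
    show "a' \<in> M" "a' * a = a'" "star a' = a'" "X * a' = 0" "a' * star X = 0"
      "b' \<in> M" "b * b' = b'" "star b' = b'" "b' * X = 0" "star X * b' = 0"
      using assms X(1) by (simp_all add: simps)
  qed
  \<comment> \<open>The polar part of a nonzero \<open>b' * m * a'\<close> would be orthogonal to
    the whole family and could be added to it.\<close>
  have key: "b' * m * a' = 0" if m: "m \<in> M" for m
  proof (rule ccontr)
    assume nz: "b' * m * a' \<noteq> 0"
    have xM: "b' * m * a' \<in> M" using m a' b' by simp
    obtain v where v: "v \<in> M" "pisom v" "\<forall>y\<in>M. y * (b' * m * a') = 0 \<longleftrightarrow> y * v = 0"
      "\<forall>y\<in>M. (b' * m * a') * y = 0 \<longleftrightarrow> v * y = 0"
      using polar[OF xM] by auto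
    have v0: "v \<noteq> 0" using v(3)[rule_format, of 1] nz by auto
    have bv: "b * v = v"
      using v(3)[rule_format, of "1 - b"] assms(2) b'(1,2)
      by (simp add: algebra_simps b'(2)[THEN mult_assoc_rewrite])
    have va: "v * a = v"
      using v(4)[rule_format, of "1 - a"] assms(1) a'(1,2) by (simp add: algebra_simps)
    have Xv: "star X * v = 0"
      using v(3)[rule_format, of "star X"] X(1) b' by (simp flip: mult.assoc)
    have vX: "v * star X = 0"
      using v(4)[rule_format, of "star X"] X(1) a' by (simp add: mult.assoc)
    have iv: "star i * v = 0" "v * star i = 0" if "i \<in> F" for i
    proof -
      have "star i = star i * i * star i"
        using FP[OF that] by (metis pisom_def star_mult star_star mult.assoc)
      then have 1: "star i = star i * i * star X" "star i = star X * i * star i"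
        using X(3,4,5)[OF that] by (metis mult.assoc star_mult star_star)+
      show "star i * v = 0" using 1(1) Xv by (metis mult.assoc mult_zero_right)
      show "v * star i = 0" using 1(2) vX by (metis mult.assoc mult_zero_left)
    qed
    have "v \<in> F"
    proof (rule Fmax)
      show "R v y \<and> R y v" if "y \<in> F" for y
        using iv[OF that] unfolding R_def by (metis star_eq_0_iff star_mult star_star)
    qed (use v v0 bv va in \<open>auto simp: P_def\<close>)
    then have "star v * v = 0" using iv by blast
    then show False using v0 by simp
  qed
  obtain z where cz: "central z" and za: "z * a' = a'"
    and z: "\<And>y. y \<in> M \<Longrightarrow> (\<And>m. m \<in> M \<Longrightarrow> y * (m * a') = 0) \<Longrightarrow> y * z = 0"
    using central_support[OF a'(1)] by blast
  have zb: "z * b' = 0"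
  proof -
    have "b' * z = 0" using b'(1) key by (intro z) (auto simp: mult.assoc)
    then show ?thesis using centralD(3)[OF cz b'(1)] by simp
  qed
  have c1: "central (1 - z)" using cz by (rule central_compl)
  have "star X * X \<preceq> b" by (rule mvleI[of X]) (use X bX in auto)
  from mvle_central_le[OF c1 assms(4,2) this] have "(1 - z) * (star X * X) \<preceq> b" .
  moreover have "(1 - z) * (star X * X) = (1 - z) * a"
    using za by (simp add: a'_def algebra_simps)
  ultimately have 1: "(1 - z) * a \<preceq> b" by simp
  have "X * star X \<preceq> a" by (rule mvleI[of "star X"]) (use X aX in auto)
  from mvle_central_le[OF cz assms(3,1) this] have "z * (X * star X) \<preceq> a" .
  moreover have "z * (X * star X) = z * b"
    using zb by (simp add: b'_def algebra_simps)
  ultimately have 2: "z * b \<preceq> a" by simp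
  show thesis by (rule that[OF cz 1 2])
qed

end

section \<open>Halving below an infinite central projection\<close>

context vn_algebra
begin

text \<open>The pair \<open>s, t\<close> witnesses that the projection \<open>star s * s\<close> is properly infinite.\<close>

definition halving :: "'a \<Rightarrow> 'a \<Rightarrow> bool" where
  "halving s t \<longleftrightarrow> s \<in> M \<and> t \<in> M \<and> pisom s \<and> star t * t = star s * s \<and>
     star s * t = 0 \<and> star s * s * s = s \<and> star s * s * t = t"

lemma halvingD:
  assumes "halving s t"
  shows "s \<in> M" "t \<in> M" "pisom s" "pisom t" "star t * t = star s * s" "star s * t = 0" "star t * s = 0"
    "star s * s * s = s" "star s * s * t = t" "star s * star s * s = star s" "star t * star s * s = star t"
    "proj (star s * s)"
proof -
  show *: "s \<in> M" "t \<in> M" "pisom s" "star t * t = star s * s" "star s * t = 0"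
    "star s * s * s = s" "star s * s * t = t"
    using assms by (auto simp: halving_def)
  show p: "proj (star s * s)" using *(3) by (rule proj_initial)
  show "pisom t" using *(4) p by (simp add: pisom_iff)
  show "star t * s = 0" using arg_cong[OF *(5), of star] by simp
  show "star s * star s * s = star s" "star t * star s * s = star t"
    using arg_cong[OF *(6), of star] arg_cong[OF *(7), of star] by (simp_all add: mult.assoc)
qed

lemma halving_absorb:
  assumes "halving s t" "a \<in> {s, t}" "p = star s * s"
  shows "a * p = a" "star a * p = star a" "p * a = a" "p * star a = star a"
proof -
  note H = halvingD[OF assms(1)]
  have p: "star p = p" using assms(3) by simp
  have "s * p = s" "t * p = t"
    using pisomD[OF H(3)] pisomD[OF H(4)] H(5) assms(3) by simp_all
  then show 1: "a * p = a" using assms(2) by auto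
  have "p * s = s" "p * t = t" using H(8,9) assms(3) by simp_all
  then show 2: "p * a = a" using assms(2) by auto
  show "star a * p = star a" "p * star a = star a"
    using arg_cong[OF 1, of star] arg_cong[OF 2, of star] p by simp_all
qed

text \<open>Hilbert's hotel: \<open>d = z - w * star w\<close> is a wandering projection of
  \<open>w\<close>, the elements \<open>w ^ m * d * star w ^ n\<close> are matrix units, and the
  maps \<open>n \<mapsto> 2 n\<close> and \<open>n \<mapsto> 2 n + 1\<close> of the indices become
  \<open>s\<close> and \<open>t\<close>.\<close>

lemma halving_seed:
  assumes z: "central z" and w: "w \<in> M" "star w * w = z" "z * (w * star w) = w * star w" "w * star w \<noteq> z"
  obtains s t where "halving s t" "s \<noteq> 0" "z * s = s"
proof -
  note zD = centralD[OF z]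
  have zw: "z * w = w"
  proof -
    have "w * z = w" using mult_initial_proj[of w] w zD(2) by simp
    then show ?thesis using zD(3)[OF w(1)] by simp
  qed
  have wz: "w * z = w" using zw zD(3)[OF w(1)] by simp
  have swz: "star w * z = star w" using arg_cong[OF zw, of star] zD(5) by simp
  have zsw: "z * star w = star w" using arg_cong[OF wz, of star] zD(5) by simp
  define d where "d = z - w * star w"
  have d: "d \<in> M" "star d = d" "d * d = d" "d * w = 0" "z * d = d" "d \<noteq> 0" "star w * d = 0"
    using zD(1) w(1,4)
    by (auto simp: d_def algebra_simps zD(4,5) zw wz swz zsw w(2) w(2)[THEN mult_assoc_rewrite]
        zw[THEN mult_assoc_rewrite] swz[THEN mult_assoc_rewrite])
  have cancel: "star w ^ n * (w ^ n * x) = x" if "z * x = x" for n x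
  proof (induction n)
    case (Suc n)
    have "star w ^ Suc n * (w ^ Suc n * x) = star w ^ n * (star w * w) * (w ^ n * x)"
      by (simp only: power_Suc2[of "star w"] power_Suc[of w] mult.assoc)
    also have "\<dots> = star w ^ n * (z * (w ^ n * x))" by (simp add: w mult.assoc)
    also have "z * (w ^ n * x) = w ^ n * x"
      using that by (cases n) (auto simp: zw[THEN mult_assoc_rewrite] mult.assoc)
    finally show ?case using Suc by simp
  qed auto
  have zero1: "d * (star w ^ n * (w ^ m * d)) = 0" if "n < m" for n m
  proof -
    obtain k where k: "m = n + Suc k" using \<open>n < m\<close> less_iff_Suc_add by auto
    have "star w ^ n * (w ^ n * (w ^ Suc k * d)) = w ^ Suc k * d"
      by (rule cancel) (simp add: zw[THEN mult_assoc_rewrite] mult.assoc)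
    moreover have "w ^ m * d = w ^ n * (w ^ Suc k * d)"
      by (simp only: k power_add mult.assoc)
    ultimately have "d * (star w ^ n * (w ^ m * d)) = d * (w ^ Suc k * d)" by simp
    then show ?thesis by (simp add: mult.assoc d(4)[THEN mult_assoc_rewrite])
  qed
  have zero2: "d * (star w ^ n * (w ^ m * d)) = 0" if "m < n" for n m
    using arg_cong[OF zero1[OF that], of star] d(2) by (simp add: mult.assoc)
  define E where "E m n = w ^ m * (d * star w ^ n)" for m n :: nat
  have EM: "E m n \<in> M" for m n using w d by (simp add: E_def)
  have Estar: "star (E m n) = E n m" for m n using d by (simp add: E_def mult.assoc)
  have Emult: "E m n * E k l = (if n = k then E m l else 0)" for m n k l
  proof -
    have 1: "E m n * E k l = w ^ m * (d * (star w ^ n * (w ^ k * d)) * star w ^ l)"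
      by (simp add: E_def mult.assoc)
    show ?thesis
    proof (cases "n = k")
      case True
      then have "d * (star w ^ n * (w ^ k * d)) = d" using cancel[OF d(5)] d(3) by simp
      then show ?thesis using True 1 by (simp add: E_def)
    next
      case False
      then have "d * (star w ^ n * (w ^ k * d)) = 0" using zero1 zero2 by (meson nat_neq_iff)
      then show ?thesis using False 1 by simp
    qed
  qed
  have E00: "E 0 0 = d" by (simp add: E_def)
  have Epi: "pisom (E m n)" for m n by (simp add: pisom_def Estar Emult)
  define f where "f n = E (2 * n) n" for n
  define g where "g n = E (2 * n + 1) n" for n
  obtain S where sumS: "sum_of f UNIV S"
    by (rule orthogonal_sum_family[of UNIV f]) (auto simp: f_def EM Epi Estar Emult)
  note S = sum_ofD[OF sumS]
  obtain T where sumT: "sum_of g UNIV T"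
    by (rule orthogonal_sum_family[of UNIV g]) (auto simp: g_def EM Epi Estar Emult)
  note T = sum_ofD[OF sumT]
  have 1: "star T * T = star S * S"
    by (rule sum_of_initial_eq[OF sumT sumS]) (simp add: f_def g_def Estar Emult)
  have "star (f i) * T = 0" for i
  proof (rule T(7))
    show "star (f i) * g j = 0" for j
    proof -
      have "2 * i \<noteq> 2 * j + 1" by presburger
      then show ?thesis by (simp add: f_def g_def Estar Emult)
    qed
  qed (simp add: f_def EM)
  then have "star T * f i = 0" for i
    by (metis star_eq_0_iff star_mult star_star)
  then have "star T * S = 0" using T S by (intro S(7)) auto
  then have 2: "star S * T = 0" by (metis star_eq_0_iff star_mult star_star)
  \<comment> \<open>The initial projection of \<open>S\<close> covers the whole ladder of diagonal
    units, even and odd, so \<open>S\<close> and \<open>T\<close> have their ranges below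
    it.\<close>
  have PE: "star S * S * E i i = E i i" for i
  proof -
    have "S * E i i = f i" using S(6)[of i, OF UNIV_I] by (simp add: mult.assoc) (simp add: f_def Estar Emult)
    then show ?thesis using S(5)[of i, OF UNIV_I] by (simp add: mult.assoc) (simp add: f_def Estar Emult)
  qed
  have PE': "star S * S * E i j = E i j" for i j
    using PE[of i] Emult[of i i i j] by (metis mult.assoc)
  have 3: "star S * S * S = S"
    using S(7)[of "1 - star S * S"] S(1) PE' by (simp add: algebra_simps f_def)
  have 4: "star S * S * T = T"
    using T(7)[of "1 - star S * S"] S(1) PE' by (simp add: algebra_simps g_def)
  have zE: "z * E i j = E i j" for i j
    by (cases i) (auto simp: E_def mult.assoc zw[THEN mult_assoc_rewrite] d(5)[THEN mult_assoc_rewrite])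
  have 5: "z * S = S"
    using S(7)[of "1 - z"] zD(1) zE by (simp add: algebra_simps f_def)
  have "S \<noteq> 0" using S(6)[of 0, OF UNIV_I] E00 d(6) by (auto simp: f_def)
  then show thesis using that[of S T] 1 2 3 4 5 S T by (auto simp: halving_def)
qed

end

section \<open>Two isometries with orthogonal ranges\<close>

locale properly_infinite_algebra = vn_algebra +
  assumes infinite_central: "central z \<Longrightarrow> z \<noteq> 0 \<Longrightarrow>
    \<exists>w\<in>M. star w * w = z \<and> z * (w * star w) = w * star w \<and> w * star w \<noteq> z"
begin

text \<open>A maximal family of halving pairs with orthogonal initial projections adds up to a pair
  \<open>S\<close>, \<open>T\<close> that halves \<open>Q\<close>. Maximality gives \<open>Q\<close>
  central support 1 and lets \<open>1 - Q\<close> embed into \<open>Q\<close>; then the whole unit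
  embeds into \<open>Q\<close>, and after halving it does so twice.\<close>

lemma orthogonal_isometries:
  obtains \<alpha> \<beta> where "\<alpha> \<in> M" "\<beta> \<in> M" "star \<alpha> * \<alpha> = 1" "star \<beta> * \<beta> = 1" "star \<alpha> * \<beta> = 0"
proof -
  define P where "P x \<longleftrightarrow> halving (fst x) (snd x) \<and> fst x \<noteq> 0" for x
  \<comment> \<open>Both members of a pair share one initial projection, and their ranges lie below
    it; so comparing first components yields all other orthogonality relations.\<close>
  define R where "R x y \<longleftrightarrow> fst x * star (fst y) = 0" for x y :: "'a \<times> 'a"
  obtain F where FP: "\<And>x. x \<in> F \<Longrightarrow> P x"
    and FR: "\<And>x y. x \<in> F \<Longrightarrow> y \<in> F \<Longrightarrow> x \<noteq> y \<Longrightarrow> R x y"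
    and Fmax: "\<And>x. P x \<Longrightarrow> (\<And>y. y \<in> F \<Longrightarrow> R x y \<and> R y x) \<Longrightarrow> x \<in> F"
    using maximal_clique[of P R] by blast
  have h: "halving (fst x) (snd x)" if "x \<in> F" for x using FP[OF that] by (simp add: P_def)
  have orth: "star a * b = 0 \<and> a * star b = 0"
    if "x \<in> F" "y \<in> F" "x \<noteq> y" "a \<in> {fst x, snd x}" "b \<in> {fst y, snd y}" for x y a b
  proof -
    define p q where "p = star (fst x) * fst x" and "q = star (fst y) * fst y"
    have "p * q = star (fst x) * (fst x * star (fst y)) * fst y" by (simp add: p_def q_def mult.assoc)
    then have pq: "p * q = 0" using FR[OF that(1-3)] by (simp add: R_def)
    have a: "star a * p = star a" "a * p = a"
      by (rule halving_absorb[OF h[OF that(1)] that(4) p_def])+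
    have b: "q * b = b" "q * star b = star b"
      by (rule halving_absorb[OF h[OF that(2)] that(5) q_def])+
    have "star a * b = (star a * p) * (q * b)" "a * star b = (a * p) * (q * star b)"
      using a b by simp_all
    moreover have "(star a * p) * (q * b) = star a * (p * q) * b"
      "(a * p) * (q * star b) = a * (p * q) * star b" by (simp_all add: mult.assoc)
    ultimately show ?thesis using pq by simp
  qed
  obtain S where sumS: "sum_of fst F S"
    by (rule orthogonal_sum_family[of F fst]) (use orth halvingD[OF h] in auto)
  note S = sum_ofD[OF sumS]
  obtain T where sumT: "sum_of snd F T"
    by (rule orthogonal_sum_family[of F snd]) (use orth halvingD[OF h] in auto)
  note T = sum_ofD[OF sumT]
  define p where "p i = star (fst i) * fst i" for i :: "'a \<times> 'a"
  have pf: "p i * fst i = fst i" "p i * snd i = snd i" "p i * star (fst i) = star (fst i)" if "i \<in> F" for i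
    using halving_absorb(3,4)[OF h[OF that] _ p_def] by simp_all
  define Q where "Q = star S * S"
  have QM: "Q \<in> M" and Qp: "proj Q" using S by (auto simp: Q_def proj_initial)
  have Q: "star Q = Q" "Q * Q = Q" using Qp by (auto simp: proj_def)
  have TQ: "star T * T = Q"
    unfolding Q_def by (rule sum_of_initial_eq[OF sumT sumS]) (rule halvingD(5)[OF h])
  have "star (snd i) * S = 0" if "i \<in> F" for i
  proof (rule S(7))
    show "star (snd i) * fst j = 0" if "j \<in> F" for j
      using orth[OF \<open>i \<in> F\<close> that] halvingD(7)[OF h[OF that]] by (cases "i = j") auto
  qed (use halvingD(2)[OF h[OF that]] in simp)
  then have "star S * snd i = 0" if "i \<in> F" for i
    using that by (metis star_eq_0_iff star_mult star_star)
  then have ST: "star S * T = 0" using S by (intro T(7)) auto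
  have TS: "star T * S = 0" using arg_cong[OF ST, of star] by simp
  have Qpi: "Q * p i = p i" if "i \<in> F" for i
  proof -
    have "S * p i = fst i" using S(6)[OF that] by (simp add: p_def mult.assoc)
    then show ?thesis using S(5)[OF that] by (simp add: Q_def p_def mult.assoc)
  qed
  have QS: "Q * S = S"
    using S(7)[of "1 - Q"] QM pf(1) Qpi
    by (simp add: algebra_simps) (metis mult.assoc)
  have QT: "Q * T = T"
    using T(7)[of "1 - Q"] QM pf(2) Qpi
    by (simp add: algebra_simps) (metis mult.assoc)
  have Fnew: False
    if st: "halving s t" "s \<noteq> 0" and sQ: "s * Q = 0" for s t
  proof -
    have sp: "s * star (fst i) = 0" if "i \<in> F" for i
    proof -
      have "star (fst i) = p i * star (fst i)" using pf(3)[OF that] by simp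
      then have "star (fst i) = Q * star (fst i)" using Qpi[OF that] by (metis mult.assoc)
      then show ?thesis using sQ by (metis mult.assoc mult_zero_left)
    qed
    have "(s, t) \<in> F"
    proof (rule Fmax)
      show "P (s, t)" using st by (simp add: P_def)
      show "R (s, t) y \<and> R y (s, t)" if "y \<in> F" for y
        using sp[OF that] unfolding R_def by (metis fst_conv star_eq_0_iff star_mult star_star)
    qed
    from sp[OF this] have "star (star s) * star s = 0" by simp
    then show False using st(2) by (simp only: star_mult_self_eq_0_iff star_eq_0_iff)
  qed
  obtain c where c: "central c" "c * Q = Q"
    "\<And>y. y \<in> M \<Longrightarrow> (\<And>m. m \<in> M \<Longrightarrow> y * (m * Q) = 0) \<Longrightarrow> y * c = 0"
    using central_support[OF QM] by blast
  \<comment> \<open>On a nonzero central projection orthogonal to \<open>Q\<close>,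
    \<open>halving_seed\<close> would provide a pair that can be added to the family.\<close>
  have c1: "c = 1"
  proof (rule ccontr)
    assume "c \<noteq> 1"
    then have "1 - c \<noteq> 0" "central (1 - c)" using central_compl[OF c(1)] by auto
    from infinite_central[OF this(2,1)] obtain s t where st: "halving s t" "s \<noteq> 0" "(1 - c) * s = s"
      using halving_seed[OF \<open>central (1 - c)\<close>] by metis
    have "s * Q = (1 - c) * s * (c * Q)" using st c by simp
    also have "\<dots> = s * ((1 - c) * c) * Q"
      using centralD(3)[OF \<open>central (1 - c)\<close> halvingD(1)[OF st(1)]] by (metis mult.assoc)
    also have "(1 - c) * c = 0" using centralD(4)[OF c(1)] by (simp add: algebra_simps)
    finally have "s * Q = 0" by simp
    then show False using Fnew st by blast
  qed
  obtain z where z: "central z" "(1 - z) * (1 - Q) \<preceq> Q" "z * Q \<preceq> 1 - Q"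
    using comparison[of "1 - Q" Q] QM Qp proj_compl[of Q] by auto
  note zD = centralD[OF z(1)]
  obtain w where w: "w \<in> M" "star w * w = z * Q" "(1 - Q) * w = w"
    using z(3) by (auto simp: mvle_def)
  have pzQ: "proj (z * Q)"
  proof -
    have "Q * z = z * Q" using zD(3)[OF QM] .
    then show ?thesis
      using zD(4,5) Q unfolding proj_def by (metis mult.assoc star_mult)
  qed
  have wp: "pisom w" using pzQ w(2) by (simp add: pisom_iff)
  have w2: "w * (z * Q) = w" using pisomD[OF wp] w(2) by simp
  have wQ: "star w * Q = 0"
  proof -
    have "star w * (1 - Q) = star w" using proj_fix_star[OF proj_compl[OF Qp] w(3)] .
    then show ?thesis by (simp add: algebra_simps)
  qed
  \<comment> \<open>A nonzero \<open>w\<close> would transport \<open>S\<close> and \<open>T\<close>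
    to a halving pair below \<open>1 - Q\<close>, against maximality.\<close>
  have w0: "w = 0"
  proof (rule ccontr)
    assume "w \<noteq> 0"
    define s where "s = w * S * star w"
    define t where "t = w * T * star w"
    have wz: "w * z = w" "w * Q = w"
    proof -
      show "w * Q = w" using w2 Q(2) by (metis mult.assoc)
      then show "w * z = w" using w2 zD(3)[OF QM] by (metis mult.assoc)
    qed
    have a: "star w * (w * x) = z * (Q * x)" for x using w(2) by (metis mult.assoc)
    have b: "w * (z * x) = w * x" "w * (Q * x) = w * x" for x using wz by (metis mult.assoc)+
    have swQ: "Q * star w = star w" "z * star w = star w"
      using arg_cong[OF wz(2), of star] arg_cong[OF wz(1), of star] Q zD(5) by auto
    have zx: "star S * (z * x) = z * (star S * x)" "star T * (z * x) = z * (star T * x)"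
        "S * (z * x) = z * (S * x)" "T * (z * x) = z * (T * x)" for x
      using zD(3)[of "star S"] zD(3)[of "star T"] zD(3)[of S] zD(3)[of T] S(1) T(1) by (metis star_mem mult.assoc)+
    have Qx: "Q * (S * x) = S * x" "Q * (T * x) = T * x" "star S * (S * x) = Q * x" "star T * (T * x) = Q * x"
      "star S * (T * x) = 0" "star T * (S * x) = 0" for x
      using QS QT ST TS TQ Q_def by (metis mult.assoc mult_zero_left)+
    note simps = s_def t_def mult.assoc a b zx Qx swQ
    have ss: "star s * s = w * star w" and tt: "star t * t = w * star w" and st: "star s * t = 0"
      by (simp_all add: simps)
    have "halving s t"
      unfolding halving_def
    proof (intro conjI)
      show "star t * t = star s * s" "star s * t = 0" using ss tt st by simp_all
      show "pisom s" using ss proj_final[OF wp] by (simp add: pisom_iff)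
      show "star s * s * s = s" "star s * s * t = t"
        unfolding ss by (simp_all add: simps)
    qed (use S T w in \<open>simp_all add: s_def t_def\<close>)
    moreover have "s \<noteq> 0"
    proof
      assume "s = 0"
      then have "star (star w) * star w = 0" using ss by simp
      then show False using \<open>w \<noteq> 0\<close> by (simp only: star_mult_self_eq_0_iff star_eq_0_iff)
    qed
    moreover have "s * Q = 0" using wQ by (simp add: s_def mult.assoc)
    ultimately show False using Fnew by blast
  qed
  have zQ0: "z * Q = 0" using w(2) w0 by simp
  have "z = 0"
  proof -
    have "z * c = 0"
    proof (rule c(3))
      fix m assume m: "m \<in> M"
      have "z * (m * Q) = m * (z * Q)" using zD(3)[OF m] by (metis mult.assoc)
      then show "z * (m * Q) = 0" using zQ0 by simp
    qed (use zD(1) in simp)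
    then show ?thesis using c1 by simp
  qed
  then obtain v where v: "v \<in> M" "star v * v = 1 - Q" "Q * v = v"
    using z(2) by (auto simp: mvle_def)
  \<comment> \<open>An isometry into \<open>Q\<close>: \<open>S\<close> compresses \<open>Q\<close>
    into one half, and \<open>T\<close> takes the copy of \<open>1 - Q\<close> made by
    \<open>v\<close> into the other.\<close>
  define J where "J = T * v + S"
  have Jp: "star J * J = 1"
  proof -
    have "star v * (star T * (T * v)) = star v * v" using TQ v(3) by (metis mult.assoc)
    moreover have "star v * (star T * S) = 0" "star S * (T * v) = 0"
      using TS ST by (simp, metis mult.assoc mult_zero_left)
    ultimately show ?thesis using v(2) by (simp add: J_def algebra_simps flip: Q_def)
  qed
  have QJ: "Q * J = J" using QS QT by (simp add: J_def algebra_simps QT[THEN mult_assoc_rewrite])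
  show thesis
  proof
    show "S * J \<in> M" "T * J \<in> M" using S T v by (simp_all add: J_def)
    have "star (S * J) * (S * J) = star J * (Q * J)" by (simp add: Q_def mult.assoc)
    then show "star (S * J) * (S * J) = 1" using QJ Jp by simp
    have "star (T * J) * (T * J) = star J * (Q * J)" using TQ by (simp add: mult.assoc mult_assoc_rewrite[OF TQ])
    then show "star (T * J) * (T * J) = 1" using QJ Jp by simp
    show "star (S * J) * (T * J) = 0" by (simp add: mult.assoc ST[THEN mult_assoc_rewrite])
  qed
qed

end

section \<open>Splitting of projections, and compressions of self-adjoint elements to zero\<close>

context vn_algebra
begin

lemma proj_diff:
  assumes "proj g" "proj d" "g * d = d"
  shows "proj (g - d)"
proof -
  have "d * g = d" using arg_cong[OF assms(3), of star] assms(1,2) by (simp add: proj_def)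
  then show ?thesis using assms by (simp add: proj_def algebra_simps)
qed

lemma proj_ran_mult_iff: "proj p \<Longrightarrow> p * v = v \<Longrightarrow> proj v \<Longrightarrow> v * p = v"
  by (metis proj_def star_mult)

text \<open>\<open>n\<close> is the meet of \<open>g\<close> and \<open>p\<close>, that is, the part
  of \<open>g\<close> killed by \<open>r\<close>. The remainder \<open>d\<close> is the range of
  \<open>g * r\<close>, which polar decomposition moves below the range of
  \<open>r * g\<close>.\<close>

lemma meet_part:
  assumes g: "g \<in> M" "proj g" and p: "p \<in> M" "proj p" and r: "r \<in> M" "proj r" and le: "(p + r) * g = g"
  obtains n d where "n \<in> M" "proj n" "g = n + d" "p * n = n" "g * n = n" "d \<preceq> ran (r * g)"
proof -
  define d where "d = ran (g * r)"
  define n where "n = g - d"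
  have gr: "g * r \<in> M" using g r by simp
  have d: "d \<in> M" "proj d" using ran[OF gr] by (auto simp: d_def)
  have ss: "star g = g" "g * g = g" "star r = r" "star d = d" using g r d by (auto simp: proj_def)
  have gd: "g * d = d" unfolding d_def
    by (rule ran_absorb[OF gr g(1)]) (simp add: ss(2) flip: mult.assoc)
  have "d * (g * r) = g * r" using ran_mult[OF gr] by (simp add: d_def)
  from arg_cong[OF this, of star] have rgd: "r * g * d = r * g" by (simp add: ss)
  then have rn: "r * n = 0" using gd by (simp add: n_def algebra_simps)
  have n: "n \<in> M" "proj n" using g d gd by (auto simp: n_def proj_diff)
  have gn: "g * n = n" using gd ss by (simp add: n_def algebra_simps)
  have pn: "p * n = n"
  proof -
    have "(p + r) * n = n" using gn le by (metis mult.assoc)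
    then show ?thesis using rn by (simp add: algebra_simps)
  qed
  have dr: "d \<preceq> ran (r * g)" using ran_star_mvle[of "r * g"] g r by (simp add: d_def ss)
  have gnd: "g = n + d" by (simp add: n_def)
  show thesis by (rule that[OF n gnd pn gn dr])
qed

text \<open>Compare the meet \<open>n\<close> of \<open>g\<close> and \<open>p\<close> with the meet
  \<open>n'\<close> of \<open>g'\<close> and \<open>r\<close>. Where \<open>n\<close> embeds into
  \<open>n'\<close>, the rest of \<open>g\<close> embeds into the range of \<open>r * g\<close>;
  this range is orthogonal to \<open>n'\<close> because \<open>g\<close> and \<open>g'\<close> are
  orthogonal, so all of \<open>g\<close> fits below \<open>r\<close>. On the complement the roles
  are exchanged.\<close>

lemma orthogonal_split:
  assumes g: "g \<in> M" "proj g" and g': "g' \<in> M" "proj g'" and gg': "g * g' = 0"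
    and p: "p \<in> M" "proj p" and r: "r \<in> M" "proj r" and le: "(p + r) * g = g" "(p + r) * g' = g'"
  obtains z where "central z" "z * g \<preceq> r" "(1 - z) * g' \<preceq> p"
proof -
  obtain n d where n: "n \<in> M" "proj n" "g = n + d" "p * n = n" "g * n = n" "d \<preceq> ran (r * g)"
    using meet_part[OF g p r le(1)] by blast
  have "(r + p) * g' = g'" using le(2) by (simp add: add.commute)
  from meet_part[OF g' r p this] obtain n' d' where n': "n' \<in> M" "proj n'" "g' = n' + d'"
    "r * n' = n'" "g' * n' = n'" "d' \<preceq> ran (p * g')" by blast
  have rgM: "r * g \<in> M" "p * g' \<in> M" using g g' p r by auto
  have g'g: "g' * g = 0" using arg_cong[OF gg', of star] g g' by (simp add: proj_def)
  have "n' * (r * g) = n' * r * g" by (simp add: mult.assoc)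
  also have "\<dots> = n' * g' * g"
    using proj_ran_mult_iff[OF r(2) n'(4,2)] proj_ran_mult_iff[OF g'(2) n'(5,2)] by simp
  finally have "n' * (r * g) = 0" using g'g by (simp add: mult.assoc)
  then have o1: "n' * ran (r * g) = 0" by (rule mult_ran_eq_0[OF rgM(1) n'(1)])
  have "n * (p * g') = n * p * g'" by (simp add: mult.assoc)
  also have "\<dots> = n * g * g'"
    using proj_ran_mult_iff[OF p(2) n(4,2)] proj_ran_mult_iff[OF g(2) n(5,2)] by simp
  finally have "n * (p * g') = 0" using gg' by (simp add: mult.assoc)
  then have o2: "n * ran (p * g') = 0" by (rule mult_ran_eq_0[OF rgM(2) n(1)])
  have rr: "r * ran (r * g) = ran (r * g)"
    by (rule ran_absorb[OF rgM(1) r(1)]) (use r in \<open>simp add: proj_def flip: mult.assoc\<close>)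
  have pp: "p * ran (p * g') = ran (p * g')"
    by (rule ran_absorb[OF rgM(2) p(1)]) (use p in \<open>simp add: proj_def flip: mult.assoc\<close>)
  obtain c where c: "central c" "(1 - c) * n \<preceq> n'" "c * n' \<preceq> n"
    using comparison[OF n(1) n'(1) n(2) n'(2)] by blast
  have c1: "central (1 - c)" using c(1) by (rule central_compl)
  have "(1 - c) * d \<preceq> ran (r * g)"
    using mvle_central_le[OF c1 _ _ n(6)] ran[OF rgM(1)] by simp
  from mvle_add[OF c(2) this n'(2) proj_ran[OF rgM(1)] o1]
  have "(1 - c) * g \<preceq> n' + ran (r * g)" by (simp add: n(3) algebra_simps)
  then have 1: "(1 - c) * g \<preceq> r" by (rule mvle_mono) (simp add: n' rr algebra_simps)
  have "c * d' \<preceq> ran (p * g')"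
    using mvle_central_le[OF c(1) _ _ n'(6)] ran[OF rgM(2)] by simp
  from mvle_add[OF c(3) this n(2) proj_ran[OF rgM(2)] o2]
  have "c * g' \<preceq> n + ran (p * g')" by (simp add: n'(3) algebra_simps)
  then have 2: "c * g' \<preceq> p" by (rule mvle_mono) (simp add: n pp algebra_simps)
  show thesis by (rule that[OF c1]) (use 1 2 in simp_all)
qed

lemma norm_proj_le_1:
  assumes "proj k"
  shows "norm k \<le> 1"
proof -
  have "norm k * norm k = norm k"
    using norm_star_mult_self[of k] assms by (simp add: proj_def power2_eq_square)
  then show ?thesis by auto
qed

text \<open>The negation of what \<open>nilpotent_compression\<close> looks for in the corner of
  \<open>k\<close>; it is the invariant of the norm-halving iteration.\<close>

definition nilpotent_free :: "'a \<Rightarrow> 'a \<Rightarrow> bool" where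
  "nilpotent_free k x \<longleftrightarrow> (\<forall>w\<in>M. pisom w \<longrightarrow> k * w = w \<longrightarrow> w * k = w \<longrightarrow>
     w * w = 0 \<longrightarrow> w * (x * w) = 0 \<longrightarrow> w = 0)"

text \<open>\<open>a\<close> and \<open>b\<close> are twice the positive and the negative part of
  \<open>x\<close>. The polar part of a nonzero \<open>a * (m * b)\<close> would be a forbidden
  \<open>w\<close>, so \<open>a M b = 0\<close>. Hence commutators with \<open>a\<close> and with
  \<open>b\<close> have orthogonal ranges, and passing from \<open>x\<close> to its absolute value
  \<open>A\<close> keeps their norms.\<close>

lemma commutator_norm_step:
  assumes k: "k \<in> M" "proj k" and x: "x \<in> M" "star x = x" "k * x = x" "norm x \<le> r"
    and none: "nilpotent_free k x"
  obtains y where "y \<in> M" "star y = y" "k * y = y" "norm y \<le> r / 2"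
    "nilpotent_free k y"
    "\<And>m. m \<in> M \<Longrightarrow> k * m = m \<Longrightarrow> m * k = m \<Longrightarrow> norm (x * m - m * x) = norm (y * m - m * y)"
proof -
  obtain A where A: "A \<in> M" "star A = A" "A * x = x * A" "A * A = x * x" "norm (A - (r / 2) *\<^sub>R 1) \<le> r / 2"
    using absolute_value[OF x(1,2,4)] by blast
  have kk: "star k = k" "k * k = k" using k by (auto simp: proj_def)
  have xk: "x * k = x" using arg_cong[OF x(3), of star] x(2) kk by simp
  have Ak: "A * k = A"
  proof -
    have "star (A * (1 - k)) * (A * (1 - k)) = (1 - k) * (A * A) * (1 - k)"
      using A(2) kk by (simp add: mult.assoc)
    also have "\<dots> = 0" by (simp add: A(4) algebra_simps xk)
    finally have "A * (1 - k) = 0" by (simp only: star_mult_self_eq_0_iff)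
    then show ?thesis by (simp add: algebra_simps)
  qed
  have kA: "k * A = A" using arg_cong[OF Ak, of star] A(2) kk by simp
  define a where "a = A + x"
  define b where "b = A - x"
  have aM: "a \<in> M" and bM: "b \<in> M" using A x by (auto simp: a_def b_def)
  have sa: "star a = a" and sb: "star b = b" using A x by (auto simp: a_def b_def)
  have ka: "k * a = a" and bk: "b * k = b" using kA Ak x(3) xk by (auto simp: a_def b_def algebra_simps)
  have ab: "a * b = 0" and ba: "b * a = 0" using A by (auto simp: a_def b_def algebra_simps)
  have amb: "a * (m * b) = 0" if m: "m \<in> M" for m
  proof (rule ccontr)
    assume nz: "a * (m * b) \<noteq> 0"
    have cM: "a * (m * b) \<in> M" using aM bM m by simp
    obtain w where w: "w \<in> M" "pisom w" "\<And>y. y \<in> M \<Longrightarrow> y * (a * (m * b)) = 0 \<longleftrightarrow> y * w = 0"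
      "\<And>y. y \<in> M \<Longrightarrow> a * (m * b) * y = 0 \<longleftrightarrow> w * y = 0"
      using polar[OF cM] by blast
    have bw: "b * w = 0" using w(3)[OF bM] ba by (simp flip: mult.assoc)
    have wa: "w * a = 0" using w(4)[OF aM] ba by (simp add: mult.assoc)
    have kw: "k * w = w" using w(3)[of "1 - k"] k(1) ka[THEN mult_assoc_rewrite] by (simp add: algebra_simps)
    have wk: "w * k = w" using w(4)[of "1 - k"] k(1) bk by (simp add: algebra_simps)
    have qw: "ran a * w = w"
      using w(3)[of "1 - ran a"] ran_mem[OF aM] ran_mult[OF aM, THEN mult_assoc_rewrite] by (simp add: algebra_simps)
    have "w * ran a = 0" using mult_ran_eq_0[OF aM w(1) wa] .
    then have ww: "w * w = 0" using qw by (metis mult.assoc mult_zero_left)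
    have "A * w = x * w" "w * A = - (w * x)" using bw wa
      by (auto simp: a_def b_def algebra_simps add_eq_0_iff)
    \<comment> \<open>\<open>w * (A * w)\<close> is evaluated from both sides: \<open>A\<close> acts
      as \<open>x\<close> on the range of \<open>w\<close>, and as \<open>- x\<close> under
      \<open>w\<close> from the right.\<close>
    then have "w * (x * w) = - (w * (x * w))" by (metis mult.assoc mult_minus_left)
    then have "w * (x * w) = 0" by (simp add: eq_neg_iff_add_eq_0 flip: scaleR_2)
    with none w(1,2) kw wk ww have "w = 0" unfolding nilpotent_free_def by blast
    then show False using w(3)[of 1] nz by simp
  qed
  \<comment> \<open>The spectrum of \<open>A\<close> lies in \<open>[0, r]\<close>; subtracting
    \<open>r / 2\<close> times the unit \<open>k\<close> of the corner centres it and leaves the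
    commutators alone.\<close>
  define y where "y = A - (r / 2) *\<^sub>R k"
  show thesis
  proof
    show "y \<in> M" "star y = y" "k * y = y" using A k kk kA by (auto simp: y_def algebra_simps)
    have "y = k * (A - (r / 2) *\<^sub>R 1)" using kA by (simp add: y_def algebra_simps)
    then have "norm y \<le> norm k * norm (A - (r / 2) *\<^sub>R 1)" by (metis norm_mult_ineq)
    also have "\<dots> \<le> 1 * (r / 2)" using A(5) norm_proj_le_1[OF k(2)] by (intro mult_mono) auto
    finally show "norm y \<le> r / 2" by simp
  next
    fix m assume m: "m \<in> M" "k * m = m" "m * k = m"
    define p where "p = a * m - m * a"
    define q where "q = b * m - m * b"
    have ms: "star m \<in> M" "m * star m \<in> M" "star m * m \<in> M" using m by auto
    have "star p * q = star m * (a * b) * m - star m * (a * (m * b)) - a * (star m * b) * m + a * (star m * m * b)"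
      by (simp add: p_def q_def sa sb algebra_simps)
    then have "star p * q = 0" using amb[OF m(1)] amb[OF ms(1)] amb[OF ms(3)] ab by simp
    from norm_add_eq_norm_diff[OF this] have "norm (p + q) = norm (p - q)" .
    moreover have "p + q = 2 *\<^sub>R (A * m - m * A)" "p - q = 2 *\<^sub>R (x * m - m * x)"
      by (simp_all add: p_def q_def a_def b_def algebra_simps scaleR_2)
    moreover have "y * m - m * y = A * m - m * A"
      using m by (simp add: y_def algebra_simps)
    ultimately show "norm (x * m - m * x) = norm (y * m - m * y)" by simp
  next
    have "w = 0" if w: "w \<in> M" "pisom w" "k * w = w" "w * k = w" "w * w = 0" "w * (y * w) = 0" for w
    proof -
      have wAw: "w * (A * w) = 0" using w(3-6) by (simp add: y_def algebra_simps)
      define p where "p = w * (a * w)"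
      define q where "q = w * (b * w)"
      have pq: "p + q = 0" using wAw by (simp add: p_def q_def a_def b_def algebra_simps flip: scaleR_2)
      \<comment> \<open>\<open>p\<close> and \<open>q\<close> have orthogonal ranges and sum 0, so
        both vanish, and \<open>w * (x * w)\<close> with them.\<close>
      have "star p * q = star w * (a * ((star w * w) * b)) * w"
        by (simp add: p_def q_def sa mult.assoc)
      then have "star p * q = 0" using amb[of "star w * w"] w(1) by simp
      moreover have "q = - p" using pq by (simp add: add_eq_0_iff)
      ultimately have "p = 0" by simp
      then have "q = 0" using pq by simp
      have "2 *\<^sub>R (w * (x * w)) = p - q" by (simp add: p_def q_def a_def b_def algebra_simps scaleR_2)
      then have "w * (x * w) = 0" using \<open>p = 0\<close> \<open>q = 0\<close> by simp
      then show ?thesis using none w unfolding nilpotent_free_def by blast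
    qed
    then show "nilpotent_free k y" unfolding nilpotent_free_def by blast
  qed
qed

text \<open>Each step replaces \<open>x\<close> by \<open>\<bar>x\<bar> - r/2\<close>, which halves the norm but keeps the norms of all
  commutators; hence an \<open>x\<close> without the required \<open>w\<close> would be central in the corner.\<close>

lemma nilpotent_compression:
  assumes k: "k \<in> M" "proj k" and x: "x \<in> M" "star x = x" "k * x = x"
    and w0: "w0 \<in> M" "w0 \<noteq> 0" "k * w0 = w0" "w0 * k = w0" "w0 * w0 = 0"
  obtains w where "w \<in> M" "pisom w" "w \<noteq> 0" "k * w = w" "w * k = w" "w * w = 0" "w * (x * w) = 0"
proof (rule ccontr)
  assume "\<not> thesis"
  then have none: "nilpotent_free k x" unfolding nilpotent_free_def using that by blast
  define r where "r = norm x"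
  define C where "C y y' \<longleftrightarrow> (\<forall>m. m \<in> M \<longrightarrow> k * m = m \<longrightarrow> m * k = m \<longrightarrow>
    norm (y * m - m * y) = norm (y' * m - m * y'))" for y y'
  have step: "\<exists>y. y \<in> M \<and> star y = y \<and> k * y = y \<and> norm y \<le> r / 2 ^ n \<and>
      nilpotent_free k y \<and> C x y" for n
  proof (induction n)
    case 0
    show ?case using x none by (intro exI[of _ x]) (auto simp: r_def C_def)
  next
    case (Suc n)
    then obtain y where y: "y \<in> M" "star y = y" "k * y = y" "norm y \<le> r / 2 ^ n"
      "nilpotent_free k y" "C x y"
      by blast
    obtain y' where y': "y' \<in> M" "star y' = y'" "k * y' = y'" "norm y' \<le> r / 2 ^ n / 2"
      "nilpotent_free k y'" "C y y'"
      unfolding C_def by (rule commutator_norm_step[OF k y(1-5)]) blast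
    have "C x y'" using y(6) y'(6) by (simp add: C_def)
    moreover have "norm y' \<le> r / 2 ^ Suc n" using y'(4) by (simp add: field_simps)
    ultimately show ?case using y' by blast
  qed
  have comm: "x * m = m * x" if m: "m \<in> M" "k * m = m" "m * k = m" for m
  proof -
    have "norm (x * m - m * x) \<le> 2 * r * norm m * (1 / 2) ^ n" for n
    proof -
      obtain y where y: "norm y \<le> r / 2 ^ n" "norm (x * m - m * x) = norm (y * m - m * y)"
        using step[of n] m unfolding C_def by blast
      have "norm (y * m - m * y) \<le> norm (y * m) + norm (m * y)" by (rule norm_triangle_ineq4)
      also have "\<dots> \<le> norm y * norm m + norm m * norm y" by (intro add_mono norm_mult_ineq)
      also have "\<dots> = 2 * norm m * norm y" by simp
      also have "\<dots> \<le> 2 * norm m * (r / 2 ^ n)" using y(1) by (intro mult_left_mono) auto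
      finally show ?thesis using y(2) by (simp add: field_simps)
    qed
    moreover have "(\<lambda>n. 2 * r * norm m * (1 / 2) ^ n) \<longlonglongrightarrow> 0"
      by (intro tendsto_mult_right_zero LIMSEQ_power_zero) simp
    ultimately have "norm (x * m - m * x) \<le> 0"
      by (intro LIMSEQ_le_const) auto
    then show ?thesis by simp
  qed
  obtain v where v: "v \<in> M" "pisom v" "\<And>y. y \<in> M \<Longrightarrow> y * w0 = 0 \<longleftrightarrow> y * v = 0"
    "\<And>y. y \<in> M \<Longrightarrow> w0 * y = 0 \<longleftrightarrow> v * y = 0"
    using polar[OF w0(1)] by blast
  have kv: "k * v = v" "v * k = v"
    using v(3)[of "1 - k"] v(4)[of "1 - k"] k w0 by (simp_all add: algebra_simps)
  have vv: "v * v = 0" using v(3)[OF w0(1)] v(4)[OF v(1)] w0(5) by simp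
  \<comment> \<open>Once \<open>x\<close> commutes with the corner, any square-zero partial isometry
    there satisfies the condition; the polar part of \<open>w0\<close> is one.\<close>
  have "v * (x * v) = v * v * x" using comm[OF v(1) kv] by (simp add: mult.assoc)
  then have "v = 0" using none v(1,2) kv vv unfolding nilpotent_free_def by simp
  then show False using v(3)[of 1] w0(2) by simp
qed

end

section \<open>Isometries separated by a given element\<close>

context properly_infinite_algebra
begin

text \<open>The join of \<open>p\<close> and \<open>q\<close> is \<open>p + r\<close> with
  \<open>r\<close> the range of \<open>(1 - p) * q\<close>, and \<open>r\<close> is subequivalent to
  \<open>q\<close>. Proper infiniteness turns one copy of \<open>z\<close> below the join into two
  orthogonal ones, as \<open>orthogonal_split\<close> requires.\<close>

lemma join_split:
  assumes z: "central z" and p: "p \<in> M" "proj p" and q: "q \<in> M" "proj q" and Q: "Q \<in> M"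
    and join: "\<And>y. y \<in> M \<Longrightarrow> y * p = 0 \<Longrightarrow> y * q = 0 \<Longrightarrow> y * Q = 0" and zQ: "z \<preceq> Q"
  obtains z1 z2 where "central z1" "central z2" "z = z1 + z2" "z1 * z2 = 0" "z1 \<preceq> p" "z2 \<preceq> q"
proof -
  obtain J where J: "J \<in> M" "star J * J = z" "Q * J = J" using zQ by (auto simp: mvle_def)
  obtain \<alpha> \<beta> where \<alpha>: "\<alpha> \<in> M" "\<beta> \<in> M" "star \<alpha> * \<alpha> = 1" "star \<beta> * \<beta> = 1" "star \<alpha> * \<beta> = 0"
    by (rule orthogonal_isometries)
  define x where "x = (1 - p) * q"
  define r where "r = ran x"
  have xM: "x \<in> M" using p q by (simp add: x_def)
  have r: "r \<in> M" "proj r" using ran[OF xM] by (auto simp: r_def)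
  have "p * x = 0" using p by (simp add: x_def proj_def algebra_simps)
       (metis mult.assoc)
  then have pr: "p * r = 0" unfolding r_def by (rule mult_ran_eq_0[OF xM p(1)])
  then have rp: "r * p = 0" using p(2) r(2) by (metis proj_def star_mult star_zero)
  have "r * q = r * x" using rp by (simp add: x_def algebra_simps mult_assoc_rewrite[OF rp])
  then have rq: "r * q = q - p * q" using ran_mult[OF xM] by (simp add: r_def x_def algebra_simps)
  have "(1 - (p + r)) * Q = 0"
    using p r rp rq by (intro join) (simp_all add: proj_def algebra_simps)
  then have prQ: "(p + r) * Q = Q" by (simp add: algebra_simps)
  have prJ: "(p + r) * J = J" using prQ J(3) by (metis mult.assoc)
  note zD = centralD[OF z]
  define a where "a = J * \<alpha>"
  define b where "b = J * \<beta>"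
  have ab: "a \<in> M" "b \<in> M" using J \<alpha> by (auto simp: a_def b_def)
  have zz: "star x * (z * y) = z * (star x * y)" if "x \<in> M" for x y
    using zD(3)[of "star x"] that by (metis mult.assoc star_mem)
  have ss: "star a * a = z" "star b * b = z" "star a * b = 0"
    by (simp_all add: a_def b_def mult.assoc J(2)[THEN mult_assoc_rewrite] zz \<alpha>)
  have pi: "pisom a" "pisom b" using ss zD(2) by (auto simp: pisom_iff)
  have prab: "(p + r) * (a * star a) = a * star a" "(p + r) * (b * star b) = b * star b"
    by (simp_all add: a_def b_def mult_assoc_rewrite[OF prJ] mult.assoc)
  have orth: "a * star a * (b * star b) = 0"
    using ss(3) by (simp add: mult.assoc mult_assoc_rewrite[OF ss(3)])
  obtain c where c: "central c" "c * (a * star a) \<preceq> r" "(1 - c) * (b * star b) \<preceq> p"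
    using orthogonal_split[OF _ proj_final[OF pi(1)] _ proj_final[OF pi(2)] orth p r prab] ab by auto
  have "ran (star (q * (1 - p))) \<preceq> ran (q * (1 - p))"
    using p q by (intro ran_star_mvle) simp
  moreover have "star (q * (1 - p)) = x" using p q by (simp add: x_def proj_def)
  ultimately have "r \<preceq> ran (q * (1 - p))" by (simp add: r_def)
  then have rq': "r \<preceq> q"
    by (rule mvle_mono) (use p q in \<open>auto intro!: ran_absorb simp: proj_def mult_assoc_rewrite\<close>)
  have za: "z \<preceq> a * star a" "z \<preceq> b * star b"
    by (rule mvleI[of a], use ss ab pi in \<open>simp_all add: pisom_def\<close>)
       (rule mvleI[of b], use ss ab pi in \<open>simp_all add: pisom_def\<close>)
  have "(1 - c) * z \<preceq> p" "c * z \<preceq> q"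
    using mvle_central[OF za(2) central_compl[OF c(1)]] mvle_central[OF za(1) c(1)] c rq' mvle_trans by blast+
  moreover have "(1 - c) * z * (c * z) = 0"
  proof -
    have "(1 - c) * z * (c * z) = (1 - c) * c * (z * z)"
      using zD(3)[OF centralD(1)[OF c(1)]] zD(4) by (metis mult.assoc)
    then show ?thesis using centralD(4)[OF c(1)] by (simp add: algebra_simps)
  qed
  ultimately show thesis
    using that[of "(1 - c) * z" "c * z"] central_mult[OF c(1) z] central_mult[OF central_compl[OF c(1)] z]
    by (simp add: algebra_simps)
qed

text \<open>Subequivalence to \<open>e\<close> is not stable under joins: two distinct projections
  of rank one embed into a third one, their join does not. Tested on central projections only, it
  is, by \<open>join_split\<close> and \<open>mvle_add_central\<close>.\<close>

definition dominated :: "'a \<Rightarrow> 'a \<Rightarrow> bool" where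
  "dominated p e \<longleftrightarrow> (\<forall>z. central z \<longrightarrow> z \<preceq> p \<longrightarrow> z \<preceq> e)"

lemma mvle_imp_dominated: "p \<preceq> e \<Longrightarrow> dominated p e"
  unfolding dominated_def using mvle_trans by blast

lemma dominated_join:
  assumes "p \<in> M" "proj p" "q \<in> M" "proj q" "Q \<in> M"
    and "\<And>y. y \<in> M \<Longrightarrow> y * p = 0 \<Longrightarrow> y * q = 0 \<Longrightarrow> y * Q = 0"
    and "dominated p e" "dominated q e"
  shows "dominated Q e"
  unfolding dominated_def
proof (intro allI impI)
  fix z assume z: "central z" "z \<preceq> Q"
  obtain z1 z2 where *: "central z1" "central z2" "z = z1 + z2" "z1 * z2 = 0" "z1 \<preceq> p" "z2 \<preceq> q"
    using join_split[OF z(1) assms(1-6) z(2)] by blast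
  then have "z1 \<preceq> e" "z2 \<preceq> e" using assms(7,8) by (auto simp: dominated_def)
  then show "z \<preceq> e" using mvle_add_central * by simp
qed

lemma join_exists:
  assumes "x \<in> M" "y \<in> M"
  obtains p where "p \<in> M" "proj p" "p * x = x" "p * y = y"
    "\<And>u. u \<in> M \<Longrightarrow> u * x = 0 \<Longrightarrow> u * y = 0 \<Longrightarrow> u * p = 0"
  using baer[of "{x, y}"] assms by auto

text \<open>The projections \<open>v v\<^sup>*\<close> and \<open>v\<^sup>* v\<close> of a maximal \<open>v\<close> with \<open>v v = v h v = 0\<close> fill up the algebra.\<close>

lemma selfadjoint_orthogonal_isometries:
  assumes h: "h \<in> M" "star h = h"
  obtains s t where "s \<in> M" "t \<in> M" "star s * s = 1" "star t * t = 1" "star t * s = 0" "star t * (h * s) = 0"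
proof -
  define P where "P v \<longleftrightarrow> v \<in> M \<and> pisom v \<and> v \<noteq> 0 \<and> v * v = 0 \<and> v * (h * v) = 0" for v
  define R where "R v w \<longleftrightarrow> star v * w = 0 \<and> v * star w = 0 \<and> v * w = 0 \<and> v * (h * w) = 0" for v w
  obtain F where FP: "\<And>x. x \<in> F \<Longrightarrow> P x"
    and FR: "\<And>x y. x \<in> F \<Longrightarrow> y \<in> F \<Longrightarrow> x \<noteq> y \<Longrightarrow> R x y"
    and Fmax: "\<And>x. P x \<Longrightarrow> (\<And>y. y \<in> F \<Longrightarrow> R x y \<and> R y x) \<Longrightarrow> x \<in> F"
    using maximal_clique[of P R] by blast
  have FM: "x \<in> M" if "x \<in> F" for x using FP[OF that] by (simp add: P_def)
  have Fvw: "v * w = 0" "v * (h * w) = 0" if "v \<in> F" "w \<in> F" for v w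
    using FP[OF that(1)] FR[OF that] by (auto simp: P_def R_def)
  obtain X where sumX: "sum_of (\<lambda>x. x) F X"
    by (rule orthogonal_sum_family[of F "\<lambda>x. x"]) (use FP FR in \<open>auto simp: P_def R_def\<close>)
  note X = sum_ofD[OF sumX]
  have "v * X = 0" if "v \<in> F" for v using Fvw that by (intro X(7) FM) auto
  then have XX: "X * X = 0" using X(1) by (intro X(8)) auto
  have "v * h * X = 0" if "v \<in> F" for v
    using Fvw that h FM by (intro X(7)) (auto simp: mult.assoc)
  then have XhX: "X * (h * X) = 0" using X(1) h by (intro X(8)) (auto simp: mult.assoc)
  define e where "e = X * star X"
  have e: "e \<in> M" "proj e" using X by (auto simp: e_def proj_final)
  have hX: "h * X \<in> M" "h * star X \<in> M" "X * h \<in> M" "star X * h \<in> M" using h X by auto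
  have Xle: "star X * X \<preceq> e" by (rule mvleI[of X]) (use X in \<open>auto simp: e_def pisom_def\<close>)
  have eX: "e \<preceq> e" using e by (intro mvle_proj) (auto simp: proj_def)
  have r1: "ran X \<preceq> e" using ran_pisom[OF X(1,2)] eX by (simp add: e_def)
  have r2: "ran (star X) \<preceq> e"
    using ran_pisom[of "star X"] X pisom_star[OF X(2)] Xle by simp
  have r3: "ran (h * X) \<preceq> e"
  proof -
    have "ran (star (star X * h)) \<preceq> ran (star X * h)" using hX by (intro ran_star_mvle)
    moreover have "star X * X * ran (star X * h) = ran (star X * h)"
    proof (intro ran_absorb)
      show "star X * X * (star X * h) = star X * h"
        using pisomD[OF pisom_star[OF X(2)]] by (metis mult.assoc star_star)
    qed (use X hX in auto)
    ultimately show ?thesis using mvle_mono Xle mvle_trans h(2) by (metis star_mult star_star)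
  qed
  have r4: "ran (h * star X) \<preceq> e"
  proof -
    have "ran (star (X * h)) \<preceq> ran (X * h)" using hX by (intro ran_star_mvle)
    moreover have "e * ran (X * h) = ran (X * h)"
      using X(2) e hX by (intro ran_absorb) (auto simp: e_def pisom_def simp flip: mult.assoc)
    ultimately show ?thesis using mvle_mono h(2) by (metis star_mult)
  qed
  obtain Q1 where Q1: "Q1 \<in> M" "proj Q1" "Q1 * X = X" "Q1 * star X = star X"
    "\<And>u. u \<in> M \<Longrightarrow> u * X = 0 \<Longrightarrow> u * star X = 0 \<Longrightarrow> u * Q1 = 0"
    using join_exists[of X "star X"] X by auto
  obtain Q2 where Q2: "Q2 \<in> M" "proj Q2" "Q2 * (h * X) = h * X" "Q2 * (h * star X) = h * star X"
    "\<And>u. u \<in> M \<Longrightarrow> u * (h * X) = 0 \<Longrightarrow> u * (h * star X) = 0 \<Longrightarrow> u * Q2 = 0"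
    using join_exists[OF hX(1,2)] by blast
  obtain Q where Q: "Q \<in> M" "proj Q" "Q * Q1 = Q1" "Q * Q2 = Q2"
    "\<And>u. u \<in> M \<Longrightarrow> u * Q1 = 0 \<Longrightarrow> u * Q2 = 0 \<Longrightarrow> u * Q = 0"
    using join_exists[OF Q1(1) Q2(1)] by blast
  have d1: "dominated Q1 e"
    by (rule dominated_join[OF _ _ _ _ Q1(1) _ mvle_imp_dominated[OF r1] mvle_imp_dominated[OF r2]])
       (use X Q1 ran mult_ran_iff in auto)
  have d2: "dominated Q2 e"
    by (rule dominated_join[OF _ _ _ _ Q2(1) _ mvle_imp_dominated[OF r3] mvle_imp_dominated[OF r4]])
       (use hX Q2 ran mult_ran_iff in auto)
  have dQ: "dominated Q e"
    by (rule dominated_join[OF Q1(1,2) Q2(1,2) Q(1) _ d1 d2]) (use Q in auto)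
  \<comment> \<open>Including \<open>h * X\<close> and \<open>h * star X\<close> in \<open>Q\<close>
    makes \<open>k * h\<close> vanish on the family; this supplies the clause with \<open>h\<close>
    in \<open>R\<close> for a new member below \<open>k\<close>.\<close>
  define k where "k = 1 - Q"
  have k: "k \<in> M" "proj k" using Q by (auto simp: k_def proj_compl)
  have kQ: "k * Q1 = 0" "k * Q2 = 0" using Q by (simp_all add: k_def algebra_simps)
  have kX: "k * X = 0" "k * star X = 0" "k * (h * X) = 0" "k * (h * star X) = 0"
    using kQ Q1(3,4) Q2(3,4) by (metis mult.assoc mult_zero_left)+
  have one: "1 \<preceq> (1::'a)" by (rule mvleI[of 1]) auto
  obtain z1 z2 where z: "central z1" "central z2" "1 = z1 + z2" "z1 * z2 = 0" "z1 \<preceq> Q" "z2 \<preceq> k"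
    by (rule join_split[OF central_one Q(1,2) k one_mem _ one])
       (auto simp: k_def algebra_simps)
  have z20: "z2 = 0"
  proof (rule ccontr)
    assume nz: "z2 \<noteq> 0"
    obtain j where j: "j \<in> M" "star j * j = z2" "k * j = j" using z(6) by (auto simp: mvle_def)
    obtain \<alpha> \<beta> where \<alpha>: "\<alpha> \<in> M" "\<beta> \<in> M" "star \<alpha> * \<alpha> = 1" "star \<beta> * \<beta> = 1" "star \<alpha> * \<beta> = 0"
      by (rule orthogonal_isometries)
    note zD = centralD[OF z(2)]
    have \<beta>\<alpha>: "star \<beta> * \<alpha> = 0" using arg_cong[OF \<alpha>(5), of star] by simp
    have zz: "star x * (z2 * y) = z2 * (star x * y)" if "x \<in> M" for x y
      using zD(3)[of "star x"] that by (metis mult.assoc star_mem)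
    \<comment> \<open>Two orthogonal copies of \<open>z2\<close> below \<open>k\<close> give a
      nonzero square-zero element of the corner, the seed that \<open>nilpotent_compression\<close>
      asks for.\<close>
    define w0 where "w0 = j * \<alpha> * star (j * \<beta>)"
    have jk: "star j * k = star j" using proj_fix_star[OF k(2) j(3)] .
    have jj: "star j * (j * y) = z2 * y" for y using j(2) by (metis mult.assoc)
    have "star (j * \<alpha>) * w0 * (j * \<beta>) = z2 * z2"
      using \<alpha> by (simp add: w0_def mult.assoc jj zz) (simp add: \<alpha> zz mult_assoc_rewrite[OF \<alpha>(3)])
    then have "w0 \<noteq> 0" using nz zD(4) by auto
    moreover have "w0 * w0 = 0"
      by (simp add: w0_def mult.assoc jj zz \<alpha> mult_assoc_rewrite[OF \<beta>\<alpha>])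
    moreover have "w0 \<in> M" "k * w0 = w0" "w0 * k = w0"
      using j \<alpha> jk by (simp_all add: w0_def mult.assoc mult_assoc_rewrite[OF j(3)])
    moreover have "k * h * k \<in> M" "star (k * h * k) = k * h * k" "k * (k * h * k) = k * h * k"
      using k h by (simp_all add: proj_def flip: mult.assoc)
    ultimately obtain w where w: "w \<in> M" "pisom w" "w \<noteq> 0" "k * w = w" "w * k = w" "w * w = 0"
        "w * (k * h * k * w) = 0"
      using nilpotent_compression[OF k, of "k * h * k" w0] by blast
    have whw: "w * (h * w) = 0" using w(4,5,7) by (metis mult.assoc)
    have kstar: "star k = k" using k(2) by (simp add: proj_def)
    have swk: "star w * k = star w" "k * star w = star w"
      using arg_cong[OF w(4), of star] arg_cong[OF w(5), of star] kstar by auto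
    have kv: "k * v = 0" "k * star v = 0" "k * (h * v) = 0" "k * (h * star v) = 0" if v: "v \<in> F" for v
    proof -
      have "v = X * (star v * v)" "star v = star X * (v * star v)"
        using X(6)[OF v] mult_assoc_rewrite[OF X(5)[OF v]] pisomD[OF pisom_star, of v] FP[OF v]
        by (simp_all add: P_def mult.assoc)
      then show "k * v = 0" "k * star v = 0" "k * (h * v) = 0" "k * (h * star v) = 0"
        using kX by (metis mult.assoc mult_zero_left)+
    qed
    have sv: "v * k = 0" "star v * k = 0" "star v * (h * k) = 0" "v * (h * k) = 0" if "v \<in> F" for v
      using kv[OF that, THEN arg_cong[of _ _ star]] kstar h(2) by (simp_all add: mult.assoc)
    have "w \<in> F"
    proof (rule Fmax)
      show "P w" using w whw by (simp add: P_def)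
      show "R w v \<and> R v w" if "v \<in> F" for v
        using mult_assoc_rewrite[OF swk(1), of v] mult_assoc_rewrite[OF w(5), of v]
          mult_assoc_rewrite[OF w(5), of "star v"] mult_assoc_rewrite[OF w(5), of "h * v"]
          mult_assoc_rewrite[OF sv(1)[OF that], of w] mult_assoc_rewrite[OF sv(2)[OF that], of w]
          mult_assoc_rewrite[OF sv(1)[OF that], of "star w"] mult_assoc_rewrite2[OF sv(4)[OF that], of w]
        by (simp add: R_def kv[OF that] swk w(4))
    qed
    from kv(1)[OF this] w(3,4) show False by simp
  qed
  then have "1 \<preceq> e" using z dQ central_one by (auto simp: dominated_def)
  then obtain j where j: "j \<in> M" "star j * j = 1" "e * j = j" by (auto simp: mvle_def)
  show thesis
  proof
    \<comment> \<open>The witnesses are \<open>star X * j\<close> and \<open>j\<close>. Inserting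
      \<open>star j = star j * e\<close> turns both products into multiples of the adjoints of
      \<open>X * X\<close> and \<open>X * (h * X)\<close>.\<close>
    show "star X * j \<in> M" "j \<in> M" "star j * j = 1" using X j by auto
    have "star (star X * j) * (star X * j) = star j * (e * j)" by (simp add: e_def mult.assoc)
    then show "star (star X * j) * (star X * j) = 1" using j by simp
    have je: "star j * e = star j" using proj_fix_star[OF e(2) j(3)] .
    have "star j * (star X * j) = star j * X * star (X * X) * j"
      using je by (simp add: e_def mult.assoc) (metis mult.assoc)
    then show "star j * (star X * j) = 0" using XX by simp
    have "star j * (h * (star X * j)) = star j * X * star (X * (h * X)) * j"
      using je h(2) by (simp add: e_def mult.assoc) (metis mult.assoc)
    then show "star j * (h * (star X * j)) = 0" using XhX by simp
  qed
qed

text \<open>The self-adjoint case for \<open>star y * y\<close> gives \<open>s\<close>,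
  \<open>t\<close> such that \<open>y * s\<close> and \<open>y * t\<close> have orthogonal ranges.
  Split the unit along the right support \<open>p\<close> of \<open>x = y * t\<close>. On
  \<open>z1\<close> the range of \<open>x\<close> is large, so \<open>T\<close> is placed there
  while \<open>S\<close> is \<open>s\<close>; on \<open>z2\<close> the kernel of \<open>x\<close> is
  large, so \<open>S\<close> is placed in the kernel of \<open>y\<close> by way of \<open>t\<close>,
  while \<open>T\<close> is the unit.\<close>

lemma isometries_annihilating:
  assumes y: "y \<in> M"
  obtains S T where "S \<in> M" "T \<in> M" "star S * S = 1" "star T * T = 1" "star T * (y * S) = 0"
proof -
  have "star y * y \<in> M" "star (star y * y) = star y * y" using y by auto
  from selfadjoint_orthogonal_isometries[OF this] obtain s t where
    st: "s \<in> M" "t \<in> M" "star s * s = 1" "star t * t = 1" "star t * s = 0" "star t * (star y * y * s) = 0"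
    by blast
  have st': "star s * t = 0" using arg_cong[OF st(5), of star] by simp
  define x where "x = y * t"
  have xM: "x \<in> M" "star x \<in> M" using y st by (auto simp: x_def)
  define p where "p = ran (star x)"
  have p: "p \<in> M" "proj p" using ran[OF xM(2)] by (auto simp: p_def)
  have xp: "x * (1 - p) = 0"
    using arg_cong[OF ran_mult[OF xM(2)], of star] p(2) by (simp add: p_def proj_def algebra_simps)
  have one: "1 \<preceq> (1::'a)" by (rule mvleI[of 1]) auto
  have p': "1 - p \<in> M" "proj (1 - p)" using p proj_compl by auto
  obtain z1 z2 where z: "central z1" "central z2" "1 = z1 + z2" "z1 * z2 = 0" "z1 \<preceq> p" "z2 \<preceq> 1 - p"
    by (rule join_split[OF central_one p p' one_mem _ one]) (auto simp: algebra_simps)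
  have "z1 \<preceq> ran x" using mvle_trans[OF z(5)] ran_star_mvle[OF xM(1)] by (simp add: p_def)
  then obtain j where j: "j \<in> M" "star j * j = z1" "ran x * j = j" by (auto simp: mvle_def)
  obtain n where n: "n \<in> M" "star n * n = z2" "(1 - p) * n = n" using z(6) by (auto simp: mvle_def)
  note z1D = centralD[OF z(1)] and z2D = centralD[OF z(2)]
  have z21: "z2 * z1 = 0" using z1D(3)[OF z2D(1)] z(4) by simp
  have jz: "j * z2 = 0"
    using mult_initial_proj[of j] j(2) z1D(2) z(4) by (metis mult.assoc mult_zero_right)
  have sj: "z2 * star j = 0" using arg_cong[OF jz, of star] z2D(5) by simp
  have z2j: "z2 * j = 0" "star j * z2 = 0" using jz sj z2D(3)[OF j(1)] z2D(3)[of "star j"] j(1) by auto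
  have yt: "y * (t * n) = 0"
  proof -
    have "x * n = x * ((1 - p) * n)" using n(3) by simp
    also have "\<dots> = x * (1 - p) * n" by (simp only: mult.assoc)
    finally have "x * n = 0" using xp by simp
    then show ?thesis by (simp add: x_def mult.assoc)
  qed
  have jys: "star j * (y * s) = 0"
  proof -
    have "star x * (y * s) = 0" using st(6) by (simp add: x_def mult.assoc)
    then have "ran x * (y * s) = 0" using xM y st by (intro ran_mult_left_eq_0) auto
    moreover have "star j = star j * ran x" using proj_fix_star[OF proj_ran[OF xM(1)] j(3)] by simp
    ultimately show ?thesis by (metis mult.assoc mult_zero_right)
  qed
  define S where "S = s * z1 + t * n"
  define T where "T = j + z2"
  have sz: "star s * (s * z1) = z1" "star t * (t * n) = n" "star s * (t * n) = 0" "star t * (s * z1) = 0"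
    using st st' by (simp_all flip: mult.assoc)
  show thesis
  proof
    show "S \<in> M" "T \<in> M" using st z1D(1) z2D(1) n j by (auto simp: S_def T_def)
    show "star S * S = 1"
      by (simp add: S_def algebra_simps sz z1D(4,5) n(2) z(3)[symmetric])
    show "star T * T = 1"
      by (simp add: T_def algebra_simps j(2) z2D(4,5) z2j sj z(3)[symmetric] jz)
    have "z2 * (y * (s * z1)) = z2 * (y * s) * z1" by (simp only: mult.assoc)
    also have "z2 * (y * s) = y * s * z2" using z2D(3)[of "y * s"] y st by simp
    also have "y * s * z2 * z1 = y * (s * (z2 * z1))" by (simp only: mult.assoc)
    finally have "z2 * (y * (s * z1)) = 0" using z21 by simp
    moreover have "star j * (y * (s * z1)) = 0" using jys by (metis mult.assoc mult_zero_left)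
    ultimately show "star T * (y * S) = 0"
      using yt by (simp add: S_def T_def algebra_simps z2D(5))
  qed
qed

end

section \<open>Bounded generation of the unitary group\<close>

primrec word_power :: "'a::monoid_mult set \<Rightarrow> nat \<Rightarrow> 'a set" where
  "word_power W 0 = {1}"
| "word_power W (Suc k) = {w * v |w v. w \<in> W \<and> v \<in> word_power W k}"

lemma word_power_mult: "x \<in> word_power W j \<Longrightarrow> y \<in> word_power W k \<Longrightarrow> x * y \<in> word_power W (j + k)"
proof (induction j arbitrary: x)
  case (Suc j)
  then obtain w v where "x = w * v" "w \<in> W" "v \<in> word_power W j" by auto
  with Suc show ?case by (auto simp: mult.assoc)
qed auto

lemma word_power_Cons: "w \<in> W \<Longrightarrow> v \<in> word_power W k \<Longrightarrow> w * v \<in> word_power W (Suc k)"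
  by auto

text \<open>Words have an exact length, so a shorter one is padded with factors
  \<open>1\<close>.\<close>

lemma word_power_mono: "1 \<in> W \<Longrightarrow> x \<in> word_power W j \<Longrightarrow> j \<le> k \<Longrightarrow> x \<in> word_power W k"
proof (induction k)
  case (Suc k)
  show ?case
  proof (cases "j = Suc k")
    case False
    then have "x \<in> word_power W k" using Suc by simp
    with word_power_Cons[OF Suc.prems(1) this] show ?thesis by simp
  qed (use Suc in simp)
qed auto

text \<open>For partial isometries with a common initial projection and orthogonal ranges, this
  symmetry exchanges the ranges along \<open>b * star a\<close> and is the identity on their
  complement.\<close>

definition swap :: "'a::cstar_ring \<Rightarrow> 'a \<Rightarrow> 'a" where
  "swap a b = a * star b + b * star a + (1 - a * star a - b * star b)"

lemma swap:
  assumes a: "pisom a" and b: "star b * b = star a * a" and ab: "star a * b = 0"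
  shows "star (swap a b) = swap a b" "swap a b * a = b" "swap a b * b = a" "swap a b * swap a b = 1"
    and "\<And>x. star a * x = 0 \<Longrightarrow> star b * x = 0 \<Longrightarrow> swap a b * x = x"
proof -
  have ba: "star b * a = 0" using arg_cong[OF ab, of star] by simp
  have pb: "pisom b" using proj_initial[OF a] b by (simp add: pisom_iff)
  have f: "a * (star a * a) = a" "b * (star a * a) = b"
    using pisomD[OF a] pisomD[OF pb] b by simp_all
  show st: "star (swap a b) = swap a b" by (simp add: swap_def algebra_simps)
  show 1: "swap a b * a = b" and 2: "swap a b * b = a"
    by (simp_all add: swap_def algebra_simps ab ba b f)
  show 3: "swap a b * x = x" if "star a * x = 0" "star b * x = 0" for x
    using that by (simp add: swap_def algebra_simps)
  have "swap a b * (1 - a * star a - b * star b) = 1 - a * star a - b * star b"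
    by (rule 3)
       (use pisomD[OF pisom_star[OF a]] pisomD[OF pisom_star[OF pb]]
         in \<open>simp_all add: algebra_simps mult_assoc_rewrite[OF ab] mult_assoc_rewrite[OF ba]\<close>)
  moreover have "swap a b * (a * star b) = b * star b" "swap a b * (b * star a) = a * star a"
    by (simp_all add: mult_assoc_rewrite[OF 1] mult_assoc_rewrite[OF 2])
  ultimately have "swap a b * (a * star b + b * star a + (1 - a * star a - b * star b)) = 1"
    by (simp add: distrib_left)
  then show "swap a b * swap a b = 1" by (simp add: swap_def)
qed

text \<open>For an isometry \<open>c\<close>, the copy of \<open>u\<close> on the range of
  \<open>c\<close>, completed by the identity: an embedding of the unitary group into
  itself.\<close>

definition theta :: "'a::cstar_ring \<Rightarrow> 'a \<Rightarrow> 'a" where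
  "theta c u = c * u * star c + (1 - c * star c)"

lemma theta_mult:
  assumes "star c * c = 1"
  shows "theta c u * c = c * u" "star c * x = 0 \<Longrightarrow> theta c u * x = x"
  using assms by (simp_all add: theta_def algebra_simps)

section \<open>Diagonal unitaries, shifts and commutators of lifts\<close>

context vn_algebra
begin

definition uni :: "'a \<Rightarrow> bool" where
  "uni u \<longleftrightarrow> u \<in> M \<and> star u * u = 1 \<and> u * star u = 1"

lemma uniD: "uni u \<Longrightarrow> u \<in> M" "uni u \<Longrightarrow> star u * u = 1" "uni u \<Longrightarrow> u * star u = 1"
  by (auto simp: uni_def)

lemma uni_one: "uni 1"
  by (simp add: uni_def)

lemma uni_star: "uni u \<Longrightarrow> uni (star u)"
  by (simp add: uni_def)

lemma uni_mult: "uni u \<Longrightarrow> uni v \<Longrightarrow> uni (u * v)"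
  by (simp add: uni_def mult.assoc mult_assoc_rewrite[of "star u" u 1] mult_assoc_rewrite[of v "star v" 1])

lemma uni_star_mult: "uni u \<Longrightarrow> u * x = y \<Longrightarrow> star u * y = x"
  using mult_assoc_rewrite[of "star u" u 1 x] by (auto simp: uni_def)

lemma uni_swap:
  assumes "a \<in> M" "b \<in> M" "pisom a" "star b * b = star a * a" "star a * b = 0"
  shows "uni (swap a b)"
proof -
  have "swap a b \<in> M" using assms(1,2) by (simp add: swap_def)
  then show ?thesis using swap[OF assms(3-5)] by (simp add: uni_def)
qed

lemma uni_theta:
  assumes "c \<in> M" "star c * c = 1" "uni u"
  shows "uni (theta c u)"
proof -
  have "theta c u \<in> M" using assms by (simp add: theta_def uni_def)
  moreover have "star (theta c u) * theta c u = 1" "theta c u * star (theta c u) = 1"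
    using uniD[OF assms(3)] assms(2)
    by (simp_all add: theta_def algebra_simps mult_assoc_rewrite[OF assms(2)]
        mult_assoc_rewrite[OF uniD(2)[OF assms(3)]] mult_assoc_rewrite[OF uniD(3)[OF assms(3)]])
  ultimately show ?thesis by (simp add: uni_def)
qed

text \<open>The ranges of the \<open>t i\<close> may fail to fill the space; hence the separate
  clauses below for elements killed by all \<open>star (t i)\<close>.\<close>

definition orthonormal :: "('i \<Rightarrow> 'a) \<Rightarrow> bool" where
  "orthonormal t \<longleftrightarrow> (\<forall>i. t i \<in> M) \<and> (\<forall>i j. star (t i) * t j = (if i = j then 1 else 0))"

lemma orthonormalD: "orthonormal t \<Longrightarrow> t i \<in> M"
    "orthonormal t \<Longrightarrow> star (t i) * t j = (if i = j then 1 else 0)"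
  by (auto simp: orthonormal_def)

text \<open>The summands \<open>t (\<pi> i) * U i * star (t i)\<close> add up to a partial isometry
  \<open>Y\<close>. As \<open>\<pi>\<close> is a bijection, its initial and final projections both
  are the sum of the ranges of the \<open>t i\<close>, so adding the complement gives a
  unitary.\<close>

lemma permuted_unitary:
  assumes t: "orthonormal t" and U: "\<And>i. uni (U i)" and \<pi>: "bij \<pi>"
  obtains X where "uni X" "\<And>i. X * t i = t (\<pi> i) * U i"
    "\<And>x. x \<in> M \<Longrightarrow> (\<And>i. star (t i) * x = 0) \<Longrightarrow> X * x = x"
proof -
  define f where "f i = t (\<pi> i) * (U i * star (t i))" for i
  have \<pi>_eq: "\<pi> i = \<pi> j \<longleftrightarrow> i = j" for i j using \<pi> by (metis bij_pointE)
  note tD = orthonormalD[OF t] and UD = uniD[OF U]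
  have tt: "star (t i) * (t j * x) = (if i = j then x else 0)" for i j x
    using tD(2)[of i j] by (auto simp flip: mult.assoc)
  have UU: "star (U i) * (U i * x) = x" "U i * (star (U i) * x) = x" for i x
    using UD(2,3)[of i] by (simp_all flip: mult.assoc)
  have ff: "star (f i) * f j = (if i = j then t i * star (t i) else 0)"
    "f i * star (f j) = (if i = j then t (\<pi> i) * star (t (\<pi> i)) else 0)" for i j
    by (auto simp: f_def mult.assoc tt UU \<pi>_eq)
  have fM: "f i \<in> M" for i using tD UD by (simp add: f_def)
  have fp: "pisom (f i)" for i
    by (simp add: pisom_iff ff proj_def mult.assoc tt)
  obtain Y where sumY: "sum_of f UNIV Y"
    by (rule orthogonal_sum_family[of UNIV f]) (auto simp: fM fp ff)
  note Y = sum_ofD[OF sumY]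
  have Yt: "Y * t i = t (\<pi> i) * U i" for i
  proof -
    have "Y * (t i * star (t i)) = f i" using Y(6)[of i, OF UNIV_I] ff(1)[of i i] by (simp add: mult.assoc)
    then have "Y * (t i * star (t i)) * t i = f i * t i" by simp
    then show ?thesis using tD(2)[of i i] by (simp add: f_def mult.assoc)
  qed
  have Yst: "star Y * (t (\<pi> i) * U i) = t i" for i
  proof -
    have "star Y * f i = t i * star (t i)" using Y(5)[of i, OF UNIV_I] ff(1)[of i i] by simp
    then have "star Y * f i * t i = t i * star (t i) * t i" by simp
    then show ?thesis using tD(2)[of i i] by (simp add: f_def mult.assoc)
  qed
  have Y0: "Y * u = 0 \<longleftrightarrow> (\<forall>i. star (t i) * u = 0)" if "u \<in> M" for u
  proof
    assume "Y * u = 0"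
    have "star (t i) * u = star (star Y * (t (\<pi> i) * U i)) * u" for i by (simp only: Yst)
    then show "\<forall>i. star (t i) * u = 0" using \<open>Y * u = 0\<close> by (simp add: mult.assoc)
  qed (use that in \<open>auto intro!: Y(8) simp: f_def mult.assoc\<close>)
  have Ys0: "star Y * u = 0 \<longleftrightarrow> (\<forall>i. star (t i) * u = 0)" if u: "u \<in> M" for u
  proof
    assume "star Y * u = 0"
    have "star (t (\<pi> i)) * u = U i * (star (t (\<pi> i) * U i) * u)" for i by (simp add: mult.assoc UU)
    also have "\<dots> i = U i * (star (Y * t i) * u)" for i by (simp only: Yt)
    finally have "star (t (\<pi> i)) * u = 0" for i using \<open>star Y * u = 0\<close> by (simp add: mult.assoc)
    then show "\<forall>i. star (t i) * u = 0" using \<pi> by (metis bij_pointE)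
  next
    assume *: "\<forall>i. star (t i) * u = 0"
    have "star u * Y = 0"
    proof (rule Y(7))
      fix i
      have "star (star (t (\<pi> i)) * u) = 0" using * by simp
      then show "star u * f i = 0" by (simp add: f_def mult_assoc_rewrite)
    qed (use u in simp)
    then show "star Y * u = 0" by (metis star_eq_0_iff star_mult star_star)
  qed
  have P: "star Y * Y = Y * star Y"
    using initial_proj_eqI[of Y "star Y"] Y(1,2) pisom_star[OF Y(2)] Y0 Ys0 by simp
  have YP: "Y * (Y * star Y) = Y" using pisomD[OF Y(2)] P by simp
  have sYP: "star Y * (Y * star Y) = star Y" using pisomD[OF pisom_star[OF Y(2)]] by simp
  have PY: "Y * (star Y * Y) = Y" "star Y * (Y * Y) = Y"
    using pisomD[OF Y(2)] P by (simp, metis mult.assoc)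
  have PsY: "Y * (star Y * star Y) = star Y"
    using arg_cong[OF YP, of star] by (simp add: mult.assoc)
  define X where "X = Y + (1 - Y * star Y)"
  show thesis
  proof
    show "uni X" unfolding uni_def
      using Y(1) by (simp add: X_def algebra_simps YP sYP PY PsY P)
    show "X * t i = t (\<pi> i) * U i" for i
    proof -
      have "Y * star Y * t i = t i" unfolding P[symmetric] by (simp add: mult.assoc Yt Yst)
      then show ?thesis by (simp add: X_def algebra_simps Yt)
    qed
    show "X * x = x" if "x \<in> M" "\<And>i. star (t i) * x = 0" for x
      using that Y0[OF that(1)] Ys0[OF that(1)] by (simp add: X_def algebra_simps)
  qed
qed

text \<open>With \<open>P\<close> the sum of the ranges of the \<open>t i\<close>, the two
  hypotheses settle \<open>(A - B) * P\<close> and \<open>(A - B) * (1 - P)\<close>.\<close>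

lemma orthonormal_ext:
  assumes t: "orthonormal t" and A: "A \<in> M" "B \<in> M" "\<And>i. A * t i = B * t i"
    and ext: "\<And>x. x \<in> M \<Longrightarrow> (\<And>i. star (t i) * x = 0) \<Longrightarrow> A * x = B * x"
  shows "A = B"
proof -
  note tD = orthonormalD[OF t]
  have tt: "star (t i) * (t j * x) = (if i = j then x else 0)" for i j x
    using tD(2)[of i j] by (auto simp flip: mult.assoc)
  define f where "f i = t i * star (t i)" for i
  have fp: "pisom (f i)" for i by (simp add: pisom_def f_def mult.assoc tt)
  obtain P where sumP: "sum_of f UNIV P"
    by (rule orthogonal_sum_family[of UNIV f]) (auto simp: f_def tD fp[unfolded f_def] mult.assoc tt)
  note P = sum_ofD(1,4,7)[OF sumP]
  have "star (t i) * (f i * P) = star (t i) * (f i * f i)" for i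
    using P(2)[of i, OF UNIV_I] by (simp add: f_def)
  then have "star (t i) * P = star (t i)" for i by (simp add: f_def mult.assoc tt)
  then have "A * (1 - P) = B * (1 - P)"
    using P(1) by (intro ext) (auto simp: algebra_simps)
  moreover have "(A - B) * P = 0"
    using A by (intro P(3)) (auto simp: f_def algebra_simps mult_assoc_rewrite[OF A(3)])
  ultimately show ?thesis by (simp add: algebra_simps)
qed

text \<open>On the summands indexed by \<open>\<int>\<close>, take \<open>D = diag(\<dots>,1,1,u,u,\<dots>)\<close> and the bilateral shift \<open>S\<close>.\<close>

lemma theta_commutator:
  assumes t: "orthonormal (t :: int \<Rightarrow> 'a)" and u: "uni u"
  obtains D S where "uni D" "uni S" "D * S * star D * star S = theta (t 0) u"
proof -
  note tD = orthonormalD[OF t] and uD = uniD[OF u]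
  obtain D where D: "uni D" "\<And>i. D * t i = t i * (if i \<ge> 0 then u else 1)"
    "\<And>x. x \<in> M \<Longrightarrow> (\<And>i. star (t i) * x = 0) \<Longrightarrow> D * x = x"
    by (rule permuted_unitary[OF t, of "\<lambda>i. if i \<ge> 0 then u else 1" id]) (use u uni_one in auto)
  have "bij (\<lambda>i::int. i + 1)" by (rule bij_betwI[where g = "\<lambda>i. i - 1"]) auto
  then obtain S where S: "uni S" "\<And>i. S * t i = t (i + 1)"
    "\<And>x. x \<in> M \<Longrightarrow> (\<And>i. star (t i) * x = 0) \<Longrightarrow> S * x = x"
    using permuted_unitary[OF t, of "\<lambda>i. 1" "\<lambda>i. i + 1"] uni_one by auto
  have sS: "star S * t i = t (i - 1)" for i
    using uni_star_mult[OF S(1) S(2)[of "i - 1"]] by simp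
  have sD: "star D * t i = t i * (if i \<ge> 0 then star u else 1)" for i
  proof (cases "i \<ge> 0")
    case True
    then have "D * (t i * star u) = t i" using D(2)[of i] uD
      by (simp add: mult_assoc_rewrite[OF D(2)] mult.assoc)
    from uni_star_mult[OF D(1) this] show ?thesis using True by simp
  next
    case False
    then have "D * t i = t i" using D(2)[of i] by simp
    from uni_star_mult[OF D(1) this] show ?thesis using False by simp
  qed
  have KM: "D * S * star D * star S \<in> M" "theta (t 0) u \<in> M"
    using uniD(1)[OF D(1)] uniD(1)[OF S(1)] tD uD by (simp_all add: theta_def)
  have t0: "star (t 0) * t 0 = 1" using tD(2) by simp
  \<comment> \<open>\<open>S * star D * star S\<close> is the inverse diagonal moved up by one
    place, so against \<open>D\<close> only the entry at \<open>0\<close> survives.\<close>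
  have "D * S * star D * star S = theta (t 0) u"
  proof (rule orthonormal_ext[OF t KM])
    fix i
    have th: "theta (t 0) u * t i = (if i = 0 then t 0 * u else t i)"
      using theta_mult(1)[OF t0, of u] theta_mult(2)[OF t0, of "t i" u] tD(2)[of 0 i] by auto
    show "D * S * star D * star S * t i = theta (t 0) u * t i"
    proof (cases "i \<ge> 1")
      case True
      then have "D * S * star D * star S * t i = t i * (u * star u)"
        by (simp add: mult.assoc sS sD mult_assoc_rewrite[OF sD] mult_assoc_rewrite[OF S(2)] mult_assoc_rewrite[OF D(2)])
      then show ?thesis using True th uD by simp
    next
      case False
      then show ?thesis using th by (simp add: mult.assoc sS sD S(2) D(2))
    qed
  next
    fix x assume x: "x \<in> M" "\<And>i. star (t i) * x = 0"
    have "star S * x = x" "star D * x = x"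
      using uni_star_mult[OF S(1) S(3)[OF x]] uni_star_mult[OF D(1) D(3)[OF x]] by auto
    moreover have "theta (t 0) u * x = x" using theta_mult(2)[OF t0 x(2)] .
    ultimately show "D * S * star D * star S * x = theta (t 0) u * x"
      using D(3)[OF x] S(3)[OF x] by (simp add: mult.assoc)
  qed
  then show thesis using that D S by blast
qed

text \<open>\<open>A\<close> and \<open>B\<close> are uncontrolled on
  \<open>r = 1 - c * star c\<close>. The symmetry \<open>g\<close> moves \<open>r\<close> into the
  range of \<open>c * \<beta>\<close>, where \<open>B\<close> is trivial because
  \<open>theta \<alpha> V\<close> fixes \<open>\<beta>\<close>; so \<open>g * B * g\<close> is
  trivial on \<open>r\<close>, while \<open>A\<close> is trivial on
  \<open>c * (1 - \<alpha> * star \<alpha>)\<close>. The two interfere only on the range of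
  \<open>c * \<alpha>\<close>, which \<open>g\<close> fixes, and there they act as \<open>U\<close>
  and \<open>V\<close>.\<close>

lemma commutator_of_lifts:
  assumes c: "c \<in> M" "star c * c = 1" and \<alpha>: "\<alpha> \<in> M" "star \<alpha> * \<alpha> = 1"
    and \<beta>: "\<beta> \<in> M" "star \<beta> * \<beta> = 1" and \<alpha>\<beta>: "star \<alpha> * \<beta> = 0"
    and U: "uni U" and V: "uni V" and A: "uni A" "A * c = c * theta \<alpha> U" and B: "uni B" "B * c = c * theta \<alpha> V"
    and g: "g = swap (1 - c * star c) (c * (\<beta> * (1 - c * star c)))"
  shows "uni g" "star g = g"
    "A * (g * (B * (g * (star A * (g * (star B * g)))))) = theta (c * \<alpha>) (U * V * star U * star V)"
proof -
  define r where "r = 1 - c * star c"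
  define v where "v = c * (\<beta> * r)"
  have cc: "star c * (c * x) = x" for x using c(2) by (simp flip: mult.assoc)
  have bb: "star \<beta> * (\<beta> * x) = x" for x using \<beta>(2) by (simp flip: mult.assoc)
  have aa: "star \<alpha> * (\<alpha> * x) = x" for x using \<alpha>(2) by (simp flip: mult.assoc)
  have ab: "star \<alpha> * (\<beta> * x) = 0" for x using \<alpha>\<beta> by (simp flip: mult.assoc)
  have ba: "star \<beta> * \<alpha> = 0" using arg_cong[OF \<alpha>\<beta>, of star] by simp
  have ba': "star \<beta> * (\<alpha> * x) = 0" for x using ba by (simp flip: mult.assoc)
  have rr: "star r = r" "r * r = r" "star c * r = 0" "r * c = 0" "r \<in> M"
    using c by (simp_all add: r_def algebra_simps cc)
  have rc: "r * (c * x) = 0" for x using rr(4) by (simp flip: mult.assoc)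
  have pr: "pisom r" by (simp add: pisom_def rr)
  have vv: "star v * v = star r * r" "star r * v = 0" "v \<in> M"
    using c \<beta> rr by (simp_all add: v_def mult.assoc cc bb rc)
  note sw = swap[OF pr vv(1,2)]
  have g_def: "g = swap r v" by (simp add: g r_def v_def)
  show "uni g" unfolding g_def by (rule uni_swap[OF rr(5) vv(3) pr vv(1,2)])
  show sg: "star g = g" unfolding g_def by (rule sw(1))
  have gr: "g * r = v" "g * v = r" "g * g = 1" using sw by (simp_all add: g_def)
  have gx: "g * x = x" if "r * x = 0" "star v * x = 0" for x using sw(5)[of x] that rr by (simp add: g_def)
  have gca: "g * (c * (\<alpha> * x)) = c * (\<alpha> * x)" for x
    by (rule gx) (simp_all add: v_def rc mult.assoc cc ba' rr(1))
  have lift: "D * (c * (\<alpha> * x)) = c * (\<alpha> * (W * x))" "D * (c * (\<beta> * x)) = c * (\<beta> * x)"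
    "D * (c * (1 - \<alpha> * star \<alpha>)) = c * (1 - \<alpha> * star \<alpha>)" "star c * (D * r) = 0"
    if D: "uni D" "D * c = c * theta \<alpha> W" and W: "uni W" for D W x
  proof -
    have Dc: "D * (c * x) = c * (theta \<alpha> W * x)" for x
      using D(2) by (metis mult.assoc)
    show "D * (c * (\<alpha> * x)) = c * (\<alpha> * (W * x))"
      by (simp add: Dc theta_def algebra_simps aa)
    show "D * (c * (\<beta> * x)) = c * (\<beta> * x)"
      by (simp add: Dc theta_def algebra_simps ab)
    show "D * (c * (1 - \<alpha> * star \<alpha>)) = c * (1 - \<alpha> * star \<alpha>)"
      unfolding Dc by (simp add: theta_def algebra_simps aa)
    have "star D * (c * theta \<alpha> W) = c" using uni_star_mult[OF D(1) D(2)] .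
    then have "star D * (c * theta \<alpha> W) * star (theta \<alpha> W) = c * star (theta \<alpha> W)" by simp
    then have "star D * c = c * star (theta \<alpha> W)"
      using uniD(3)[OF uni_theta[OF \<alpha> W]] by (simp add: mult.assoc)
    from arg_cong[OF this, of star] have "star c * D = theta \<alpha> W * star c" by simp
    then show "star c * (D * r) = 0" using rr(3) by (simp add: mult.assoc flip: mult.assoc[of "star c"])
  qed
  have slift: "star D * (c * (\<alpha> * x)) = c * (\<alpha> * (star W * x))"
    "star D * (c * (1 - \<alpha> * star \<alpha>)) = c * (1 - \<alpha> * star \<alpha>)" "star c * (star D * r) = 0"
    if D: "uni D" "D * c = c * theta \<alpha> W" and W: "uni W" for D W x
  proof -
    have WW: "W * (star W * x) = x" using uniD(3)[OF W] by (simp flip: mult.assoc)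
    show "star D * (c * (\<alpha> * x)) = c * (\<alpha> * (star W * x))"
      by (rule uni_star_mult[OF D(1)]) (simp add: lift(1)[OF D W] WW)
    show "star D * (c * (1 - \<alpha> * star \<alpha>)) = c * (1 - \<alpha> * star \<alpha>)"
      by (rule uni_star_mult[OF D(1) lift(3)[OF D W]])
    have "star c * (star D * r) = star (D * c) * r" by (simp add: mult.assoc)
    then show "star c * (star D * r) = 0" using rr(3) by (simp add: D(2) mult.assoc)
  qed
  define B' where "B' = g * (B * g)"
  have uB': "uni B'" unfolding B'_def by (intro uni_mult \<open>uni g\<close> B)
  have B'ca: "B' * (c * (\<alpha> * x)) = c * (\<alpha> * (V * x))" for x
    by (simp add: B'_def mult.assoc gca lift(1)[OF B V])
  have B'r: "B' * r = r"
    by (simp add: B'_def mult.assoc gr(1)) (simp add: v_def lift(2)[OF B V], simp add: gr(2) flip: v_def)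
  have sB'r: "star B' * r = r" by (rule uni_star_mult[OF uB' B'r])
  have VV: "V * (star V * x) = x" for x using uniD(3)[OF V] by (simp flip: mult.assoc)
  have sB'ca: "star B' * (c * (\<alpha> * x)) = c * (\<alpha> * (star V * x))" for x
    by (rule uni_star_mult[OF uB']) (simp add: B'ca VV)
  define q where "q = c * (1 - \<alpha> * star \<alpha>)"
  have AA: "A * (star A * x) = x" and BB: "B' * (star B' * x) = x" for x
    using uniD(3)[OF A(1)] uniD(3)[OF uB'] by (simp_all flip: mult.assoc)
  define K where "K = A * (B' * (star A * star B'))"
  define T where "T = theta (c * \<alpha>) (U * V * star U * star V)"
  have ca: "star (c * \<alpha>) * (c * \<alpha>) = 1" using \<alpha> by (simp add: mult.assoc cc)
  have 1: "K * (c * \<alpha>) = T * (c * \<alpha>)"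
  proof -
    have "K * (c * (\<alpha> * 1)) = c * (\<alpha> * (U * (V * (star U * (star V * 1)))))"
      by (simp only: K_def mult.assoc B'ca sB'ca lift(1)[OF A U] slift(1)[OF A U])
    moreover have "T * (c * \<alpha>) = c * \<alpha> * (U * V * star U * star V)"
      unfolding T_def by (rule theta_mult[OF ca])
    ultimately show ?thesis by (simp add: mult.assoc)
  qed
  \<comment> \<open>\<open>B'\<close> preserves the range of \<open>c * \<alpha>\<close> and fixes
    \<open>r\<close>, so \<open>star B'\<close> maps \<open>q\<close> into what is left, the range
    of \<open>q\<close>; there \<open>star A\<close> is trivial.\<close>
  have 2: "K * q = T * q"
  proof -
    define x where "x = star B' * q"
    have "star \<alpha> * (star c * x) = star (B' * (c * (\<alpha> * 1))) * q"
      by (simp add: x_def mult.assoc)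
    also have "\<dots> = 0" by (simp only: B'ca) (simp add: q_def mult.assoc cc c(2) algebra_simps aa)
    finally have x1: "star \<alpha> * (star c * x) = 0" .
    have "r * x = star (B' * r) * q" by (simp add: x_def mult.assoc rr)
    also have "\<dots> = 0" by (simp add: B'r rr q_def rc)
    finally have x2: "x = c * (star c * x)" by (simp add: r_def algebra_simps)
    have "x = q * (star c * x)" using x1 x2 by (simp add: q_def algebra_simps)
    then have "star A * x = star A * q * (star c * x)" by (metis mult.assoc)
    also have "star A * q = q" unfolding q_def by (rule slift(2)[OF A U])
    finally have "star A * x = x" using \<open>x = q * (star c * x)\<close> by simp
    then have "K * q = A * q" by (simp add: K_def mult.assoc BB flip: x_def) (simp add: x_def BB)
    also have "\<dots> = q" unfolding q_def by (rule lift(3)[OF A U])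
    also have "T * q = q"
      unfolding T_def by (rule theta_mult(2)[OF ca]) (simp add: q_def mult.assoc cc c(2) algebra_simps aa)
    ultimately show ?thesis by simp
  qed
  \<comment> \<open>\<open>star A\<close> keeps \<open>r\<close> inside its own range, on which
    \<open>B'\<close> is trivial.\<close>
  have 3: "K * r = T * r"
  proof -
    define y where "y = star A * r"
    have "star c * y = 0" unfolding y_def by (rule slift(3)[OF A U])
    then have y: "r * y = y" by (simp add: r_def algebra_simps)
    have "B' * y = B' * r * y" using y by (simp add: mult.assoc)
    then have "B' * y = y" using B'r y by simp
    then have "K * r = r" by (simp add: K_def mult.assoc sB'r flip: y_def) (simp add: y_def AA)
    moreover have "T * r = r"
      unfolding T_def by (rule theta_mult(2)[OF ca]) (simp add: mult.assoc rr)
    ultimately show ?thesis by simp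
  qed
  have "c * \<alpha> * star (c * \<alpha>) + q * star c + r = 1"
    by (simp add: q_def r_def algebra_simps)
  then have "K = K * (c * \<alpha> * star (c * \<alpha>) + q * star c + r)" by simp
  also have "\<dots> = K * (c * \<alpha>) * star (c * \<alpha>) + K * q * star c + K * r"
    by (simp only: distrib_left mult.assoc)
  also have "\<dots> = T * (c * \<alpha>) * star (c * \<alpha>) + T * q * star c + T * r"
    by (simp only: 1 2 3)
  also have "\<dots> = T * (c * \<alpha> * star (c * \<alpha>) + q * star c + r)"
    by (simp only: distrib_left mult.assoc)
  also have "\<dots> = T" using \<open>c * \<alpha> * star (c * \<alpha>) + q * star c + r = 1\<close> by simp
  finally have "K = T" .
  moreover have "K = A * (g * (B * (g * (star A * (g * (star B * g))))))"
    by (simp add: K_def B'_def sg mult.assoc)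
  ultimately show "A * (g * (B * (g * (star A * (g * (star B * g)))))) = theta (c * \<alpha>) (U * V * star U * star V)"
    by (simp add: T_def)
qed

text \<open>A unitary that fixes \<open>e\<close> also satisfies \<open>e * X = e\<close>, so it is
  block diagonal and the compression to the range of \<open>c\<close> is unitary.\<close>

lemma supported_eq_theta:
  assumes c: "c \<in> M" "star c * c = 1" and X: "uni X" "X * (1 - c * star c) = 1 - c * star c"
  obtains Y where "uni Y" "X = theta c Y"
proof
  define e where "e = 1 - c * star c"
  have ec: "e * c = 0" "e * (c * x) = 0" for x
    using c(2) mult_assoc_rewrite[OF c(2)] by (simp_all add: e_def algebra_simps)
  have cce: "c * (star c * x) = x - e * x" for x by (simp add: e_def algebra_simps)
  have se: "star e = e" by (simp add: e_def)
  have Xe: "X * e = e" using X(2) by (simp add: e_def)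
  have sXe: "star X * e = e" using uni_star_mult[OF X(1) Xe] .
  have eX: "e * X = e" "e * star X = e"
    using arg_cong[OF sXe, of star] arg_cong[OF Xe, of star] se by simp_all
  have eX': "e * (X * x) = e * x" "e * (star X * x) = e * x" for x
    using eX by (simp_all flip: mult.assoc)
  have XX: "star X * (X * x) = x" "X * (star X * x) = x" for x
    using uniD(2,3)[OF X(1)] by (simp_all flip: mult.assoc)
  show "uni (star c * (X * c))"
    using c uniD(1)[OF X(1)]
    by (simp add: uni_def mult.assoc cce right_diff_distrib eX' ec XX)
  have "theta c (star c * (X * c)) = c * (star c * (X * (c * star c))) + e"
    by (simp only: theta_def mult.assoc e_def)
  also have "\<dots> = X * (c * star c) + e" by (simp add: cce[of "X * (c * star c)"] eX' ec)
  also have "c * star c = 1 - e" by (simp add: e_def)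
  finally show "X = theta c (star c * (X * c))" using Xe by (simp add: algebra_simps)
qed

end

section \<open>Diagonal argument and count of factors\<close>

context properly_infinite_algebra
begin

text \<open>\<open>\<beta>\<close> makes room and \<open>\<alpha>\<close> occupies it: the family is
  \<open>\<beta> ^ n * \<alpha>\<close>.\<close>

lemma orthonormal_sequence:
  obtains s :: "nat \<Rightarrow> 'a" where "orthonormal s"
proof -
  obtain \<alpha> \<beta> where \<alpha>: "\<alpha> \<in> M" "\<beta> \<in> M" "star \<alpha> * \<alpha> = 1" "star \<beta> * \<beta> = 1" "star \<alpha> * \<beta> = 0"
    by (rule orthogonal_isometries)
  have cancel: "star \<beta> ^ n * (\<beta> ^ n * x) = x" for n x
  proof (induction n)
    case (Suc n)
    have "star \<beta> ^ Suc n * (\<beta> ^ Suc n * x) = star \<beta> ^ n * (star \<beta> * \<beta>) * (\<beta> ^ n * x)"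
      by (simp only: power_Suc2[of "star \<beta>"] power_Suc[of \<beta>] mult.assoc)
    then show ?case using Suc \<alpha> by simp
  qed auto
  define s where "s n = \<beta> ^ n * \<alpha>" for n
  have less: "star (s m) * s n = 0" if "m < n" for m n
  proof -
    obtain k where k: "n = m + Suc k" using \<open>m < n\<close> less_iff_Suc_add by auto
    have "star (s m) * s n = star \<alpha> * (star \<beta> ^ m * (\<beta> ^ m * (\<beta> ^ Suc k * \<alpha>)))"
      by (simp only: s_def k power_add star_mult star_power mult.assoc)
    also have "\<dots> = star \<alpha> * (\<beta> ^ Suc k * \<alpha>)" by (simp only: cancel)
    also have "\<dots> = 0" by (simp add: mult.assoc mult_assoc_rewrite[OF \<alpha>(5)])
    finally show ?thesis .
  qed
  have "star (s m) * s n = 0" if "n < m" for m n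
    using arg_cong[OF less[OF that], of star] by simp
  with less have "star (s m) * s n = 0" if "m \<noteq> n" for m n using that by (meson nat_neq_iff)
  moreover have "star (s n) * s n = 1" for n using \<alpha> by (simp add: s_def mult.assoc cancel)
  moreover have "s n \<in> M" for n using \<alpha> by (simp add: s_def)
  ultimately show thesis using that[of s] by (auto simp: orthonormal_def)
qed

text \<open>The 60 is \<open>26 + (8 + 26)\<close>, for the factors \<open>\<sigma>2\<close>,
  \<open>\<sigma>1\<close> and \<open>\<rho>\<close>. \<open>sym\<close> provides the adjoints of
  lifts in the words of length 8; the clause on \<open>1\<close> serves later padding.\<close>

lemma unitary_word_bound:
  fixes W :: "nat \<Rightarrow> 'a set"
  assumes W: "\<And>n w. w \<in> W n \<Longrightarrow> uni w" "\<And>n. W n \<subseteq> W (Suc n)" "\<And>u. uni u \<Longrightarrow> \<exists>n. u \<in> W n"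
    and sym: "\<And>n w. w \<in> W n \<Longrightarrow> star w \<in> W n"
  obtains n where "\<And>u. uni u \<Longrightarrow> u \<in> word_power (W n) 60" "1 \<in> W n"
proof -
  have mono: "W m \<subseteq> W n" if "m \<le> n" for m n using lift_Suc_mono_le[of W, OF W(2) that] .
  obtain s :: "nat \<Rightarrow> 'a" where s: "orthonormal s" by (rule orthonormal_sequence)
  note sD = orthonormalD[OF s]
  \<comment> \<open>If for each \<open>n\<close> some \<open>U n\<close> had no lift in
    \<open>W n\<close> along \<open>s n\<close>, the diagonal unitary with entries
    \<open>U n\<close> would belong to no \<open>W n\<close>.\<close>
  have "\<exists>n. \<forall>u. uni u \<longrightarrow> (\<exists>w\<in>W n. w * s n = s n * u)"
  proof (rule ccontr)
    assume "\<not> ?thesis"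
    then obtain U where U: "\<And>n. uni (U n)" "\<And>n w. w \<in> W n \<Longrightarrow> w * s n \<noteq> s n * U n" by metis
    obtain X where X: "uni X" "\<And>n. X * s n = s n * U n"
    proof (rule permuted_unitary[OF s U(1) bij_id])
      fix X assume "uni X" "\<And>n. X * s n = s (id n) * U n"
      then show thesis by (intro that) simp_all
    qed
    then show False using U(2) W(3)[OF X(1)] by blast
  qed
  then obtain n0 where n0: "\<And>u. uni u \<Longrightarrow> \<exists>w\<in>W n0. w * s n0 = s n0 * u" by blast
  define c where "c = s n0"
  have c: "c \<in> M" "star c * c = 1" using sD by (simp_all add: c_def)
  obtain \<alpha> \<beta> where \<alpha>: "\<alpha> \<in> M" "\<beta> \<in> M" "star \<alpha> * \<alpha> = 1" "star \<beta> * \<beta> = 1" "star \<alpha> * \<beta> = 0"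
    by (rule orthogonal_isometries)
  have \<beta>\<alpha>: "star \<beta> * \<alpha> = 0" using arg_cong[OF \<alpha>(5), of star] by simp
  \<comment> \<open>Indexing by the integers makes the bilateral shift available.\<close>
  define t where "t i = s (int_encode i)" for i
  have t: "orthonormal t" using sD by (auto simp: orthonormal_def t_def int_encode_eq)
  \<comment> \<open>Lifts produce copies of commutators along \<open>c * \<alpha>\<close>, and the
    shift turns a commutator into a copy along \<open>t 0\<close>; \<open>d\<close> composes the
    two.\<close>
  define d where "d = c * \<alpha> * t 0"
  have t0: "t 0 \<in> M" "star (t 0) * t 0 = 1" using orthonormalD[OF t] by simp_all
  have d: "d \<in> M" "star d * d = 1"
    using c \<alpha> t0 mult_assoc_rewrite[OF c(2)] mult_assoc_rewrite[OF \<alpha>(3)]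
    by (simp_all add: d_def mult.assoc)
  define a where "a = d * \<alpha>"
  define b where "b = d * \<beta>"
  define e where "e = 1 - d * star d"
  have dd: "star d * (d * x) = x" for x using d(2) by (simp flip: mult.assoc)
  have e: "e \<in> M" "star e = e" "e * e = e" "star d * e = 0" "e * d = 0"
    using d by (simp_all add: e_def algebra_simps dd)
  have ed: "e * (d * x) = 0" for x using e(5) by (simp flip: mult.assoc)
  have ab: "a \<in> M" "b \<in> M" "star a * a = 1" "star b * b = 1" "star a * b = 0" "star b * a = 0"
    using d \<alpha> \<beta>\<alpha> by (simp_all add: a_def b_def mult.assoc dd)
  have eab: "e * a = 0" "e * b = 0" "star a * e = 0" "star b * e = 0"
    by (simp_all add: a_def b_def ed mult.assoc e(4))
  have pe: "pisom e" by (simp add: pisom_def e)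
  have iso: "pisom x" if "star x * x = 1" for x using that by (simp add: pisom_def mult.assoc)
  have sw: "star x * x = 1 \<Longrightarrow> star (x * e) * (x * e) = star e * e" for x
    using mult_assoc_rewrite[of "star x" x 1 e] by (simp add: mult.assoc)
  have sw0: "e * x = 0 \<Longrightarrow> star e * (x * e) = 0" for x
    using e(2) by (simp flip: mult.assoc)
  define g where "g = swap (1 - c * star c) (c * (\<beta> * (1 - c * star c)))"
  have ug: "uni g"
    using commutator_of_lifts(1)[OF c \<alpha>(1,3,2,4,5) uni_one uni_one uni_one _ uni_one _ g_def]
    by (simp_all add: theta_def)
  have uni_e: "uni (swap e (x * e))" if "x \<in> M" "star x * x = 1" "e * x = 0" for x
    using that e by (intro uni_swap pe sw sw0) auto
  obtain n1 n2 n3 n4 where n: "g \<in> W n1" "swap e (a * e) \<in> W n2" "swap e (b * e) \<in> W n3" "1 \<in> W n4"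
    using W(3) ug uni_e ab eab uni_one by metis
  \<comment> \<open>Besides the lifts only finitely many fixed elements have to be reached: three
    symmetries and \<open>1\<close>.\<close>
  define N where "N = Max {n0, n1, n2, n3, n4}"
  have le: "n0 \<le> N" "n1 \<le> N" "n2 \<le> N" "n3 \<le> N" "n4 \<le> N" by (auto simp: N_def)
  have WN: "g \<in> W N" "swap e (a * e) \<in> W N" "swap e (b * e) \<in> W N" "1 \<in> W N"
    using n mono le by blast+
  have lift: "\<exists>w\<in>W N. w * c = c * u" if "uni u" for u
    using n0[OF that] mono[OF le(1)] by (auto simp: c_def)
  have supp: "X \<in> word_power (W N) 8" if X: "uni X" "X * e = e" for X
  proof -
    obtain Y where Y: "uni Y" "X = theta d Y"
      using supported_eq_theta[OF d X(1)] X(2) by (auto simp: e_def)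
    obtain D S where DS: "uni D" "uni S" "D * S * star D * star S = theta (t 0) Y"
      using theta_commutator[OF t Y(1)] by blast
    have "\<exists>A\<in>W N. A * c = c * theta \<alpha> D" "\<exists>B\<in>W N. B * c = c * theta \<alpha> S"
      using lift uni_theta[OF \<alpha>(1,3)] DS by auto
    then obtain A B where A: "A \<in> W N" "A * c = c * theta \<alpha> D" and B: "B \<in> W N" "B * c = c * theta \<alpha> S"
      by blast
    have "theta (c * \<alpha>) (theta (t 0) Y) = X"
      by (simp add: Y(2) theta_def d_def algebra_simps)
    then have "A * (g * (B * (g * (star A * (g * (star B * g)))))) = X"
      using commutator_of_lifts(3)[OF c \<alpha>(1,3,2,4,5) DS(1,2) W(1)[OF A(1)] A(2) W(1)[OF B(1)] B(2) g_def] DS(3)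
      by simp
    moreover have "A * (g * (B * (g * (star A * (g * (star B * (g * 1))))))) \<in>
        word_power (W N) (Suc (Suc (Suc (Suc (Suc (Suc (Suc (Suc 0))))))))"
      using A B WN sym by (intro word_power_Cons) auto
    ultimately show ?thesis by (simp add: eval_nat_numeral)
  qed
  \<comment> \<open>\<open>h\<close> carries \<open>e\<close> to \<open>x * e\<close>, and
    \<open>\<tau>\<close> carries that to \<open>y * e\<close>, where \<open>X\<close> is trivial;
    so the conjugate \<open>X2\<close> fixes \<open>e\<close> and costs 8. Undoing the conjugation
    takes \<open>\<tau>\<close> twice at 8 each and \<open>h\<close> twice at 1 each.\<close>
  have fixing: "X \<in> word_power (W N) 26"
    if x: "x \<in> {a, b}" and y: "y \<in> M" "star y * y = 1" "e * y = 0" "star y * x = 0"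
      and X: "uni X" "X * y = y" for X x y
  proof -
    have xD: "x \<in> M" "star x * x = 1" "e * x = 0" "star x * e = 0" "swap e (x * e) \<in> W N"
      using x ab eab WN by auto
    define \<tau> where "\<tau> = swap y x"
    define h where "h = swap e (x * e)"
    have xy: "star x * x = star y * y" using xD y by simp
    have u\<tau>: "uni \<tau>" unfolding \<tau>_def by (rule uni_swap[OF y(1) xD(1) iso[OF y(2)] xy y(4)])
    note \<tau> = swap[OF iso[OF y(2)] xy y(4), folded \<tau>_def]
    have uh: "uni h" unfolding h_def by (rule uni_e[OF xD(1-3)])
    note h = swap[OF pe sw[OF xD(2)] sw0[OF xD(3)], folded h_def]
    have ye: "star y * e = 0" using arg_cong[OF y(3), of star] e(2) by simp
    have \<tau>8: "\<tau> \<in> word_power (W N) 8" by (rule supp[OF u\<tau> \<tau>(5)[OF ye xD(4)]])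
    define X2 where "X2 = h * (\<tau> * (X * (\<tau> * h)))"
    have X2: "uni X2" unfolding X2_def by (intro uni_mult uh u\<tau> X)
    have "X2 * e = h * (\<tau> * (X * (\<tau> * (x * e))))" by (simp add: X2_def mult.assoc h(2))
    also have "\<dots> = e"
      by (simp add: mult_assoc_rewrite[OF \<tau>(3)] mult_assoc_rewrite[OF X(2)] mult_assoc_rewrite[OF \<tau>(2)] h(3))
    finally have X28: "X2 \<in> word_power (W N) 8" by (intro supp X2)
    have "\<tau> * (h * (X2 * (h * \<tau>))) = X"
      by (simp add: X2_def mult.assoc mult_assoc_rewrite[OF h(4)] mult_assoc_rewrite[OF \<tau>(4)] \<tau>(4))
    moreover have "\<tau> * (h * (X2 * (h * \<tau>))) \<in> word_power (W N) (8 + Suc (8 + Suc 8))"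
      using xD(5) by (intro word_power_mult word_power_Cons \<tau>8 X28) (simp_all add: h_def)
    ultimately show ?thesis by simp
  qed
  have "u \<in> word_power (W N) 60" if u: "uni u" for u
  proof -
    \<comment> \<open>Placing \<open>S\<close> in the range of \<open>a\<close> and \<open>T\<close>
      in that of \<open>b\<close> makes them orthogonal from the outset; only the compression of
      \<open>u\<close> between these ranges must be annihilated.\<close>
    have "star b * (u * a) \<in> M" using ab uniD[OF u] by simp
    from isometries_annihilating[OF this] obtain S' T' where
      ST: "S' \<in> M" "T' \<in> M" "star S' * S' = 1" "star T' * T' = 1" "star T' * (star b * (u * a) * S') = 0"
      by blast
    define S where "S = a * S'"
    define T where "T = b * T'"
    have abx: "star a * (a * x) = x" "star b * (b * x) = x" "star a * (b * x) = 0" "star b * (a * x) = 0" for x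
      using ab by (simp_all flip: mult.assoc)
    have S: "S \<in> M" "star S * S = 1" "e * S = 0" "star S * b = 0"
      and T: "T \<in> M" "star T * T = 1" "e * T = 0" "star T * a = 0"
      and STo: "star S * T = 0"
      using ab ST by (simp_all add: S_def T_def mult.assoc abx mult_assoc_rewrite[OF eab(1)] mult_assoc_rewrite[OF eab(2)])
    have TuS: "star T * (u * S) = 0" using ST(5) by (simp add: S_def T_def mult.assoc)
    have Sx: "star S * (S * x) = x" "star T * (T * x) = x" "star T * (u * (S * x)) = 0" "e * (S * x) = 0" "e * (T * x) = 0" for x
      using S T mult_assoc_rewrite2[OF TuS] by (simp_all add: mult_assoc_rewrite)
    have ux: "star u * (u * x) = x" for x using uniD(2)[OF u] by (simp flip: mult.assoc)
    define \<sigma>1 where "\<sigma>1 = swap S T"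
    have TT: "star T * T = star S * S" using S T by simp
    have u1: "uni \<sigma>1" unfolding \<sigma>1_def by (rule uni_swap[OF S(1) T(1) iso[OF S(2)] TT STo])
    note s1 = swap[OF iso[OF S(2)] TT STo, folded \<sigma>1_def]
    have Se: "star S * e = 0" "star T * e = 0"
      using arg_cong[OF S(3), of star] arg_cong[OF T(3), of star] e(2) by simp_all
    have 1: "\<sigma>1 \<in> word_power (W N) 8" by (rule supp[OF u1 s1(5)[OF Se]])
    \<comment> \<open>Exchanging only the \<open>\<alpha>\<close> halves leaves
      \<open>T * \<beta>\<close> fixed by \<open>\<sigma>2\<close>, which is the isometry that
      \<open>fixing\<close> needs.\<close>
    define p where "p = T * \<alpha>"
    define q where "q = u * (S * \<alpha>)"
    have pq: "p \<in> M" "q \<in> M" "star p * p = 1" "star q * q = star p * p" "star p * q = 0"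
      using S T \<alpha> uniD[OF u] by (simp_all add: p_def q_def mult.assoc Sx ux)
    define \<sigma>2 where "\<sigma>2 = swap p q"
    have u2: "uni \<sigma>2" unfolding \<sigma>2_def by (rule uni_swap[OF pq(1,2) iso[OF pq(3)] pq(4,5)])
    note s2 = swap[OF iso[OF pq(3)] pq(4,5), folded \<sigma>2_def]
    have SuT: "star S * (star u * T) = 0" using arg_cong[OF TuS, of star] by (simp add: mult.assoc)
    have fix2: "\<sigma>2 * (T * \<beta>) = T * \<beta>"
      using \<alpha> by (intro s2(5)) (simp_all add: p_def q_def mult.assoc Sx mult_assoc_rewrite2[OF SuT])
    have 2: "\<sigma>2 \<in> word_power (W N) 26"
      by (rule fixing[OF _ _ _ _ _ u2 fix2, of a]) (use T \<alpha> in \<open>simp_all add: mult.assoc Sx\<close>)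
    \<comment> \<open>\<open>u\<close> sends \<open>S * \<alpha>\<close> to \<open>q\<close>,
      \<open>\<sigma>2\<close> sends \<open>q\<close> to \<open>p = T * \<alpha>\<close>, and
      \<open>\<sigma>1\<close> returns this to \<open>S * \<alpha>\<close>.\<close>
    define \<rho> where "\<rho> = \<sigma>1 * (\<sigma>2 * u)"
    have u3: "uni \<rho>" unfolding \<rho>_def by (intro uni_mult u1 u2 u)
    have "\<rho> * (S * \<alpha>) = \<sigma>1 * (\<sigma>2 * q)" by (simp add: \<rho>_def q_def mult.assoc)
    also have "\<dots> = S * \<alpha>" by (simp add: s2(3) p_def mult_assoc_rewrite[OF s1(3)])
    finally have fix3: "\<rho> * (S * \<alpha>) = S * \<alpha>" .
    have 3: "\<rho> \<in> word_power (W N) 26"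
      by (rule fixing[OF _ _ _ _ _ u3 fix3, of b]) (use S \<alpha> in \<open>simp_all add: mult.assoc Sx\<close>)
    have "\<sigma>2 * (\<sigma>1 * \<rho>) = u"
      by (simp add: \<rho>_def mult_assoc_rewrite[OF s1(4)] mult_assoc_rewrite[OF s2(4)])
    moreover have "\<sigma>2 * (\<sigma>1 * \<rho>) \<in> word_power (W N) (26 + (8 + 26))"
      by (intro word_power_mult 1 2 3)
    ultimately show ?thesis by simp
  qed
  then show thesis using that WN(4) by blast
qed

end

section \<open>Bounded operators on a Hilbert space\<close>

text \<open>By the parallelogram law a sequence in \<open>K\<close> minimising the distance to
  \<open>x\<close> is Cauchy; its limit \<open>y\<close> is a nearest point, and moving
  \<open>y\<close> inside \<open>K\<close> shows orthogonality.\<close>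

lemma orthogonal_decomposition:
  fixes K :: "'a::{real_inner,banach} set"
  assumes K: "subspace K" "closed K"
  obtains y where "y \<in> K" "\<And>k. k \<in> K \<Longrightarrow> inner (x - y) k = 0"
proof -
  have ne: "K \<noteq> {}" using subspace_0[OF K(1)] by auto
  define d where "d = infdist x K"
  have dle: "d \<le> norm (x - k)" if "k \<in> K" for k
    using infdist_le[OF that, of x] by (simp add: d_def dist_norm)
  have d0: "d \<ge> 0" by (simp add: d_def infdist_nonneg)
  have "\<exists>k\<in>K. norm (x - k) < d + 1 / Suc n" for n
  proof (rule ccontr)
    assume "\<not> ?thesis"
    then have "d + 1 / Suc n \<le> (INF k\<in>K. dist x k)"
      using ne by (intro cINF_greatest) (auto simp: dist_norm not_less)
    then show False using ne by (simp add: d_def infdist_def)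
  qed
  then obtain k where k: "\<And>n. k n \<in> K" "\<And>n. norm (x - k n) < d + 1 / Suc n" by metis
  have lim: "(\<lambda>n. norm (x - k n)) \<longlonglongrightarrow> d"
  proof (rule tendsto_sandwich[of "\<lambda>_. d" _ _ "\<lambda>n. d + 1 / Suc n"])
    show "(\<lambda>n. d + 1 / Suc n) \<longlonglongrightarrow> d"
      using tendsto_add[OF tendsto_const LIMSEQ_inverse_real_of_nat, of d] by (simp add: divide_inverse)
  qed (use k dle in \<open>auto intro!: always_eventually less_imp_le\<close>)
  have par: "(norm (k m - k n))\<^sup>2 \<le> 2 * ((norm (x - k m))\<^sup>2 - d\<^sup>2) + 2 * ((norm (x - k n))\<^sup>2 - d\<^sup>2)" for m n
  proof -
    define c where "c = (1/2) *\<^sub>R (k m + k n)"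
    have "c \<in> K" unfolding c_def using k K by (intro subspace_scale subspace_add) auto
    then have "d\<^sup>2 \<le> (norm (x - c))\<^sup>2" using dle d0 by (intro power_mono) auto
    moreover have "(norm (k m - k n))\<^sup>2 = 2 * (norm (x - k m))\<^sup>2 + 2 * (norm (x - k n))\<^sup>2 - 4 * (norm (x - c))\<^sup>2"
      unfolding c_def power2_norm_eq_inner
      by (simp add: inner_diff_left inner_diff_right inner_add_left inner_add_right inner_commute algebra_simps)
    ultimately show ?thesis by (simp add: right_diff_distrib)
  qed
  have "Cauchy k"
  proof (rule metric_CauchyI)
    fix e :: real assume e: "e > 0"
    have "(\<lambda>n. (norm (x - k n))\<^sup>2 - d\<^sup>2) \<longlonglongrightarrow> d\<^sup>2 - d\<^sup>2"
      by (intro tendsto_intros lim)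
    then have "eventually (\<lambda>n. (norm (x - k n))\<^sup>2 - d\<^sup>2 < e\<^sup>2 / 4) sequentially"
      using e by (intro order_tendstoD(2)) auto
    then obtain N where N: "\<And>n. n \<ge> N \<Longrightarrow> (norm (x - k n))\<^sup>2 - d\<^sup>2 < e\<^sup>2 / 4"
      by (auto simp: eventually_sequentially)
    have "dist (k m) (k n) < e" if "m \<ge> N" "n \<ge> N" for m n
    proof -
      have "a < e'" if "a \<le> 2 * b + 2 * c" "b < e' / 4" "c < e' / 4" for a b c e' :: real
        using that by linarith
      from this[OF par N[OF that(1)] N[OF that(2)]]
      have "(norm (k m - k n))\<^sup>2 < e\<^sup>2" .
      then show ?thesis using e by (simp add: dist_norm power_less_imp_less_base)
    qed
    then show "\<exists>N. \<forall>m\<ge>N. \<forall>n\<ge>N. dist (k m) (k n) < e" by blast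
  qed
  then obtain y where y: "k \<longlonglongrightarrow> y" by (meson Cauchy_convergent convergent_def)
  have yK: "y \<in> K" using K(2) k(1) y by (rule closed_sequentially)
  have "(\<lambda>n. norm (x - k n)) \<longlonglongrightarrow> norm (x - y)" by (intro tendsto_intros y)
  then have yd: "norm (x - y) = d" using lim LIMSEQ_unique by blast
  have "inner (x - y) h = 0" if h: "h \<in> K" for h
  proof (cases "h = 0")
    case False
    \<comment> \<open>This \<open>t\<close> minimises the distance from \<open>x\<close> along the
      line \<open>y + t h\<close>, so it must be 0.\<close>
    define t where "t = inner (x - y) h / inner h h"
    have hh: "inner h h > 0" using False by simp
    have "y + t *\<^sub>R h \<in> K" using yK h K by (intro subspace_add subspace_scale)
    from dle[OF this] have "(norm (x - y))\<^sup>2 \<le> (norm (x - (y + t *\<^sub>R h)))\<^sup>2"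
      using yd d0 by (intro power_mono) auto
    also have "\<dots> = (norm (x - y))\<^sup>2 - 2 * t * inner (x - y) h + t\<^sup>2 * inner h h"
      unfolding power2_norm_eq_inner
      by (simp add: inner_diff_left inner_diff_right inner_add_left inner_add_right inner_commute algebra_simps power2_eq_square)
    finally have "2 * t * inner (x - y) h \<le> t\<^sup>2 * inner h h" by simp
    moreover have "t * inner h h = inner (x - y) h" using hh by (simp add: t_def)
    ultimately have "2 * (t * t) * inner h h \<le> t * t * inner h h"
      by (simp add: power2_eq_square mult.assoc)
    then have "t * t * inner h h \<le> 0" by linarith
    then have "t = 0" using hh by (auto simp: mult_le_0_iff not_le)
    then show ?thesis using hh by (simp add: t_def)
  qed simp
  then show thesis using that yK by blast
qed

text \<open>\<open>z\<close> spans the orthogonal complement of the kernel.\<close>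

lemma riesz_representation:
  fixes f :: "'a::{real_inner,banach} \<Rightarrow> real"
  assumes "bounded_linear f"
  obtains y where "\<And>x. f x = inner x y"
proof (cases "\<forall>x. f x = 0")
  case True
  then show thesis using that[of 0] by simp
next
  case False
  interpret bounded_linear f by fact
  define K where "K = {x. f x = 0}"
  have "subspace K" by (auto simp: K_def subspace_def add scaleR zero)
  moreover have "closed K" unfolding K_def
    by (intro closed_Collect_eq continuous_intros linear_continuous_on assms)
  moreover obtain x0 where x0: "f x0 \<noteq> 0" using False by auto
  ultimately obtain y0 where y0: "y0 \<in> K" "\<And>k. k \<in> K \<Longrightarrow> inner (x0 - y0) k = 0"
    using orthogonal_decomposition by blast
  define z where "z = x0 - y0"
  have fz: "f z \<noteq> 0" using x0 y0 by (simp add: z_def K_def diff)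
  then have zz: "inner z z \<noteq> 0" using zero by auto
  show thesis
  proof
    fix x
    have "f (x - (f x / f z) *\<^sub>R z) = 0" using fz by (simp add: diff scaleR)
    then have "inner z (x - (f x / f z) *\<^sub>R z) = 0" using y0(2) by (simp add: z_def K_def)
    then have "inner x z * f z = f x * inner z z"
      using fz by (simp add: inner_diff_right inner_commute field_simps)
    then show "f x = inner x ((f z / inner z z) *\<^sub>R z)"
      using zz by (simp add: field_simps)
  qed
qed

subsection \<open>Complex structure\<close>

lemma cinner_scaleC_right: "cinner x (c *\<^sub>C y) = cnj c * cinner x y"
  using cinner_scaleC_left[of c y x] cinner_commute by (metis complex_cnj_mult)

lemma Im_cinner: "Im (cinner x y) = - inner (\<i> *\<^sub>C x) y"
  by (simp add: inner_eq_Re_cinner cinner_scaleC_left)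

lemma inner_eq_imp_eq:
  fixes x y :: "'h::chilbert_space"
  shows "(\<And>u. inner u x = inner u y) \<Longrightarrow> x = y"
  by (metis inner_commute vector_eq_rdot)

lemma inner_scaleC_left: "inner (c *\<^sub>C x) y = inner x (cnj c *\<^sub>C y)"
  by (simp add: inner_eq_Re_cinner cinner_scaleC_left cinner_scaleC_right)

lemma norm_scaleC: "norm (c *\<^sub>C x) = cmod c * norm x"
proof -
  have "(norm (c *\<^sub>C x))\<^sup>2 = (cmod c * norm x)\<^sup>2"
  proof -
    have "cinner (c *\<^sub>C x) (c *\<^sub>C x) = complex_of_real ((cmod c)\<^sup>2) * cinner x x"
      by (simp only: cinner_scaleC_left cinner_scaleC_right complex_norm_square mult.assoc mult.left_commute)
    then show ?thesis
      by (simp add: power2_norm_eq_inner power_mult_distrib inner_eq_Re_cinner)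
  qed
  then show ?thesis by (metis norm_ge_zero mult_nonneg_nonneg power2_eq_imp_eq)
qed

lemma scaleC_zero: "c *\<^sub>C (0 :: 'h::chilbert_space) = 0"
  using scaleC_add_right[of c "0 :: 'h" 0] by simp

lemma scaleC_scaleR: "c *\<^sub>C (r *\<^sub>R x) = r *\<^sub>R (c *\<^sub>C x)"
  by (simp add: scaleR_eq_scaleC scaleC_scaleC mult.commute)

lemma bounded_linear_scaleC: "bounded_linear (\<lambda>x::'h::chilbert_space. c *\<^sub>C x)"
  by (rule bounded_linear_intro[of _ "cmod c"])
     (auto simp: scaleC_add_right scaleC_scaleR norm_scaleC mult.commute)

lemma scaleC_diff: "c *\<^sub>C (x - y) = c *\<^sub>C x - c *\<^sub>C (y::'h::chilbert_space)"
  using bounded_linear.linear[OF bounded_linear_scaleC] by (rule linear_diff)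

lemma bounded_opsD: "T \<in> bounded_ops \<Longrightarrow> blinfun_apply T (c *\<^sub>C x) = c *\<^sub>C blinfun_apply T x"
  by (simp add: bounded_ops_def)

text \<open>The real representation theorem takes care of real parts. Imaginary parts follow on
  replacing \<open>x\<close> by \<open>\<i> *\<^sub>C x\<close>, since \<open>T\<close> commutes
  with complex scalars.\<close>

lemma adjoint_exists:
  assumes T: "T \<in> bounded_ops"
  obtains S where "S \<in> bounded_ops" "\<And>x y. cinner (blinfun_apply T x) y = cinner x (blinfun_apply S y)"
proof -
  have "\<exists>z. \<forall>x. inner (blinfun_apply T x) y = inner x z" for y
  proof -
    have "bounded_linear (\<lambda>x. inner (blinfun_apply T x) y)"
      by (intro bounded_linear_intros)
    then show ?thesis using riesz_representation by metis
  qed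
  then obtain S where S: "\<And>x y. inner (blinfun_apply T x) y = inner x (S y)" by metis
  have add: "S (a + b) = S a + S b" for a b
    by (rule inner_eq_imp_eq) (simp add: inner_add_right flip: S)
  have scale: "S (c *\<^sub>C a) = c *\<^sub>C S a" for c a
  proof (rule inner_eq_imp_eq)
    fix u
    have "inner u (S (c *\<^sub>C a)) = inner (blinfun_apply T u) (c *\<^sub>C a)" by (simp add: S)
    also have "\<dots> = inner (blinfun_apply T (cnj c *\<^sub>C u)) a"
      using inner_scaleC_left[of "cnj c" "blinfun_apply T u" a] by (simp add: bounded_opsD[OF T])
    also have "\<dots> = inner u (c *\<^sub>C S a)" using inner_scaleC_left[of "cnj c" u "S a"] by (simp add: S)
    finally show "inner u (S (c *\<^sub>C a)) = inner u (c *\<^sub>C S a)" .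
  qed
  have bound: "norm (S a) \<le> norm a * norm T" for a
  proof (cases "S a = 0")
    case False
    have "norm (S a) * norm (S a) = inner (blinfun_apply T (S a)) a"
      by (simp add: S flip: power2_norm_eq_inner power2_eq_square)
    also have "\<dots> \<le> norm (blinfun_apply T (S a)) * norm a" by (rule norm_cauchy_schwarz)
    also have "\<dots> \<le> norm T * norm (S a) * norm a" by (intro mult_right_mono norm_blinfun) auto
    finally show ?thesis using False by (simp add: mult.commute mult.left_commute)
  qed simp
  have "bounded_linear S"
    by (rule bounded_linear_intro[of _ "norm T"]) (auto simp: add bound scale scaleR_eq_scaleC)
  then have app: "blinfun_apply (Blinfun S) = S" by (rule bounded_linear_Blinfun_apply)
  have Sb: "Blinfun S \<in> bounded_ops" by (simp add: bounded_ops_def app scale)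
  have "cinner (blinfun_apply T x) y = cinner x (S y)" for x y
    by (rule complex_eqI)
       (simp_all add: Im_cinner S flip: inner_eq_Re_cinner bounded_opsD[OF T])
  with Sb show thesis using that[of "Blinfun S"] by (simp add: app)
qed

lemma hilbert_adjoint:
  assumes T: "T \<in> bounded_ops"
  shows "hilbert_adjoint T \<in> bounded_ops"
    and "cinner (blinfun_apply T x) y = cinner x (blinfun_apply (hilbert_adjoint T) y)"
proof -
  obtain S where S: "S \<in> bounded_ops" "\<And>x y. cinner (blinfun_apply T x) y = cinner x (blinfun_apply S y)"
    using adjoint_exists[OF T] by blast
  have "hilbert_adjoint T = S"
    unfolding hilbert_adjoint_def
  proof (rule the_equality)
    fix S' assume *: "\<forall>x y. cinner (blinfun_apply T x) y = cinner x (blinfun_apply S' y)"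
    show "S' = S"
    proof (rule blinfun_eqI)
      show "blinfun_apply S' y = blinfun_apply S y" for y
        by (rule inner_eq_imp_eq) (simp add: inner_eq_Re_cinner *[rule_format, symmetric] S(2)[symmetric])
    qed
  qed (use S in auto)
  then show "hilbert_adjoint T \<in> bounded_ops"
    "cinner (blinfun_apply T x) y = cinner x (blinfun_apply (hilbert_adjoint T) y)"
    using S by auto
qed

subsection \<open>The algebra of bounded complex-linear operators as a type\<close>

text \<open>The zero space is allowed, where \<open>0 = 1\<close>; so the type is no instance of \<^class>\<open>ring_1\<close>.\<close>

typedef (overloaded) 'h op = "bounded_ops :: ('h::chilbert_space \<Rightarrow>\<^sub>L 'h) set"
  morphisms blin Op
  by (rule exI[of _ 0]) (simp add: bounded_ops_def scaleC_zero)

setup_lifting type_definition_op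

definition app :: "'h::chilbert_space op \<Rightarrow> 'h \<Rightarrow> 'h" where
  "app T = blinfun_apply (blin T)"

lemma blin_bounded [simp]: "blin T \<in> bounded_ops"
  by (rule blin)

lemma op_eqI: "(\<And>x. app S x = app T x) \<Longrightarrow> S = T"
  by (simp add: app_def blin_inject[symmetric] blinfun_eqI)

lemma app_scaleC: "app T (c *\<^sub>C x) = c *\<^sub>C app T x"
  by (simp add: app_def bounded_opsD)

lemma bounded_linear_app: "bounded_linear (app T)"
  unfolding app_def by (rule blinfun.bounded_linear_right)

lemmas app_add = linear_add[OF bounded_linear.linear[OF bounded_linear_app]]
lemmas app_diff = linear_diff[OF bounded_linear.linear[OF bounded_linear_app]]
lemmas app_scaleR = linear_scale[OF bounded_linear.linear[OF bounded_linear_app]]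
lemmas app_zero [simp] = linear_0[OF bounded_linear.linear[OF bounded_linear_app]]
lemmas tendsto_app = bounded_linear.tendsto[OF bounded_linear_app]

lemma op_exists:
  assumes "\<And>x y. f (x + y) = f x + f y" "\<And>c x. f (c *\<^sub>C x) = c *\<^sub>C f x" "\<And>x. norm (f x) \<le> b * norm x"
  obtains T where "\<And>x. app T x = f x"
proof -
  have "bounded_linear f"
    by (rule bounded_linear_intro[of _ b]) (use assms in \<open>auto simp: scaleR_eq_scaleC mult.commute\<close>)
  then have *: "blinfun_apply (Blinfun f) = f" by (rule bounded_linear_Blinfun_apply)
  then have "Blinfun f \<in> bounded_ops" using assms by (simp add: bounded_ops_def)
  then show thesis using that[of "Op (Blinfun f)"] * by (simp add: app_def Op_inverse)
qed

instantiation op :: (chilbert_space) real_normed_vector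
begin

lift_definition zero_op :: "'a op" is 0 by (simp add: bounded_ops_def scaleC_zero)
lift_definition plus_op :: "'a op \<Rightarrow> 'a op \<Rightarrow> 'a op" is "(+)"
  by (simp add: bounded_ops_def blinfun.add_left scaleC_add_right)
lift_definition minus_op :: "'a op \<Rightarrow> 'a op \<Rightarrow> 'a op" is "(-)"
  by (simp add: bounded_ops_def blinfun.diff_left scaleC_diff)
lift_definition uminus_op :: "'a op \<Rightarrow> 'a op" is "uminus"
  by (simp add: bounded_ops_def blinfun.minus_left) (metis scaleC_diff diff_0 scaleC_zero)
lift_definition scaleR_op :: "real \<Rightarrow> 'a op \<Rightarrow> 'a op" is "scaleR"
  by (simp add: bounded_ops_def blinfun.scaleR_left scaleC_scaleR)
lift_definition norm_op :: "'a op \<Rightarrow> real" is norm .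

definition dist_op :: "'a op \<Rightarrow> 'a op \<Rightarrow> real" where "dist_op a b = norm (a - b)"
definition "(uniformity :: ('a op \<times> 'a op) filter) = (INF e\<in>{0 <..}. principal {(x, y). dist x y < e})"
definition open_op :: "'a op set \<Rightarrow> bool"
  where "open_op S = (\<forall>x\<in>S. \<forall>\<^sub>F (x', y) in uniformity. x' = x \<longrightarrow> y \<in> S)"
definition sgn_op :: "'a op \<Rightarrow> 'a op" where "sgn_op x = scaleR (inverse (norm x)) x"

instance
  apply standard
  unfolding dist_op_def open_op_def sgn_op_def uniformity_op_def
  apply (rule refl | (transfer, simp add: algebra_simps norm_triangle_ineq))+
  done

end

lemma app_arith [simp]:
  "app 0 x = 0" "app (S + T) x = app S x + app T x" "app (S - T) x = app S x - app T x"
  "app (- T) x = - app T x" "app (r *\<^sub>R T) x = r *\<^sub>R app T x"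
  by (simp_all add: app_def zero_op.rep_eq plus_op.rep_eq minus_op.rep_eq uminus_op.rep_eq scaleR_op.rep_eq
      blinfun.add_left blinfun.diff_left blinfun.minus_left blinfun.scaleR_left)

lemma norm_app: "norm (app T x) \<le> norm T * norm x"
  unfolding app_def norm_op.rep_eq by (rule norm_blinfun)

lemma norm_opI: "0 \<le> b \<Longrightarrow> (\<And>x. norm (app T x) \<le> b * norm x) \<Longrightarrow> norm T \<le> b"
  unfolding app_def norm_op.rep_eq by (rule norm_blinfun_bound)

instantiation op :: (chilbert_space) "{real_normed_algebra, monoid_mult}"
begin

lift_definition times_op :: "'a op \<Rightarrow> 'a op \<Rightarrow> 'a op" is "blinfun_compose"
  by (simp add: bounded_ops_def)
lift_definition one_op :: "'a op" is id_blinfun by (simp add: bounded_ops_def)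

lemma app_times [simp]: "app (S * T) x = app S (app T x)"
  by (simp add: app_def times_op.rep_eq)

lemma app_one [simp]: "app 1 x = x"
  by (simp add: app_def one_op.rep_eq)

instance
proof
  fix a b c :: "'a op" and r :: real
  show "norm (a * b) \<le> norm a * norm b"
    by transfer (rule norm_blinfun_compose)
qed (auto intro!: op_eqI simp: app_add app_scaleR)

end

instance op :: (chilbert_space) banach
proof
  fix X :: "nat \<Rightarrow> 'a op" assume X: "Cauchy X"
  have "Cauchy (\<lambda>n. blin (X n))"
    using X unfolding Cauchy_iff by (simp flip: minus_op.rep_eq norm_op.rep_eq)
  then obtain L where L: "(\<lambda>n. blin (X n)) \<longlonglongrightarrow> L"
    by (meson Cauchy_convergent convergent_def)
  have lim: "(\<lambda>n. app (X n) x) \<longlonglongrightarrow> blinfun_apply L x" for x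
    unfolding app_def by (intro blinfun.tendsto L tendsto_const)
  have "L \<in> bounded_ops"
    unfolding bounded_ops_def
  proof (intro CollectI allI)
    fix c x
    have "(\<lambda>n. c *\<^sub>C app (X n) x) \<longlonglongrightarrow> c *\<^sub>C blinfun_apply L x"
      by (rule bounded_linear.tendsto[OF bounded_linear_scaleC lim])
    then show "blinfun_apply L (c *\<^sub>C x) = c *\<^sub>C blinfun_apply L x"
      using lim[of "c *\<^sub>C x"] LIMSEQ_unique by (simp add: app_scaleC) blast
  qed
  then have "blin (Op L) = L" by (rule Op_inverse)
  then have "(\<lambda>n. norm (X n - Op L)) \<longlonglongrightarrow> 0"
    using L by (simp add: norm_op.rep_eq minus_op.rep_eq tendsto_norm_zero_iff LIM_zero_iff)
  then show "convergent X"
    unfolding convergent_def using LIM_zero_cancel tendsto_norm_zero_iff by blast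
qed

lift_definition adj :: "'h::chilbert_space op \<Rightarrow> 'h op" is hilbert_adjoint
  by (rule hilbert_adjoint(1))

lemma cinner_adj: "cinner (app T x) y = cinner x (app (adj T) y)"
  unfolding app_def adj.rep_eq by (rule hilbert_adjoint(2)[OF blin_bounded])

lemma inner_adj: "inner (app T x) y = inner x (app (adj T) y)"
  by (simp add: inner_eq_Re_cinner cinner_adj)

lemma adj_eqI:
  assumes "\<And>x y. inner (app T x) y = inner x (app S y)"
  shows "adj T = S"
  by (rule op_eqI, rule inner_eq_imp_eq) (simp add: assms flip: inner_adj)

lemma inner_adj': "inner (app (adj T) x) y = inner x (app T y)"
  by (metis inner_adj inner_commute)

lemma norm_adj_le: "norm (adj T) \<le> norm T"
proof (rule norm_opI)
  fix x
  let ?a = "app (adj T) x"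
  show "norm ?a \<le> norm T * norm x"
  proof (cases "?a = 0")
    case False
    have "norm ?a * norm ?a = inner (app T ?a) x"
      by (simp add: inner_adj flip: power2_norm_eq_inner power2_eq_square)
    also have "\<dots> \<le> norm (app T ?a) * norm x" by (rule norm_cauchy_schwarz)
    also have "\<dots> \<le> norm T * norm ?a * norm x" by (intro mult_right_mono norm_app) auto
    finally show ?thesis using False by (simp add: mult.commute mult.left_commute)
  qed simp
qed simp

instantiation op :: (chilbert_space) cstar_ring
begin

definition star_op :: "'a op \<Rightarrow> 'a op" where "star_op = adj"

instance
proof
  fix x y :: "'a op" and r :: real
  show "star (x + y) = star x + star y" "star (x * y) = star y * star x"
    "star (r *\<^sub>R x) = r *\<^sub>R star x"
    unfolding star_op_def
    by (rule adj_eqI; simp add: inner_adj inner_add_left inner_add_right)+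
  show "star (star x) = x"
    unfolding star_op_def by (rule adj_eqI) (simp only: inner_adj')
  show "norm (star x * x) = (norm x)\<^sup>2"
  proof (rule antisym)
    have "norm (adj x * x) \<le> norm (adj x) * norm x" by (rule norm_mult_ineq)
    also have "\<dots> \<le> norm x * norm x" by (intro mult_right_mono norm_adj_le) simp
    finally show "norm (star x * x) \<le> (norm x)\<^sup>2" by (simp add: star_op_def power2_eq_square)
    have "norm x \<le> sqrt (norm (star x * x))"
    proof (rule norm_opI)
      fix u
      have "(norm (app x u))\<^sup>2 = inner u (app (star x * x) u)"
        by (simp add: power2_norm_eq_inner star_op_def inner_adj)
      also have "\<dots> \<le> norm u * norm (app (star x * x) u)" by (rule norm_cauchy_schwarz)
      also have "\<dots> \<le> norm u * (norm (star x * x) * norm u)" by (intro mult_left_mono norm_app) simp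
      also have "\<dots> = (sqrt (norm (star x * x)) * norm u)\<^sup>2"
        by (simp add: power_mult_distrib power2_eq_square)
      finally show "norm (app x u) \<le> sqrt (norm (star x * x)) * norm u"
        by (rule power2_le_imp_le) simp
    qed simp
    then have "(norm x)\<^sup>2 \<le> (sqrt (norm (star x * x)))\<^sup>2" by (intro power_mono) auto
    then show "(norm x)\<^sup>2 \<le> norm (star x * x)" by simp
  qed
qed

end

lemma inner_star: "inner (app T x) y = inner x (app (star T) y)"
  by (simp add: star_op_def inner_adj)

lemma inner_star': "inner (app (star T) x) y = inner x (app T y)"
  by (simp add: star_op_def inner_adj')

lemma norm_star_op: "norm (star (T :: 'h::chilbert_space op)) = norm T"
  using norm_adj_le[of T] norm_adj_le[of "star T"] star_star[of T] by (simp add: star_op_def)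

lemma tendsto_app_left: "(X \<longlonglongrightarrow> T) \<Longrightarrow> (\<lambda>n. app (X n) x) \<longlonglongrightarrow> app T x"
proof -
  assume "X \<longlonglongrightarrow> T"
  have "bounded_linear (\<lambda>T::'a op. app T x)"
    by (rule bounded_linear_intro[of _ "norm x"]) (auto simp: norm_app)
  then show ?thesis using \<open>X \<longlonglongrightarrow> T\<close> by (rule bounded_linear.tendsto)
qed

lemma tendsto_star: "(X \<longlonglongrightarrow> (T :: 'h::chilbert_space op)) \<Longrightarrow> (\<lambda>n. star (X n)) \<longlonglongrightarrow> star T"
proof -
  assume "X \<longlonglongrightarrow> T"
  have "bounded_linear (star :: 'h op \<Rightarrow> 'h op)"
    by (rule bounded_linear_intro[of _ 1]) (auto simp: norm_star_op)
  then show ?thesis using \<open>X \<longlonglongrightarrow> T\<close> by (rule bounded_linear.tendsto)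
qed

subsection \<open>Square roots\<close>

text \<open>With \<open>b = 1 - x\<^sup>* x\<close>, the iteration \<open>c \<mapsto> (b + c\<^sup>2) / 2\<close> converges to \<open>c = 1 - \<bar>x\<bar>\<close>; it is
  dominated by the same iteration for \<open>b = 1\<close> in the reals.\<close>

lemma square_root_exists:
  fixes x :: "'h::chilbert_space op"
  assumes x: "norm x \<le> 1"
  obtains s where "star s = s" "s * s = star x * x" "norm (s - (1 / 2) *\<^sub>R 1) \<le> 1 / 2"
    "\<And>m. m * (star x * x) = star x * x * m \<Longrightarrow> m * s = s * m"
proof -
  define b where "b = 1 - star x * x"
  define c where "c = rec_nat 0 (\<lambda>_ c. (1 / 2) *\<^sub>R (b + c * c))"
  define t where "t = rec_nat (0::real) (\<lambda>_ t. (1 + t * t) / 2)"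
  have c: "c 0 = 0" "\<And>n. c (Suc n) = (1 / 2) *\<^sub>R (b + c n * c n)" by (auto simp: c_def)
  have t: "t 0 = 0" "\<And>n. t (Suc n) = (1 + t n * t n) / 2" by (auto simp: t_def)
  have t01: "0 \<le> t n \<and> t n \<le> 1" for n
  proof (induction n)
    case (Suc n)
    then have "t n * t n \<le> 1 * 1" by (intro mult_mono) auto
    then show ?case by (simp add: t)
  qed (simp add: t)
  have tmono: "t n \<le> t (Suc n)" for n
  proof -
    have "0 \<le> (1 - t n) * (1 - t n)" by simp
    then show ?thesis by (simp add: t algebra_simps)
  qed
  have xu: "norm (app x u) \<le> norm u" for u
    using norm_app[of x u] x by (meson mult_left_le_one_le norm_ge_zero order_trans)
  have xsu: "norm (app (star x) u) \<le> norm u" for u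
    using norm_app[of "star x" u] x unfolding norm_star_op
    by (meson mult_left_le_one_le norm_ge_zero order_trans)
  have b1: "norm b \<le> 1"
  proof (rule norm_opI)
    fix u
    have "inner u (app (star x) (app x u)) = inner (app x u) (app x u)"
      "inner (app (star x) (app x u)) u = inner (app x u) (app x u)"
      by (rule inner_star[symmetric], rule inner_star')
    then have "(norm (app b u))\<^sup>2 = (norm u)\<^sup>2 - 2 * (norm (app x u))\<^sup>2 + (norm (app (star x) (app x u)))\<^sup>2"
      unfolding power2_norm_eq_inner
      by (simp add: b_def inner_diff_left inner_diff_right)
    also have "\<dots> \<le> (norm u)\<^sup>2 - 2 * (norm (app x u))\<^sup>2 + (norm (app x u))\<^sup>2"
      using power_mono[OF xsu[of "app x u"], of 2] by simp
    also have "\<dots> \<le> (norm u)\<^sup>2" by simp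
    finally show "norm (app b u) \<le> 1 * norm u" using power2_le_imp_le by fastforce
  qed simp
  have bpos: "0 \<le> inner (app b u) u" for u
  proof -
    have "inner (app b u) u = (norm u)\<^sup>2 - (norm (app x u))\<^sup>2"
      unfolding power2_norm_eq_inner by (simp add: b_def inner_diff_left inner_star')
    also have "\<dots> \<ge> 0" using power_mono[OF xu[of u], of 2] by simp
    finally show ?thesis .
  qed
  have sb: "star b = b" by (simp add: b_def)
  have sc: "star (c n) = c n" for n by (induction n) (auto simp: c sb)
  have cpos: "0 \<le> inner (app (c n) u) u" for n u
  proof (cases n)
    case (Suc k)
    have "inner (app (c k) (app (c k) u)) u = (norm (app (c k) u))\<^sup>2"
      using inner_star[of "c k" "app (c k) u" u] by (simp add: sc power2_norm_eq_inner)
    then show ?thesis using bpos[of u] by (simp add: Suc c inner_add_left)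
  qed (simp add: c)
  have cn: "norm (c n) \<le> t n" for n
  proof (induction n)
    case (Suc n)
    have "norm (b + c n * c n) \<le> norm b + norm (c n) * norm (c n)"
      by (intro norm_triangle_le add_left_mono norm_mult_ineq)
    also have "\<dots> \<le> 1 + t n * t n" using b1 Suc by (intro add_mono mult_mono) (auto simp: t01)
    finally show ?case by (simp add: c t)
  qed (simp add: c t)
  have cdiff: "norm (c (Suc n) - c n) \<le> t (Suc n) - t n" for n
  proof (induction n)
    case 0
    show ?case using b1 by (simp add: c t)
  next
    case (Suc n)
    let ?d = "c (Suc n) - c n"
    \<comment> \<open>A difference of squares written so that it holds without
      commutativity.\<close>
    have "c (Suc (Suc n)) - c (Suc n) = (1 / 2) *\<^sub>R (c (Suc n) * ?d + ?d * c n)"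
      by (simp add: c(2)[of "Suc n"] c(2)[of n, symmetric] algebra_simps)
         (simp add: c(2)[of n] algebra_simps)
    then have "norm (c (Suc (Suc n)) - c (Suc n)) = norm (c (Suc n) * ?d + ?d * c n) / 2" by simp
    also have "\<dots> \<le> (norm (c (Suc n)) * norm ?d + norm ?d * norm (c n)) / 2"
      by (intro divide_right_mono norm_triangle_le add_mono norm_mult_ineq) simp
    also have "\<dots> \<le> (t (Suc n) * (t (Suc n) - t n) + (t (Suc n) - t n) * t n) / 2"
      using Suc cn t01 tmono by (intro divide_right_mono add_mono mult_mono) auto
    also have "\<dots> = t (Suc (Suc n)) - t (Suc n)"
    proof -
      have "(T * (T - u) + (T - u) * u) / 2 = S - T" if "S = (1 + T * T) / 2" "T = (1 + u * u) / 2"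
        for S T u :: real
      proof -
        have "2 * S = 1 + T * T" using that(1) by simp
        moreover have "2 * T = 1 + u * u" using that(2) by simp
        ultimately show ?thesis by (simp add: field_simps)
      qed
      from this[OF t(2) t(2)] show ?thesis .
    qed
    finally show ?case .
  qed
  have "convergent t"
    using t01 tmono by (intro Bseq_mono_convergent BseqI'[of _ 1]) (auto simp: incseq_SucI intro: lift_Suc_mono_le)
  then have "summable (\<lambda>n. t (Suc n) - t n)"
    using telescope_summable unfolding convergent_def by blast
  then have "summable (\<lambda>n. c (Suc n) - c n)"
    by (rule summable_comparison_test[rotated]) (use cdiff in auto)
  then have "convergent (\<lambda>n. \<Sum>k<n. c (Suc k) - c k)"
    by (simp add: summable_iff_convergent)
  then have "convergent c" by (simp add: sum_lessThan_telescope c(1))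
  then obtain l where l: "c \<longlonglongrightarrow> l" by (auto simp: convergent_def)
  have "(\<lambda>n. (1 / 2) *\<^sub>R (b + c n * c n)) \<longlonglongrightarrow> (1 / 2) *\<^sub>R (b + l * l)"
    by (intro tendsto_intros l)
  then have "(\<lambda>n. c (Suc n)) \<longlonglongrightarrow> (1 / 2) *\<^sub>R (b + l * l)" by (simp add: c)
  then have ll: "l = (1 / 2) *\<^sub>R (b + l * l)"
    using LIMSEQ_Suc[OF l] LIMSEQ_unique by blast
  have sl: "star l = l" using tendsto_star[OF l] l by (simp add: sc LIMSEQ_unique)
  have lpos: "0 \<le> inner (app l u) u" for u
    by (rule LIMSEQ_le_const[where X = "\<lambda>n. inner (app (c n) u) u"])
       (use cpos in \<open>auto intro!: tendsto_intros tendsto_app_left l\<close>)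
  have l1: "norm l \<le> 1"
  proof (rule LIMSEQ_le_const2)
    show "(\<lambda>n. norm (c n)) \<longlonglongrightarrow> norm l" by (intro tendsto_intros l)
    show "\<exists>N. \<forall>n\<ge>N. norm (c n) \<le> 1" using cn t01 order_trans by blast
  qed
  define s where "s = 1 - l"
  show thesis
  proof
    show "star s = s" by (simp add: s_def sl)
    \<comment> \<open>The fixed-point equation rearranges to
      \<open>(1 - l) * (1 - l) = 1 - b\<close>.\<close>
    have "2 *\<^sub>R l = b + l * l" by (subst ll) simp
    then show "s * s = star x * x" by (simp add: s_def b_def algebra_simps scaleR_2)
    have "norm ((1 / 2) *\<^sub>R 1 - l) \<le> 1 / 2"
    proof (rule norm_opI)
      fix u
      \<comment> \<open>Positivity of \<open>l\<close> at \<open>u - l u\<close>, together with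
        \<open>norm l \<le> 1\<close>, yields \<open>l * l \<le> l\<close> as quadratic forms, which
        is the bound on \<open>1/2 - l\<close>.\<close>
      have "0 \<le> inner (app l (u - app l u)) (u - app l u)" by (rule lpos)
      also have "\<dots> = inner (app l u) u - 2 * (norm (app l u))\<^sup>2 + inner (app l (app l u)) (app l u)"
        unfolding power2_norm_eq_inner using inner_star[of l "app l u" u]
        by (simp add: app_diff inner_diff_left inner_diff_right sl)
      also have "inner (app l (app l u)) (app l u) \<le> norm (app l (app l u)) * norm (app l u)"
        by (rule norm_cauchy_schwarz)
      also have "norm (app l (app l u)) * norm (app l u) \<le> norm (app l u) * norm (app l u)"
        using norm_app[of l "app l u"] mult_left_le_one_le[of "norm (app l u)" "norm l"] l1
        by (intro mult_right_mono) auto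
      finally have "(norm (app l u))\<^sup>2 \<le> inner (app l u) u" by (simp add: power2_eq_square)
      moreover have "(norm (app ((1 / 2) *\<^sub>R 1 - l) u))\<^sup>2 = (norm u)\<^sup>2 / 4 - inner (app l u) u + (norm (app l u))\<^sup>2"
        unfolding power2_norm_eq_inner using inner_commute[of u "app l u"]
        by (simp add: inner_diff_left inner_diff_right field_simps)
      ultimately have "(norm (app ((1 / 2) *\<^sub>R 1 - l) u))\<^sup>2 \<le> (1 / 2 * norm u)\<^sup>2"
        by (simp add: power_mult_distrib power2_eq_square)
      then show "norm (app ((1 / 2) *\<^sub>R 1 - l) u) \<le> 1 / 2 * norm u"
        by (rule power2_le_imp_le) simp
    qed simp
    moreover have "s - (1 / 2) *\<^sub>R 1 = (1 / 2) *\<^sub>R 1 - l"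
    proof -
      have "(1 / 2) *\<^sub>R (1 :: 'h op) + (1 / 2) *\<^sub>R 1 = 1" by (simp flip: scaleR_add_left)
      then show ?thesis by (simp add: s_def algebra_simps)
    qed
    ultimately show "norm (s - (1 / 2) *\<^sub>R 1) \<le> 1 / 2" by simp
    fix m assume m: "m * (star x * x) = star x * x * m"
    then have mb: "m * b = b * m" by (simp add: b_def algebra_simps)
    have "m * c n = c n * m" for n
    proof (induction n)
      case (Suc n)
      then have "m * (c n * c n) = c n * c n * m" by (metis mult.assoc)
      then show ?case by (simp add: c mb distrib_left distrib_right)
    qed (simp add: c)
    moreover have "(\<lambda>n. m * c n) \<longlonglongrightarrow> m * l" "(\<lambda>n. c n * m) \<longlonglongrightarrow> l * m"
      by (intro tendsto_intros l)+
    ultimately have "m * l = l * m" using LIMSEQ_unique by simp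
    then show "m * s = s * m" by (simp add: s_def algebra_simps)
  qed
qed

subsection \<open>Projections, sums and polar decompositions\<close>

lemma projection_exists:
  fixes K :: "'h::chilbert_space set"
  assumes K: "0 \<in> K" "\<And>x y. x \<in> K \<Longrightarrow> y \<in> K \<Longrightarrow> x + y \<in> K" "\<And>c x. x \<in> K \<Longrightarrow> c *\<^sub>C x \<in> K" "closed K"
  obtains P where "proj P" "\<And>x. app P x \<in> K" "\<And>x. x \<in> K \<Longrightarrow> app P x = x"
proof -
  have sub: "subspace K" using K by (auto simp: subspace_def scaleR_eq_scaleC)
  have "\<exists>y\<in>K. \<forall>k\<in>K. inner (x - y) k = 0" for x
    using orthogonal_decomposition[OF sub K(4)] by metis
  then obtain f where f: "\<And>x. f x \<in> K" "\<And>x k. k \<in> K \<Longrightarrow> inner (x - f x) k = 0" by metis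
  have uniq: "f x = y" if "y \<in> K" "\<And>k. k \<in> K \<Longrightarrow> inner (x - y) k = 0" for x y
  proof -
    have d: "f x - y \<in> K" using f(1) that(1) sub by (intro subspace_diff)
    have "inner (f x - y) (f x - y) = inner (x - y) (f x - y) - inner (x - f x) (f x - y)"
      by (simp add: inner_diff_left)
    also have "\<dots> = 0" using f(2)[OF d] that(2)[OF d] by simp
    finally show ?thesis by simp
  qed
  have add: "f (x + y) = f x + f y" for x y
  proof (rule uniq)
    show "f x + f y \<in> K" by (intro K f)
    fix k assume k: "k \<in> K"
    have "x + y - (f x + f y) = (x - f x) + (y - f y)" by simp
    then show "inner (x + y - (f x + f y)) k = 0" by (simp only: inner_add_left f(2)[OF k])
  qed
  have scale: "f (c *\<^sub>C x) = c *\<^sub>C f x" for c x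
  proof (rule uniq)
    fix k assume "k \<in> K"
    then have "inner (x - f x) (cnj c *\<^sub>C k) = 0" by (intro K f)
    then show "inner (c *\<^sub>C x - c *\<^sub>C f x) k = 0"
      using inner_scaleC_left[of c "x - f x" k] by (simp add: scaleC_diff)
  qed (intro K f)
  have bound: "norm (f x) \<le> 1 * norm x" for x
  proof (cases "f x = 0")
    case False
    have "norm (f x) * norm (f x) = inner x (f x)"
      using f(2)[OF f(1), of x x] by (simp add: inner_diff_left flip: power2_norm_eq_inner power2_eq_square)
    also have "\<dots> \<le> norm x * norm (f x)" by (rule norm_cauchy_schwarz)
    finally show ?thesis using False by simp
  qed simp
  obtain P where P: "\<And>x. app P x = f x" using op_exists[of f 1, OF add scale bound] by blast
  have fK: "f x = x" if "x \<in> K" for x using that by (intro uniq) auto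
  have "inner x (f y) = inner (f x) (f y)" for x y
    using f(2)[of "f y" x] f(1) by (simp add: inner_diff_left)
  then have "inner (app P x) y = inner x (app P y)" for x y
    unfolding P by (metis inner_commute)
  then have "star P = P" unfolding star_op_def by (intro adj_eqI)
  moreover have "P * P = P" by (rule op_eqI) (simp add: P fK f)
  ultimately show thesis using that[of P] f fK by (simp add: proj_def P)
qed

text \<open>Invariance under \<open>T\<close> gives \<open>P T P = T P\<close>, and invariance under
  \<open>star T\<close> gives \<open>P T P = P T\<close>.\<close>

lemma proj_commute_invariant:
  assumes P: "proj P" "\<And>x. app P x \<in> K" "\<And>x. x \<in> K \<Longrightarrow> app P x = x"
    and T: "\<And>x. x \<in> K \<Longrightarrow> app T x \<in> K" "\<And>x. x \<in> K \<Longrightarrow> app (star T) x \<in> K"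
  shows "P * T = T * P"
proof -
  have sP: "star P = P" using P(1) by (simp add: proj_def)
  have 1: "P * (T * P) = T * P" by (rule op_eqI) (simp add: P T)
  have 2: "P * (star T * P) = star T * P" by (rule op_eqI) (simp add: P T)
  have "P * (T * P) = P * T" using arg_cong[OF 2, of star] sP by (simp add: mult.assoc)
  then show ?thesis using 1 by simp
qed

text \<open>Pythagoras for the ranges and Bessel's inequality for the initial spaces:
  \<open>y\<close>, the sum of the \<open>star v * v\<close> applied to \<open>x\<close>, is the
  orthogonal projection of \<open>x\<close> to the span of the latter.\<close>

lemma norm_app_sq_pisom_sum:
  assumes A: "finite A" and pi: "\<And>v. v \<in> A \<Longrightarrow> pisom v"
    and orth: "\<And>v w. v \<in> A \<Longrightarrow> w \<in> A \<Longrightarrow> v \<noteq> w \<Longrightarrow> star v * w = 0 \<and> v * star w = 0"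
  shows "(norm (\<Sum>v\<in>A. app v x))\<^sup>2 = (\<Sum>v\<in>A. (norm (app v x))\<^sup>2)"
    and "(\<Sum>v\<in>A. (norm (app v x))\<^sup>2) \<le> (norm (x :: 'h::chilbert_space))\<^sup>2"
proof -
  have o: "inner (app v a) (app w b) = 0" if "v \<in> A" "w \<in> A" "v \<noteq> w" for v w a b
    using orth[OF that] inner_star[of v a "app w b"] by (simp flip: app_times)
  have "pairwise (\<lambda>v w. orthogonal (app v x) (app w x)) A"
    unfolding pairwise_def orthogonal_def using o by blast
  then show sq: "(norm (\<Sum>v\<in>A. app v x))\<^sup>2 = (\<Sum>v\<in>A. (norm (app v x))\<^sup>2)"
    by (rule norm_sum_Pythagorean[OF A])
  define y where "y = (\<Sum>v\<in>A. app (star v) (app v x))"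
  have vy: "app v y = app v x" if v: "v \<in> A" for v
  proof -
    have "app v y = (\<Sum>w\<in>A. app (v * star w) (app w x))"
      by (simp add: y_def linear_sum[OF bounded_linear.linear[OF bounded_linear_app]])
    also have "\<dots> = (\<Sum>w\<in>A. if w = v then app v x else 0)"
    proof (rule sum.cong)
      fix w assume w: "w \<in> A"
      have "v * star v * v = v" using pi[OF v] by (simp add: pisom_def)
      then have "app v (app (star v) (app v x)) = app v x" by (metis app_times)
      then show "app (v * star w) (app w x) = (if w = v then app v x else 0)"
        using orth[OF v w] by (cases "w = v") auto
    qed simp
    finally show ?thesis using A v by simp
  qed
  have yx: "inner y x = (\<Sum>v\<in>A. (norm (app v x))\<^sup>2)"
    by (simp add: y_def inner_sum_left inner_star' power2_norm_eq_inner)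
  have "inner y y = (\<Sum>v\<in>A. inner (app v x) (app v y))"
    by (subst (1) y_def) (simp add: inner_sum_left inner_star')
  then have yy: "inner y y = inner y x" by (simp add: yx vy power2_norm_eq_inner)
  have "0 \<le> inner (x - y) (x - y)" by simp
  also have "\<dots> = inner x x - inner y x"
    by (simp add: inner_diff_left inner_diff_right yy inner_commute)
  finally show "(\<Sum>v\<in>A. (norm (app v x))\<^sup>2) \<le> (norm x)\<^sup>2" by (simp add: yx power2_norm_eq_inner)
qed

text \<open>Cauchy criterion along finite subsets of an index set of any size: enlarging
  \<open>A\<close> to \<open>A \<union> B\<close> changes the sum by a vector whose squared norm is
  the sum of squares over \<open>B - A\<close>, small once \<open>A\<close> nearly exhausts the
  total.\<close>

lemma orthogonal_summable:
  fixes f :: "'i \<Rightarrow> 'h::banach" and B :: real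
  assumes sq: "\<And>A. finite A \<Longrightarrow> A \<subseteq> F \<Longrightarrow> (norm (sum f A))\<^sup>2 = (\<Sum>v\<in>A. (norm (f v))\<^sup>2)"
    and bd: "\<And>A. finite A \<Longrightarrow> A \<subseteq> F \<Longrightarrow> (\<Sum>v\<in>A. (norm (f v))\<^sup>2) \<le> B"
  shows "f summable_on F"
proof -
  let ?g = "\<lambda>v. (norm (f v))\<^sup>2"
  have sg: "?g summable_on F"
    by (rule nonneg_bdd_above_summable_on) (use bd in \<open>auto intro!: bdd_aboveI[of _ B]\<close>)
  define L where "L = infsum ?g F"
  have lim: "(sum ?g \<longlongrightarrow> L) (finite_subsets_at_top F)"
    using has_sum_infsum[OF sg] by (simp add: has_sum_def L_def)
  have le: "sum ?g A \<le> L" if "finite A" "A \<subseteq> F" for A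
    unfolding L_def by (rule finite_sum_le_infsum[OF sg that]) simp
  have "\<exists>P. eventually P (finite_subsets_at_top F) \<and>
      (\<forall>A B. P A \<and> P B \<longrightarrow> dist (sum f A) (sum f B) < e)" if e: "e > 0" for e
  proof -
    define P where "P A \<longleftrightarrow> finite A \<and> A \<subseteq> F \<and> sum ?g A > L - (e / 2)\<^sup>2" for A
    have "\<forall>\<^sub>F A in finite_subsets_at_top F. sum ?g A > L - (e / 2)\<^sup>2"
      by (rule order_tendstoD(1)[OF lim]) (use e in simp)
    moreover have "\<forall>\<^sub>F A in finite_subsets_at_top F. finite A \<and> A \<subseteq> F"
      by (rule eventually_finite_subsets_at_top_weakI) simp
    ultimately have "eventually P (finite_subsets_at_top F)"
      by eventually_elim (simp add: P_def)
    moreover have half: "dist (sum f A) (sum f (A \<union> B)) < e / 2" if "P A" "P B" for A B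
    proof -
      have AB: "finite A" "finite B" "A \<subseteq> F" "B \<subseteq> F" using that by (auto simp: P_def)
      have "sum f (A \<union> B) - sum f A = sum f (B - A)"
        using AB sum.union_disjoint[of A "B - A" f] by simp
      moreover have "(norm (sum f (B - A)))\<^sup>2 = sum ?g (B - A)" using AB by (intro sq) auto
      moreover have "sum ?g (A \<union> B) = sum ?g A + sum ?g (B - A)"
        using AB sum.union_disjoint[of A "B - A" ?g] by simp
      moreover have "sum ?g (A \<union> B) \<le> L" using AB by (intro le) auto
      moreover have "sum ?g A > L - (e / 2)\<^sup>2" using that by (simp add: P_def)
      ultimately have "(norm (sum f (A \<union> B) - sum f A))\<^sup>2 < (e / 2)\<^sup>2" by simp
      then have "norm (sum f (A \<union> B) - sum f A) < e / 2"
        by (rule power_less_imp_less_base) (use e in simp)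
      then show ?thesis by (simp add: dist_norm norm_minus_commute)
    qed
    have "dist (sum f A) (sum f B) < e" if "P A" "P B" for A B
      using half[OF that] half[OF that(2,1)] dist_triangle2[of "sum f A" "sum f B" "sum f (A \<union> B)"]
      by (simp add: Un_commute)
    ultimately show ?thesis by blast
  qed
  then have "cauchy_filter (filtermap (sum f) (finite_subsets_at_top F))"
    by (simp add: cauchy_filter_metric_filtermap)
  moreover have "complete (UNIV :: 'h set)"
    by (meson Cauchy_convergent UNIV_I complete_def convergent_def)
  ultimately obtain l where "(sum f \<longlongrightarrow> l) (finite_subsets_at_top F)"
    using complete_uniform[where S=UNIV] by (force simp add: filterlim_def)
  then show ?thesis unfolding summable_on_def has_sum_def by blast
qed

lemma closure_range_sequence:
  fixes y :: "'a::first_countable_topology"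
  assumes "y \<in> closure (range f)"
  obtains \<xi> where "(\<lambda>n. f (\<xi> n)) \<longlonglongrightarrow> y"
proof -
  obtain a where a: "\<And>n. a n \<in> range f" "a \<longlonglongrightarrow> y"
    using assms unfolding closure_sequential by blast
  have "(\<lambda>n. f (inv_into UNIV f (a n))) = a" using a(1) by (simp add: f_inv_into_f)
  then show thesis using that[of "\<lambda>n. inv_into UNIV f (a n)"] a(2) by simp
qed

text \<open>The map from \<open>s \<xi>\<close> to \<open>x \<xi>\<close> is isometric, so it
  extends to the closure of the range of \<open>s\<close>; \<open>v\<close> is this extension after
  \<open>P\<close>. Its description by approximating sequences lets each later identity for
  \<open>v\<close> be checked on a suitable sequence.\<close>

lemma isometric_extension:
  fixes x s :: "'h::chilbert_space op"
  assumes iso: "\<And>\<xi>. norm (app x \<xi>) = norm (app s \<xi>)"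
    and P: "proj P" "\<And>\<xi>. app P \<xi> \<in> closure (range (app s))"
  obtains v where "\<And>\<xi> \<eta>. (\<lambda>n. app s (\<xi> n)) \<longlonglongrightarrow> app P \<eta> \<Longrightarrow> (\<lambda>n. app x (\<xi> n)) \<longlonglongrightarrow> app v \<eta>"
proof -
  have "\<exists>\<xi>. (\<lambda>n. app s (\<xi> n)) \<longlonglongrightarrow> app P \<eta>" for \<eta>
    by (rule closure_range_sequence[OF P(2)]) (rule exI)
  then have "\<forall>\<eta>. \<exists>\<xi>. (\<lambda>n. app s (\<xi> n)) \<longlonglongrightarrow> app P \<eta>" by blast
  from choice[OF this] obtain X where X: "\<And>\<eta>. (\<lambda>n. app s (X \<eta> n)) \<longlonglongrightarrow> app P \<eta>" by blast
  have eq: "norm (app x a - app x b) = norm (app s a - app s b)" for a b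
    using iso[of "a - b"] by (simp add: app_diff)
  have "convergent (\<lambda>n. app x (X \<eta> n))" for \<eta>
  proof -
    have "Cauchy (\<lambda>n. app s (X \<eta> n))" using X by (intro LIMSEQ_imp_Cauchy)
    then have "Cauchy (\<lambda>n. app x (X \<eta> n))" unfolding Cauchy_iff eq .
    then show ?thesis by (rule Cauchy_convergent)
  qed
  then have "\<forall>\<eta>. \<exists>l. (\<lambda>n. app x (X \<eta> n)) \<longlonglongrightarrow> l" unfolding convergent_def by blast
  from choice[OF this] obtain f where f: "\<And>\<eta>. (\<lambda>n. app x (X \<eta> n)) \<longlonglongrightarrow> f \<eta>" by blast
  have lim: "(\<lambda>n. app x (\<xi> n)) \<longlonglongrightarrow> f \<eta>" if "(\<lambda>n. app s (\<xi> n)) \<longlonglongrightarrow> app P \<eta>" for \<xi> \<eta>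
  proof -
    have "(\<lambda>n. norm (app s (\<xi> n) - app s (X \<eta> n))) \<longlonglongrightarrow> norm (app P \<eta> - app P \<eta>)"
      by (intro tendsto_intros that X)
    then have "(\<lambda>n. app x (\<xi> n) - app x (X \<eta> n)) \<longlonglongrightarrow> 0"
      by (simp add: tendsto_norm_zero_iff flip: eq)
    from tendsto_add[OF this f[of \<eta>]] show ?thesis by simp
  qed
  have uniq: "f \<eta> = l" if "(\<lambda>n. app s (\<xi> n)) \<longlonglongrightarrow> app P \<eta>" "(\<lambda>n. app x (\<xi> n)) \<longlonglongrightarrow> l" for \<xi> \<eta> l
    using lim[OF that(1)] that(2) LIMSEQ_unique by blast
  have add: "f (a + b) = f a + f b" for a b
  proof (rule uniq)
    show "(\<lambda>n. app s (X a n + X b n)) \<longlonglongrightarrow> app P (a + b)"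
      "(\<lambda>n. app x (X a n + X b n)) \<longlonglongrightarrow> f a + f b"
      by (simp_all add: app_add) (intro tendsto_intros X f)+
  qed
  have scale: "f (c *\<^sub>C a) = c *\<^sub>C f a" for c a
  proof (rule uniq)
    show "(\<lambda>n. app s (c *\<^sub>C X a n)) \<longlonglongrightarrow> app P (c *\<^sub>C a)"
      "(\<lambda>n. app x (c *\<^sub>C X a n)) \<longlonglongrightarrow> c *\<^sub>C f a"
      by (simp_all add: app_scaleC) (intro bounded_linear.tendsto[OF bounded_linear_scaleC] X f)+
  qed
  have bound: "norm (f a) \<le> norm P * norm a" for a
  proof -
    have "(\<lambda>n. norm (app x (X a n))) \<longlonglongrightarrow> norm (f a)" by (intro tendsto_intros f)
    moreover have "(\<lambda>n. norm (app s (X a n))) \<longlonglongrightarrow> norm (app P a)" by (intro tendsto_intros X)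
    ultimately have "norm (f a) = norm (app P a)" unfolding iso using LIMSEQ_unique by blast
    then show ?thesis using norm_app[of P a] by simp
  qed
  obtain v where v: "\<And>a. app v a = f a" using op_exists[of f, OF add scale bound] by blast
  show thesis by (rule that[of v], unfold v) (rule lim)
qed

subsection \<open>Von Neumann algebras\<close>

definition op_commutant :: "'h::chilbert_space op set \<Rightarrow> 'h op set" where
  "op_commutant A = {T. \<forall>S\<in>A. T * S = S * T}"

locale concrete_vn_algebra =
  fixes M :: "'h::chilbert_space op set"
  assumes star_closed: "x \<in> M \<Longrightarrow> star x \<in> M"
    and bicommutant: "op_commutant (op_commutant M) = M"
begin

lemma memI: "(\<And>T. T \<in> op_commutant M \<Longrightarrow> x * T = T * x) \<Longrightarrow> x \<in> M"
  using bicommutant by (auto simp: op_commutant_def)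

lemma memD: "x \<in> M \<Longrightarrow> T \<in> op_commutant M \<Longrightarrow> T * x = x * T"
  by (auto simp: op_commutant_def)

lemma memD_app: "x \<in> M \<Longrightarrow> T \<in> op_commutant M \<Longrightarrow> app T (app x u) = app x (app T u)"
  by (metis memD app_times)

lemma star_commutant:
  assumes "T \<in> op_commutant M"
  shows "star T \<in> op_commutant M"
  unfolding op_commutant_def
proof (intro CollectI ballI)
  fix S assume "S \<in> M"
  then have "T * star S = star S * T" using memD star_closed assms by blast
  from arg_cong[OF this, of star] show "star T * S = S * star T" by simp
qed

lemma ring_ops:
  shows "1 \<in> M" "x \<in> M \<Longrightarrow> y \<in> M \<Longrightarrow> x + y \<in> M" "x \<in> M \<Longrightarrow> y \<in> M \<Longrightarrow> x - y \<in> M"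
    "x \<in> M \<Longrightarrow> y \<in> M \<Longrightarrow> x * y \<in> M" "x \<in> M \<Longrightarrow> r *\<^sub>R x \<in> M"
proof -
  show "1 \<in> M" by (rule memI) simp
  show "x + y \<in> M" if "x \<in> M" "y \<in> M"
  proof (rule memI)
    fix T assume T: "T \<in> op_commutant M"
    show "(x + y) * T = T * (x + y)"
      using memD[OF that(1) T] memD[OF that(2) T] by (simp add: distrib_left distrib_right)
  qed
  show "x - y \<in> M" if "x \<in> M" "y \<in> M"
  proof (rule memI)
    fix T assume T: "T \<in> op_commutant M"
    show "(x - y) * T = T * (x - y)"
      using memD[OF that(1) T] memD[OF that(2) T] by (simp add: left_diff_distrib right_diff_distrib)
  qed
  show "x * y \<in> M" if "x \<in> M" "y \<in> M"
  proof (rule memI)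
    fix T assume T: "T \<in> op_commutant M"
    show "x * y * T = T * (x * y)"
      using memD[OF that(1) T] memD[OF that(2) T] by (metis mult.assoc)
  qed
  show "r *\<^sub>R x \<in> M" if "x \<in> M" by (rule memI) (simp add: memD[OF that])
qed

text \<open>The complement of \<open>p\<close> is the projection \<open>n\<close> to the common
  kernel of the \<open>star x\<close>. The commutant leaves this kernel invariant, so
  \<open>n\<close> lies in the bicommutant.\<close>

lemma concrete_baer:
  assumes F: "F \<subseteq> M"
  shows "\<exists>p\<in>M. proj p \<and> (\<forall>x\<in>F. p * x = x) \<and> (\<forall>y\<in>M. (\<forall>x\<in>F. y * x = 0) \<longrightarrow> y * p = 0)"
proof -
  define K where "K = {u. \<forall>x\<in>F. app (star x) u = 0}"
  have "K = (\<Inter>x\<in>F. {u. app (star x) u = 0})" by (auto simp: K_def)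
  moreover have "closed {u. app (star x) u = 0}" for x
    by (intro closed_Collect_eq linear_continuous_on bounded_linear_app continuous_on_const)
  ultimately have "closed K" by auto
  then obtain n where n: "proj n" "\<And>u. app n u \<in> K" "\<And>u. u \<in> K \<Longrightarrow> app n u = u"
    using projection_exists[of K] by (auto simp: K_def app_add app_scaleC scaleC_zero)
  have TK: "app T u \<in> K" if "T \<in> op_commutant M" "u \<in> K" for T u
    using that F star_closed by (auto simp: K_def simp flip: memD_app)
  have "n \<in> M"
  proof (rule memI)
    fix T assume "T \<in> op_commutant M"
    then show "n * T = T * n" using TK star_commutant by (intro proj_commute_invariant[OF n]) auto
  qed
  have "star x * n = 0" if "x \<in> F" for x
    by (rule op_eqI) (use n(2) that in \<open>auto simp: K_def\<close>)
  then have "star (star x * n) = star 0" if "x \<in> F" for x using that by simp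
  then have nx: "n * x = 0" if "x \<in> F" for x
    using that n(1) by (simp add: proj_def)
  have "y * n = y" if y: "\<forall>x\<in>F. y * x = 0" for y
  proof -
    have "app (star x) (app (star y) u) = 0" if "x \<in> F" for x u
    proof -
      have "star (y * x) = 0" using y that by simp
      then have "app (star x * star y) u = 0" by simp
      then show ?thesis by simp
    qed
    then have "app n (app (star y) u) = app (star y) u" for u by (intro n(3)) (simp add: K_def)
    then have "n * star y = star y" by (intro op_eqI) simp
    from arg_cong[OF this, of star] show ?thesis using n(1) by (simp add: proj_def)
  qed
  then show ?thesis
    using nx n(1) \<open>n \<in> M\<close> ring_ops by (intro bexI[of _ "1 - n"]) (auto simp: proj_compl algebra_simps)
qed

text \<open>The sum converges pointwise, and every claim is then evaluated term by term;
  orthogonality leaves at most one nonzero term.\<close>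

lemma concrete_orthogonal_sum:
  assumes F: "F \<subseteq> M" "\<forall>v\<in>F. pisom v" "\<forall>v\<in>F. \<forall>w\<in>F. v \<noteq> w \<longrightarrow> star v * w = 0 \<and> v * star w = 0"
  shows "\<exists>X\<in>M. (\<forall>v\<in>F. X * star v = v * star v \<and> star v * X = star v * v) \<and>
        (\<forall>y\<in>M. (\<forall>v\<in>F. y * v = 0) \<longrightarrow> y * X = 0) \<and>
        (\<forall>y\<in>M. (\<forall>v\<in>F. v * y = 0) \<longrightarrow> X * y = 0)"
proof -
  have sq: "(norm (\<Sum>v\<in>A. app v x))\<^sup>2 = (\<Sum>v\<in>A. (norm (app v x))\<^sup>2)"
      "(\<Sum>v\<in>A. (norm (app v x))\<^sup>2) \<le> (norm x)\<^sup>2" if "finite A" "A \<subseteq> F" for A x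
    using that F by (intro norm_app_sq_pisom_sum; blast)+
  have summ: "(\<lambda>v. app v x) summable_on F" for x
    using sq by (intro orthogonal_summable[of F _ "(norm x)\<^sup>2"])
  define f where "f x = infsum (\<lambda>v. app v x) F" for x
  have hs: "((\<lambda>v. app v x) has_sum f x) F" for x unfolding f_def using summ by simp
  have uniq: "f x = l" if "((\<lambda>v. app v x) has_sum l) F" for x l
    using hs that has_sum_unique by blast
  have add: "f (x + y) = f x + f y" for x y
    by (rule uniq) (use has_sum_add[OF hs hs] in \<open>simp add: app_add\<close>)
  have scale: "f (c *\<^sub>C x) = c *\<^sub>C f x" for c x
    by (rule uniq) (use has_sum_bounded_linear[OF bounded_linear_scaleC hs] in \<open>simp add: app_scaleC\<close>)
  have bound: "norm (f x) \<le> 1 * norm x" for x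
  proof -
    have "((\<lambda>A. norm (\<Sum>v\<in>A. app v x)) \<longlongrightarrow> norm (f x)) (finite_subsets_at_top F)"
      using hs[of x] unfolding has_sum_def by (rule tendsto_norm)
    moreover have "norm (\<Sum>v\<in>A. app v x) \<le> norm x" if "finite A" "A \<subseteq> F" for A
    proof (rule power2_le_imp_le)
      show "(norm (\<Sum>v\<in>A. app v x))\<^sup>2 \<le> (norm x)\<^sup>2"
        unfolding sq(1)[OF that] by (rule sq(2)[OF that])
    qed simp
    then have "\<forall>\<^sub>F A in finite_subsets_at_top F. norm (\<Sum>v\<in>A. app v x) \<le> norm x"
      by (intro eventually_finite_subsets_at_top_weakI)
    ultimately have "norm (f x) \<le> norm x"
      by (rule tendsto_upperbound) (rule finite_subsets_at_top_neq_bot)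
    then show ?thesis by simp
  qed
  obtain X where X: "\<And>x. app X x = f x" using op_exists[of f 1, OF add scale bound] by blast
  have hsX: "((\<lambda>v. app v x) has_sum app X x) F" for x using hs by (simp add: X)
  have single: "((\<lambda>v. g v) has_sum g w) F" if "w \<in> F" "\<And>v. v \<in> F \<Longrightarrow> v \<noteq> w \<Longrightarrow> g v = 0"
    for g :: "'h op \<Rightarrow> 'h" and w
    by (rule has_sum_finite_neutralI[of "{w}"]) (use that in auto)
  have "X \<in> M"
  proof (rule memI)
    fix T assume T: "T \<in> op_commutant M"
    show "X * T = T * X"
    proof (rule op_eqI)
      fix x
      have "((\<lambda>v. app T (app v x)) has_sum app T (app X x)) F"
        by (rule has_sum_bounded_linear[OF bounded_linear_app hsX])
      moreover have "((\<lambda>v. app T (app v x)) has_sum app X (app T x)) F"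
        using hsX[of "app T x"] by (rule has_sum_cong[THEN iffD1, rotated]) (use F T memD_app in auto)
      ultimately show "app (X * T) x = app (T * X) x" using has_sum_unique by simp
    qed
  qed
  moreover have "X * star w = w * star w" if w: "w \<in> F" for w
  proof (rule op_eqI)
    fix x
    have "((\<lambda>v. app v (app (star w) x)) has_sum app w (app (star w) x)) F"
      by (rule single[OF w]) (use F(3) w in \<open>auto simp flip: app_times\<close>)
    then show "app (X * star w) x = app (w * star w) x"
      using hsX[of "app (star w) x"] has_sum_unique by simp
  qed
  moreover have "star w * X = star w * w" if w: "w \<in> F" for w
  proof (rule op_eqI)
    fix x
    have "((\<lambda>v. app (star w) (app v x)) has_sum app (star w) (app X x)) F"
      by (rule has_sum_bounded_linear[OF bounded_linear_app hsX])
    moreover have "((\<lambda>v. app (star w) (app v x)) has_sum app (star w) (app w x)) F"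
      by (rule single[OF w]) (use F(3) w in \<open>auto simp flip: app_times\<close>)
    ultimately show "app (star w * X) x = app (star w * w) x" using has_sum_unique by simp
  qed
  moreover have "y * X = 0" if y: "\<forall>v\<in>F. y * v = 0" for y
  proof (rule op_eqI)
    fix x
    have "((\<lambda>v. app y (app v x)) has_sum app y (app X x)) F"
      by (rule has_sum_bounded_linear[OF bounded_linear_app hsX])
    moreover have "((\<lambda>v. app y (app v x)) has_sum 0) F"
      by (rule has_sum_0) (use y in \<open>simp flip: app_times\<close>)
    ultimately show "app (y * X) x = app 0 x" using has_sum_unique by simp
  qed
  moreover have "X * y = 0" if y: "\<forall>v\<in>F. v * y = 0" for y
  proof (rule op_eqI)
    fix x
    have "((\<lambda>v. app v (app y x)) has_sum 0) F"
      by (rule has_sum_0) (use y in \<open>simp flip: app_times\<close>)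
    then show "app (X * y) x = app 0 x" using hsX[of "app y x"] has_sum_unique by simp
  qed
  ultimately show ?thesis by blast
qed

text \<open>\<open>s\<close> is the absolute value of \<open>x\<close>, \<open>P\<close> projects to
  the closure of its range, and \<open>v\<close> extends the isometry from \<open>s u\<close> to
  \<open>x u\<close>. The norm bound is that of \<open>square_root_exists\<close>;
  \<open>concrete_polar\<close> rescales.\<close>

lemma concrete_polar_contraction:
  assumes x: "x \<in> M" "norm x \<le> 1"
  shows "\<exists>v\<in>M. pisom v \<and> (\<forall>y\<in>M. y * x = 0 \<longleftrightarrow> y * v = 0) \<and> (\<forall>y\<in>M. x * y = 0 \<longleftrightarrow> v * y = 0)"
proof -
  obtain s where s: "star s = s" "s * s = star x * x" "norm (s - (1 / 2) *\<^sub>R 1) \<le> 1 / 2"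
    and scomm: "\<And>m. m * (star x * x) = star x * x * m \<Longrightarrow> m * s = s * m"
    using square_root_exists[OF x(2)] by blast
  have xx: "star x * x \<in> M" by (intro ring_ops(4) star_closed x)
  have sM: "s \<in> M"
    by (rule memI) (rule scomm[OF memD[OF xx], symmetric])
  have iso: "norm (app x u) = norm (app s u)" for u
  proof -
    have "inner (app x u) (app x u) = inner u (app (star x * x) u)" by (simp add: inner_star)
    also have "\<dots> = inner (app s u) (app s u)" by (simp add: inner_star s(1) flip: s(2))
    finally show ?thesis by (simp add: norm_eq_sqrt_inner)
  qed
  define K where "K = closure (range (app s))"
  have clK: "closed K" by (simp add: K_def)
  have zeroK: "0 \<in> K" unfolding K_def by (metis app_zero rangeI closure_subset subsetD)
  have addK: "a + b \<in> K" if "a \<in> K" "b \<in> K" for a b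
  proof -
    obtain \<alpha> where "(\<lambda>n. app s (\<alpha> n)) \<longlonglongrightarrow> a"
      using \<open>a \<in> K\<close> unfolding K_def by (rule closure_range_sequence)
    moreover obtain \<beta> where "(\<lambda>n. app s (\<beta> n)) \<longlonglongrightarrow> b"
      using \<open>b \<in> K\<close> unfolding K_def by (rule closure_range_sequence)
    ultimately have "(\<lambda>n. app s (\<alpha> n + \<beta> n)) \<longlonglongrightarrow> a + b" by (simp add: app_add tendsto_add)
    then show ?thesis unfolding K_def closure_sequential
      by (intro exI[of _ "\<lambda>n. app s (\<alpha> n + \<beta> n)"]) simp
  qed
  have inv: "h a \<in> K" if h: "bounded_linear h" "\<And>u. h (app s u) \<in> range (app s)" and "a \<in> K" for h a
  proof -
    obtain \<alpha> where "(\<lambda>n. app s (\<alpha> n)) \<longlonglongrightarrow> a"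
      using \<open>a \<in> K\<close> unfolding K_def by (rule closure_range_sequence)
    then have "(\<lambda>n. h (app s (\<alpha> n))) \<longlonglongrightarrow> h a" by (rule bounded_linear.tendsto[OF h(1)])
    then show ?thesis unfolding K_def closure_sequential
      by (intro exI[of _ "\<lambda>n. h (app s (\<alpha> n))"]) (simp add: h(2))
  qed
  have scaleK: "c *\<^sub>C a \<in> K" if "a \<in> K" for c a
    by (rule inv[OF bounded_linear_scaleC _ that]) (metis app_scaleC rangeI)
  obtain P where P: "proj P" "\<And>u. app P u \<in> K" "\<And>u. u \<in> K \<Longrightarrow> app P u = u"
    using projection_exists[OF zeroK addK scaleK clK] by blast
  have P': "star P = P" "P * P = P" using P by (auto simp: proj_def)
  have TK: "app T u \<in> K" if "T \<in> op_commutant M" "u \<in> K" for T u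
    by (rule inv[OF bounded_linear_app _ that(2)]) (simp add: memD_app[OF sM that(1)])
  have PM: "P \<in> M"
  proof (rule memI)
    fix T assume "T \<in> op_commutant M"
    then show "P * T = T * P" using TK star_commutant by (intro proj_commute_invariant[OF P]) auto
  qed
  have sK: "app s u \<in> K" for u unfolding K_def by (rule subsetD[OF closure_subset rangeI])
  have Ps: "P * s = s" by (rule op_eqI) (simp add: P sK)
  have sP: "s * P = s" using arg_cong[OF Ps, of star] P' s(1) by simp
  have annP: "y * s = 0 \<longleftrightarrow> y * P = 0" for y
  proof
    assume ys: "y * s = 0"
    show "y * P = 0"
    proof (rule op_eqI)
      fix u
      have "K \<subseteq> {w. app y w = 0}"
        unfolding K_def
      proof (rule closure_minimal)
        show "closed {w. app y w = 0}"
          by (intro closed_Collect_eq linear_continuous_on bounded_linear_app continuous_on_const)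
        show "range (app s) \<subseteq> {w. app y w = 0}"
          using ys by (auto simp flip: app_times)
      qed
      then show "app (y * P) u = app 0 u" using P(2)[of u] by auto
    qed
  next
    assume "y * P = 0"
    then show "y * s = 0" using Ps by (metis mult.assoc mult_zero_left)
  qed
  obtain v where v: "\<And>\<xi> \<eta>. (\<lambda>n. app s (\<xi> n)) \<longlonglongrightarrow> app P \<eta> \<Longrightarrow> (\<lambda>n. app x (\<xi> n)) \<longlonglongrightarrow> app v \<eta>"
    using isometric_extension[OF iso P(1,2)[unfolded K_def]] by blast
  have ex: "\<exists>\<xi>. (\<lambda>n. app s (\<xi> n)) \<longlonglongrightarrow> app P \<eta>" for \<eta>
    by (rule closure_range_sequence[OF P(2)[unfolded K_def]]) (rule exI)
  have vs: "v * s = x"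
  proof (rule op_eqI)
    fix u
    have "(\<lambda>n. app s u) \<longlonglongrightarrow> app P (app s u)" using P(3)[OF sK] by simp
    from v[OF this] show "app (v * s) u = app x u" by (simp add: LIMSEQ_const_iff)
  qed
  have vP: "v * P = v"
  proof (rule op_eqI)
    fix u
    obtain \<xi> where \<xi>: "(\<lambda>n. app s (\<xi> n)) \<longlonglongrightarrow> app P u" using ex by blast
    then have "(\<lambda>n. app s (\<xi> n)) \<longlonglongrightarrow> app P (app P u)" using P by simp
    from v[OF this] v[OF \<xi>] show "app (v * P) u = app v u" using LIMSEQ_unique by simp
  qed
  have vM: "v \<in> M"
  proof (rule memI)
    fix T assume T: "T \<in> op_commutant M"
    show "v * T = T * v"
    proof (rule op_eqI)
      fix u
      obtain \<xi> where \<xi>: "(\<lambda>n. app s (\<xi> n)) \<longlonglongrightarrow> app P u" using ex by blast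
      have "(\<lambda>n. app s (app T (\<xi> n))) \<longlonglongrightarrow> app P (app T u)"
        using tendsto_app[OF \<xi>, of T] by (simp add: memD_app[OF sM T] memD_app[OF PM T])
      from v[OF this] have "(\<lambda>n. app T (app x (\<xi> n))) \<longlonglongrightarrow> app v (app T u)"
        by (simp add: memD_app[OF x(1) T])
      then show "app (v * T) u = app (T * v) u"
        using tendsto_app[OF v[OF \<xi>], of T] LIMSEQ_unique by simp
    qed
  qed
  \<comment> \<open>\<open>star v * v = P\<close> comes from cancelling \<open>s\<close> on each
    side of \<open>s * (star v * v) * s = s * s\<close>; each cancellation trades an annihilated
    \<open>s\<close> for an annihilated \<open>P\<close>.\<close>
  have "s * (star v * v) * s = star (v * s) * (v * s)" by (simp add: s(1) mult.assoc)
  then have "(s * (star v * v) - s) * s = 0" by (simp add: vs s(2) left_diff_distrib)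
  then have "(s * (star v * v) - s) * P = 0" by (simp add: annP)
  then have "s * (star v * v) = s" using vP sP by (simp add: left_diff_distrib mult.assoc)
  from arg_cong[OF this, of star] have "(star v * v - 1) * s = 0" by (simp add: s(1) algebra_simps)
  then have "(star v * v - 1) * P = 0" by (simp add: annP)
  then have vv: "star v * v = P" using vP by (simp add: left_diff_distrib mult.assoc)
  have "pisom v" using vv P(1) by (simp add: pisom_iff)
  moreover have "y * x = 0 \<longleftrightarrow> y * v = 0" for y
  proof -
    have "y * x = 0 \<longleftrightarrow> y * v * s = 0" by (simp add: vs mult.assoc)
    also have "\<dots> \<longleftrightarrow> y * v * P = 0" by (rule annP)
    finally show ?thesis by (simp add: vP mult.assoc)
  qed
  moreover have "x * y = 0 \<longleftrightarrow> v * y = 0" for y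
  proof
    assume "x * y = 0"
    then have "v * (s * y) = 0" by (simp add: flip: vs mult.assoc)
    then have "P * (s * y) = 0" by (simp add: mult.assoc flip: vv)
    then have "s * y = 0" using mult_assoc_rewrite[OF Ps] by simp
    then have "star (s * y) = star 0" by simp
    then have "star y * s = 0" by (simp only: star_mult s(1) star_zero)
    then have "star (star y * P) = star 0" by (simp add: annP)
    then have "P * y = 0" by (simp only: star_mult star_star P' star_zero)
    then show "v * y = 0" using mult_assoc_rewrite[OF vP, of y] by simp
  next
    assume "v * y = 0"
    then have "P * y = 0" by (simp add: mult.assoc flip: vv)
    then have "s * y = 0" using mult_assoc_rewrite[OF sP, of y] by simp
    then show "x * y = 0" by (simp add: mult.assoc flip: vs)
  qed
  ultimately show ?thesis using vM by blast
qed

lemma concrete_polar: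
  assumes x: "x \<in> M"
  shows "\<exists>v\<in>M. pisom v \<and> (\<forall>y\<in>M. y * x = 0 \<longleftrightarrow> y * v = 0) \<and> (\<forall>y\<in>M. x * y = 0 \<longleftrightarrow> v * y = 0)"
proof (cases "x = 0")
  case True
  then show ?thesis using x by (intro bexI[of _ 0]) (auto simp: pisom_def)
next
  case False
  define x' where "x' = (1 / norm x) *\<^sub>R x"
  have "y * x' = 0 \<longleftrightarrow> y * x = 0" "x' * y = 0 \<longleftrightarrow> x * y = 0" for y
    using False by (simp_all add: x'_def)
  moreover have "x' \<in> M" "norm x' \<le> 1" using x ring_ops False by (auto simp: x'_def)
  ultimately show ?thesis using concrete_polar_contraction[of x'] by simp
qed

lemma concrete_absolute_value:
  assumes x: "x \<in> M" "star x = x" "norm x \<le> r"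
  shows "\<exists>a\<in>M. star a = a \<and> a * x = x * a \<and> a * a = x * x \<and> norm (a - (r / 2) *\<^sub>R 1) \<le> r / 2"
proof (cases "r = 0")
  case True
  then have "x = 0" using x(3) by simp
  then show ?thesis using True x by (intro bexI[of _ 0]) auto
next
  case False
  then have r: "r > 0" using x(3) norm_ge_zero[of x] by linarith
  define x' where "x' = (1 / r) *\<^sub>R x"
  have "norm x' \<le> 1" using r x(3) by (simp add: x'_def)
  then obtain s where s: "star s = s" "s * s = star x' * x'" "norm (s - (1 / 2) *\<^sub>R 1) \<le> 1 / 2"
    "\<And>m. m * (star x' * x') = star x' * x' * m \<Longrightarrow> m * s = s * m"
    using square_root_exists[of x'] by blast
  have x'M: "x' \<in> M" using ring_ops(5)[OF x(1)] by (simp add: x'_def)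
  have sM: "s \<in> M"
  proof (rule memI)
    fix T assume T: "T \<in> op_commutant M"
    have "star x' * x' \<in> M" by (intro ring_ops(4) star_closed x'M)
    from s(4)[OF memD[OF this T]] show "s * T = T * s" by simp
  qed
  have xs: "x * s = s * x" by (rule s(4)) (simp add: x'_def x(2) mult.assoc)
  show ?thesis
  proof (intro bexI conjI)
    show "r *\<^sub>R s \<in> M" by (rule ring_ops(5)[OF sM])
    show "star (r *\<^sub>R s) = r *\<^sub>R s" by (simp add: s)
    show "r *\<^sub>R s * x = x * (r *\<^sub>R s)" by (simp add: xs)
    show "r *\<^sub>R s * (r *\<^sub>R s) = x * x" using r by (simp add: s(2) x'_def x(2))
    have "r *\<^sub>R s - (r / 2) *\<^sub>R 1 = r *\<^sub>R (s - (1 / 2) *\<^sub>R 1)" by (simp add: scaleR_diff_right)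
    then have "norm (r *\<^sub>R s - (r / 2) *\<^sub>R 1) = r * norm (s - (1 / 2) *\<^sub>R 1)" using r by simp
    also have "\<dots> \<le> r * (1 / 2)" using r s(3) by (intro mult_left_mono) auto
    finally show "norm (r *\<^sub>R s - (r / 2) *\<^sub>R 1) \<le> r / 2" by simp
  qed
qed

sublocale vn_algebra M
  using star_closed ring_ops concrete_baer concrete_orthogonal_sum concrete_polar concrete_absolute_value
  by unfold_locales

end

section \<open>Unitary groups\<close>

lemma op_commutant_eq:
  assumes "A \<subseteq> bounded_ops"
  shows "op_commutant {T. blin T \<in> A} = {T. blin T \<in> commutant A}"
proof (intro equalityI subsetI)
  fix T assume T: "T \<in> op_commutant {T. blin T \<in> A}"
  have "blin T o\<^sub>L S = S o\<^sub>L blin T" if "S \<in> A" for S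
  proof -
    have S: "blin (Op S) = S" using that assms by (intro Op_inverse) auto
    then have "T * Op S = Op S * T" using T that by (auto simp: op_commutant_def)
    then show ?thesis by (metis S times_op.rep_eq)
  qed
  then show "T \<in> {T. blin T \<in> commutant A}" by (simp add: commutant_def)
next
  fix T assume "T \<in> {T. blin T \<in> commutant A}"
  then show "T \<in> op_commutant {T. blin T \<in> A}"
    by (auto simp: commutant_def op_commutant_def blin_inject[symmetric] times_op.rep_eq)
qed

lemma blin_star: "blin (star T) = hilbert_adjoint (blin T)"
  by (simp add: star_op_def adj.rep_eq)

lemma word_power_set_power:
  assumes "x \<in> word_power W k" and "\<And>w. w \<in> W \<Longrightarrow> blin w \<in> V"
  shows "blin x \<in> set_power (unitary_group M) V k"
  using assms(1)
proof (induction k arbitrary: x)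
  case 0
  then show ?case by (simp add: set_power_def unitary_group_def one_op.rep_eq)
next
  case (Suc k)
  then obtain w v where wv: "x = w * v" "w \<in> W" "v \<in> word_power W k" by auto
  from Suc.IH[OF wv(3)] obtain ws where ws: "length ws = k" "set ws \<subseteq> V"
    "blin v = foldr (\<lambda>w v. w \<otimes>\<^bsub>unitary_group M\<^esub> v) ws \<one>\<^bsub>unitary_group M\<^esub>"
    by (auto simp: set_power_def)
  have "blin x = foldr (\<lambda>w v. w \<otimes>\<^bsub>unitary_group M\<^esub> v) (blin w # ws) \<one>\<^bsub>unitary_group M\<^esub>"
    using ws(3) by (simp add: wv(1) times_op.rep_eq unitary_group_def)
  then show ?case unfolding set_power_def
    using ws wv assms(2) by (intro CollectI exI[of _ "blin w # ws"]) auto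
qed

lemma set_power_subset:
  assumes "group G" "W \<subseteq> carrier G"
  shows "set_power G W k \<subseteq> carrier G"
proof -
  interpret group G by fact
  have "foldr (\<lambda>w v. w \<otimes>\<^bsub>G\<^esub> v) ws \<one>\<^bsub>G\<^esub> \<in> carrier G" if "set ws \<subseteq> W" for ws
    using that assms(2) by (induction ws) auto
  then show ?thesis by (auto simp: set_power_def)
qed

theorem theorem1p2:
  fixes M :: "('h::chilbert_space \<Rightarrow>\<^sub>L 'h) set"
  assumes "von_neumann_algebra M"
    and "properly_infinite M"
  shows "strong_uncountable_cofinality 96 (unitary_group M)"
proof -
  define N where "N = {T. blin T \<in> M}"
  have Mb: "M \<subseteq> bounded_ops" and Mstar: "\<And>T. T \<in> M \<Longrightarrow> hilbert_adjoint T \<in> M"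
    and Mcc: "commutant (commutant M) = M"
    using assms(1) by (auto simp: von_neumann_algebra_def)
  have blin_Op: "blin (Op T) = T" if "T \<in> M" for T using that Mb by (intro Op_inverse) auto
  have OpN: "Op T \<in> N" if "T \<in> M" for T using that blin_Op by (simp add: N_def)
  have "commutant M \<subseteq> bounded_ops" by (auto simp: commutant_def)
  then have "op_commutant (op_commutant N) = N"
    unfolding N_def by (simp add: op_commutant_eq Mb Mcc)
  moreover have "star T \<in> N" if "T \<in> N" for T using that Mstar by (simp add: N_def blin_star)
  ultimately interpret concrete_vn_algebra N by unfold_locales
  have blin_eq: "blin S = blin T \<longleftrightarrow> S = T" for S T :: "'h op" by (rule blin_inject)
  interpret properly_infinite_algebra N
  proof
    fix z assume z: "central z" "z \<noteq> 0"
    have "blin z \<in> projections M"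
      using z(1) unfolding central_def proj_def projections_def
      by (simp add: N_def blin_eq flip: blin_star times_op.rep_eq)
    moreover have "blin z o\<^sub>L T = T o\<^sub>L blin z" if "T \<in> M" for T
      using centralD(3)[OF z(1) OpN[OF that]] blin_Op[OF that] by (metis times_op.rep_eq)
    ultimately have "blin z \<in> central_projections M" by (simp add: central_projections_def)
    moreover have "blin z \<noteq> 0" using z(2) by (metis blin_eq zero_op.rep_eq)
    ultimately obtain q x where q: "proper_subprojection q (blin z)" and x: "x \<in> M"
      "hilbert_adjoint x o\<^sub>L x = blin z" "x o\<^sub>L hilbert_adjoint x = q"
      using assms(2) unfolding properly_infinite_def equivalent_projections_def by blast
    define w where "w = Op x"
    have w: "blin w = x" "w \<in> N" using x(1) by (simp_all add: w_def blin_Op OpN)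
    have "blin (star w * w) = blin z" using w x by (simp add: times_op.rep_eq blin_star)
    moreover have wq: "blin (w * star w) = q" using w x by (simp add: times_op.rep_eq blin_star)
    moreover have "blin (z * (w * star w)) = blin (w * star w)" "w * star w \<noteq> z"
      using q wq by (auto simp: proper_subprojection_def times_op.rep_eq[of z])
    ultimately show "\<exists>w\<in>N. star w * w = z \<and> z * (w * star w) = w * star w \<and> w * star w \<noteq> z"
      using w(2) by (auto simp: blin_eq)
  qed
  let ?G = "unitary_group M"
  have carrier: "carrier ?G = blin ` {u. uni u}"
  proof (intro equalityI subsetI)
    fix g assume "g \<in> carrier ?G"
    then have g: "g \<in> M" "g o\<^sub>L hilbert_adjoint g = id_blinfun" "hilbert_adjoint g o\<^sub>L g = id_blinfun"
      by (auto simp: unitary_group_def)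
    have b: "blin (Op g) = g" using g(1) by (rule blin_Op)
    have "blin (Op g * star (Op g)) = blin 1" "blin (star (Op g) * Op g) = blin 1"
      using g by (simp_all add: times_op.rep_eq blin_star one_op.rep_eq b)
    then have "uni (Op g)" using OpN[OF g(1)] by (simp add: uni_def blin_eq)
    then show "g \<in> blin ` {u. uni u}" using b by (metis imageI mem_Collect_eq)
  next
    fix g assume "g \<in> blin ` {u. uni u}"
    then obtain u where u: "g = blin u" "uni u" by auto
    have "blin (u * star u) = blin 1" "blin (star u * u) = blin 1" "u \<in> N"
      using u(2) by (auto simp: uni_def)
    then show "g \<in> carrier ?G"
      by (simp add: unitary_group_def u(1) N_def times_op.rep_eq blin_star one_op.rep_eq)
  qed
  have group: "group ?G"
  proof (rule groupI)
    fix x y assume "x \<in> carrier ?G" "y \<in> carrier ?G"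
    then obtain u v where "x = blin u" "y = blin v" "uni u" "uni v" by (auto simp: carrier)
    then show "x \<otimes>\<^bsub>?G\<^esub> y \<in> carrier ?G"
      unfolding carrier by (auto simp: unitary_group_def uni_mult simp flip: times_op.rep_eq)
  next
    show "\<one>\<^bsub>?G\<^esub> \<in> carrier ?G"
      unfolding carrier using uni_one by (auto simp: unitary_group_def simp flip: one_op.rep_eq)
  next
    fix x assume "x \<in> carrier ?G"
    then obtain u where u: "x = blin u" "uni u" by (auto simp: carrier)
    show "\<exists>y\<in>carrier ?G. y \<otimes>\<^bsub>?G\<^esub> x = \<one>\<^bsub>?G\<^esub>"
      unfolding carrier
      using u uni_star[OF u(2)] uniD(2)[OF u(2)]
      by (intro bexI[of _ "blin (star u)"])
         (auto simp: unitary_group_def simp flip: one_op.rep_eq times_op.rep_eq)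
  qed (auto simp: unitary_group_def intro!: blinfun_eqI)
  show ?thesis
    unfolding strong_uncountable_cofinality_def
  proof (intro conjI group allI impI)
    fix W :: "nat \<Rightarrow> ('h \<Rightarrow>\<^sub>L 'h) set"
    assume W: "(\<forall>n. W n \<subseteq> carrier ?G) \<and> (\<forall>n. W n \<subseteq> W (Suc n)) \<and> (\<Union>n. W n) = carrier ?G"
    \<comment> \<open>The symmetric part of \<open>W n\<close>. Since the chain increases, every
      unitary still enters together with its adjoint at some stage.\<close>
    define V where "V n = {u. uni u \<and> blin u \<in> W n \<and> blin (star u) \<in> W n}" for n
    have mono: "W m \<subseteq> W n" if "m \<le> n" for m n
      using lift_Suc_mono_le[of W m n] W that by blast
    have ex: "\<exists>n. u \<in> V n" if u: "uni u" for u
    proof -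
      have "blin u \<in> carrier ?G" "blin (star u) \<in> carrier ?G" using u uni_star by (auto simp: carrier)
      then obtain m n where "blin u \<in> W m" "blin (star u) \<in> W n" using W by blast
      then have "u \<in> V (max m n)" using u mono[of m "max m n"] mono[of n "max m n"] by (auto simp: V_def)
      then show ?thesis by blast
    qed
    obtain n where n: "\<And>u. uni u \<Longrightarrow> u \<in> word_power (V n) 60" "1 \<in> V n"
    proof (rule unitary_word_bound[of V])
      show "V n \<subseteq> V (Suc n)" for n using W by (auto simp: V_def)
    qed (use ex in \<open>auto simp: V_def uni_star\<close>)
    have "carrier ?G \<subseteq> set_power ?G (W n) 96"
    proof
      fix g assume "g \<in> carrier ?G"
      then obtain u where u: "g = blin u" "uni u" by (auto simp: carrier)
      \<comment> \<open>Words of length 60 are padded with 36 factors \<open>1\<close>.\<close>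
      have "u \<in> word_power (V n) 96" by (rule word_power_mono[OF n(2) n(1)[OF u(2)]]) simp
      then show "g \<in> set_power ?G (W n) 96"
        unfolding u(1) by (rule word_power_set_power) (simp add: V_def)
    qed
    then show "\<exists>n. set_power ?G (W n) 96 = carrier ?G"
      using set_power_subset[OF group, of "W n" 96] W by blast
  qed
qed

end
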